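(* Let $\mathcal{L}\subset\operatorname{Lip}_1(\mathbb{R})$ be a monoidal subfamily. Then the $\mathcal{L}$-compact class $\mathcal{D}/\mathcal{L}$, equipped with the box distance $\Box$, is complete and separable.
   Context: Geometric data sets: a geometric data set is a triple $X=(X,F_X,\mu_X)$ where $F_X$ is a nonempty set of real-valued functions on $X$ such that $d_X(x,y):=\sup_{f\in F_X}|f(x)-f(y)|$ is a complete separable metric on $X$, and $\mu_X$ is a Borel probability measure with full support on $(X,d_X)$. $\overline{F_X}$ denotes the closure of $F_X$ under pointwise convergence. $X$ and $Y$ are isomorphic if there is a bijection $\varphi:X\to Y$ with $\varphi_*\mu_X=\mu_Y$ and $\overline{F_Y}\circ\varphi=\overline{F_X}$; $\mathcal{D}$ is the set of isomorphism classes. Ky Fan metric: for a measure $\mu$ on $X$ and $\mu$-measurable $f,g:X\to\mathbb{R}$, $d_{\mathrm{KF}}^\mu(f,g):=\inf\{\epsilon\ge 0: \mu(\{|f-g|>\epsilon\})\le\epsilon\}$; $d_{\mathrm{KF}}^X:=d_{\mathrm{KF}}^{\mu_X}$. For a metric $d$, $U(A,\epsilon;d)$ is the open $\epsilon$-neighborhood of $A$ and $d_{\mathrm{H}}$ is the Hausdorff distance. Box distance: $\Pi(\mu_X,\mu_Y)$ is the set of couplings of $\mu_X,\mu_Y$. For functions on a set containing $S$ put $d_\infty^S(f,g):=\sup_{S}|f-g|$. For geometric data sets $X,Y$, $$\Box(X,Y)=\min_{\pi\in\Pi(\mu_X,\mu_Y),\ S}\max\{1-\pi(S),\,2(d_\infty^S)_{\mathrm{H}}(\overline{F_X}\circ\mathrm{pr}_1,\overline{F_Y}\circ\mathrm{pr}_2)\},$$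 where $S$ runs over nonempty closed subsets of $X\times Y$. Monoidal and $\mathcal{L}$-compact: $\operatorname{Lip}_1(\mathbb{R})$ is the set of 1-Lipschitz functions $\mathbb{R}\to\mathbb{R}$. $\mathcal{L}\subset\operatorname{Lip}_1(\mathbb{R})$ is monoidal if it contains $\mathrm{id}_{\mathbb{R}}$, is closed under composition, and is closed under pointwise convergence on $\mathbb{R}$. For a family $F$ of real-valued functions, $\mathcal{L}\circ F:=\{p\circ f: p\in\mathcal{L}, f\in F\}$. For $F\subset\overline{F_X}$ and $\epsilon>0$, $\operatorname{Cov}(F,\epsilon;\mathcal{L}):=\inf\{\#\mathcal{N}: \mathcal{N}\subset F\text{ finite}, F\subset U(\mathcal{L}\circ\mathcal{N},\epsilon;d_{\mathrm{KF}}^X)\}$. A geometric data set $X$ is $\mathcal{L}$-compact if $\mathcal{L}\circ\overline{F_X}\subset\overline{F_X}$ and $\operatorname{Cov}(\overline{F_X},\epsilon;\mathcal{L})<\infty$ for every $\epsilon>0$. $\mathcal{D}/\mathcal{L}$ is the set of isomorphism classes of $\mathcal{L}$-compact geometric data sets. *)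

theory Defs
  imports "HOL-Probability.Probability" "HOL-Library.Equipollence"
begin

section \<open>Geometric data sets\<close>

text \<open>A function on the underlying set \<open>pts X\<close> is represented by a function that is
  \<^const>\<open>extensional\<close> on \<open>pts X\<close>, so that equality is equality of functions on \<open>pts X\<close>.\<close>

record 'a data_set =
  pts :: "'a set"
  feats :: "('a \<Rightarrow> real) set"
  msr :: "'a measure"

text \<open>The value \<open>0\<close> off \<open>pts X\<close> is there because \<^locale>\<open>Metric_space\<close> asks for symmetry and
  nonnegativity on the whole type.\<close>

definition fdist :: "'a data_set \<Rightarrow> 'a \<Rightarrow> 'a \<Rightarrow> real" where
  "fdist X x y = (if x \<in> pts X \<and> y \<in> pts X then (SUP f\<in>feats X. \<bar>f x - f y\<bar>) else 0)"

abbreviation ftop :: "'a data_set \<Rightarrow> 'a topology" where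
  "ftop X \<equiv> Metric_space.mtopology (pts X) (fdist X)"

text \<open>The condition \<^const>\<open>bdd_above\<close> says that the supremum defining the metric is finite.\<close>

definition geometric_data_set :: "'a data_set \<Rightarrow> bool" where
  "geometric_data_set X \<longleftrightarrow>
     feats X \<noteq> {} \<and> feats X \<subseteq> extensional (pts X) \<and>
     (\<forall>x\<in>pts X. \<forall>y\<in>pts X. bdd_above ((\<lambda>f. \<bar>f x - f y\<bar>) ` feats X)) \<and>
     Metric_space (pts X) (fdist X) \<and>
     Metric_space.mcomplete (pts X) (fdist X) \<and>
     separable_space (ftop X) \<and>
     prob_space (msr X) \<and> space (msr X) = pts X \<and>
     sets (msr X) = sigma_sets (pts X) {U. openin (ftop X) U} \<and>
     (\<forall>U. openin (ftop X) U \<and> U \<noteq> {} \<longrightarrow> measure (msr X) U > 0)"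

definition feats_closure :: "'a data_set \<Rightarrow> ('a \<Rightarrow> real) set" where
  "feats_closure X = product_topology (\<lambda>_. euclideanreal) (pts X) closure_of feats X"

definition isomorphic :: "'a data_set \<Rightarrow> 'b data_set \<Rightarrow> bool" where
  "isomorphic X Y \<longleftrightarrow>
     (\<exists>\<phi>. bij_betw \<phi> (pts X) (pts Y) \<and>
          \<phi> \<in> measurable (msr X) (msr Y) \<and> distr (msr X) (msr Y) \<phi> = msr Y \<and>
          (\<lambda>g. compose (pts X) g \<phi>) ` feats_closure Y = feats_closure X)"

definition iso_rel :: "('a data_set \<times> 'a data_set) set" where
  "iso_rel = {(X, Y). geometric_data_set X \<and> geometric_data_set Y \<and> isomorphic X Y}"


section \<open>Box distance\<close>

definition couplings :: "'a measure \<Rightarrow> 'b measure \<Rightarrow> ('a \<times> 'b) measure set" where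
  "couplings M N =
     {\<pi>. sets \<pi> = sets (M \<Otimes>\<^sub>M N) \<and> distr \<pi> M fst = M \<and> distr \<pi> N snd = N}"

definition dsup :: "'c set \<Rightarrow> ('c \<Rightarrow> real) \<Rightarrow> ('c \<Rightarrow> real) \<Rightarrow> ennreal" where
  "dsup S f g = (SUP s\<in>S. ennreal \<bar>f s - g s\<bar>)"

definition hausdorff :: "('c \<Rightarrow> 'c \<Rightarrow> ennreal) \<Rightarrow> 'c set \<Rightarrow> 'c set \<Rightarrow> ennreal" where
  "hausdorff d A B = max (SUP a\<in>A. INF b\<in>B. d a b) (SUP b\<in>B. INF a\<in>A. d a b)"

text \<open>For arbitrary geometric data sets the value can be \<open>\<infinity>\<close>. Since \<open>S\<close> is nonempty, the triangle
  inequality can fail when its right-hand side is at least \<open>1\<close> (the minimum of \<open>1\<close> and \<open>box_dist\<close>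
  does satisfy it), so this is not packaged as a \<^locale>\<open>Metric_space\<close>.\<close>

definition box_dist :: "'a data_set \<Rightarrow> 'b data_set \<Rightarrow> ennreal" where
  "box_dist X Y =
     (INF (\<pi>, S) \<in> couplings (msr X) (msr Y) \<times>
                    {S. S \<noteq> {} \<and> closedin (prod_topology (ftop X) (ftop Y)) S}.
        max (ennreal (1 - measure \<pi> S))
            (2 * hausdorff (dsup S) ((\<lambda>f. f \<circ> fst) ` feats_closure X)
                                    ((\<lambda>g. g \<circ> snd) ` feats_closure Y)))"

text \<open>On isomorphism classes; \<^const>\<open>box_dist\<close> is invariant under isomorphism, so the choice of
  representatives does not matter.\<close>

definition box_class :: "'a data_set set \<Rightarrow> 'a data_set set \<Rightarrow> ennreal" where
  "box_class A B = box_dist (SOME X. X \<in> A) (SOME Y. Y \<in> B)"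


section \<open>Monoidal families and \<open>\<L>\<close>-compactness\<close>

text \<open>\<^const>\<open>closed\<close> on \<^typ>\<open>real \<Rightarrow> real\<close> refers to the topology of pointwise convergence.\<close>

definition monoidal :: "(real \<Rightarrow> real) set \<Rightarrow> bool" where
  "monoidal L \<longleftrightarrow>
     L \<subseteq> {p. 1-lipschitz_on UNIV p} \<and>
     id \<in> L \<and> (\<forall>p\<in>L. \<forall>q\<in>L. p \<circ> q \<in> L) \<and> closed L"

definition postcompose ::
  "'a data_set \<Rightarrow> (real \<Rightarrow> real) set \<Rightarrow> ('a \<Rightarrow> real) set \<Rightarrow> ('a \<Rightarrow> real) set" where
  "postcompose X L F = {compose (pts X) p f | p f. p \<in> L \<and> f \<in> F}"

definition ky_fan :: "'a measure \<Rightarrow> ('a \<Rightarrow> real) \<Rightarrow> ('a \<Rightarrow> real) \<Rightarrow> real" where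
  "ky_fan M f g = Inf {\<epsilon>. \<epsilon> \<ge> 0 \<and> measure M {x \<in> space M. \<bar>f x - g x\<bar> > \<epsilon>} \<le> \<epsilon>}"

definition open_nbhd :: "('c \<Rightarrow> 'c \<Rightarrow> real) \<Rightarrow> 'c set \<Rightarrow> real \<Rightarrow> 'c set" where
  "open_nbhd d A \<epsilon> = {x. \<exists>a\<in>A. d x a < \<epsilon>}"

definition Cov ::
  "'a data_set \<Rightarrow> (real \<Rightarrow> real) set \<Rightarrow> ('a \<Rightarrow> real) set \<Rightarrow> real \<Rightarrow> enat" where
  "Cov X L F \<epsilon> =
     (INF N \<in> {N. finite N \<and> N \<subseteq> F \<and> F \<subseteq> open_nbhd (ky_fan (msr X)) (postcompose X L N) \<epsilon>}.
        enat (card N))"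

definition L_compact :: "(real \<Rightarrow> real) set \<Rightarrow> 'a data_set \<Rightarrow> bool" where
  "L_compact L X \<longleftrightarrow>
     geometric_data_set X \<and>
     postcompose X L (feats_closure X) \<subseteq> feats_closure X \<and>
     (\<forall>\<epsilon>>0. Cov X L (feats_closure X) \<epsilon> < \<infinity>)"

text \<open>Isomorphism classes are formed inside a fixed type \<open>'a\<close>. A complete separable metric space
  has at most the cardinality of the continuum, so every isomorphism class of
  geometric data sets is represented here as soon as \<^typ>\<open>real\<close> embeds into \<open>'a\<close>.\<close>

definition L_compact_classes :: "(real \<Rightarrow> real) set \<Rightarrow> 'a data_set set set" where
  "L_compact_classes L = {X. L_compact L X} // iso_rel"

end

theory Submission
  imports Defs
begin

text \<open>Completeness: a box-Cauchy sequence is thinned out so that consecutive spaces are coupled up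
  to an error \<open>e n\<close> with \<open>e (Suc n) = e n / 2\<close>. Each space is cut into countably many small cells.
  The laws of the cells under consecutive couplings fit together to a Markov chain on cell indices,
  which avoids disintegration of measures. By Borel-Cantelli almost every path of the
  chain eventually stays in cells where consecutive features are matched. A sequence of consecutively
  matched features then has a limit along the path, and these limits are the features of the limit
  space, whose points are the limits of the path evaluations. A coupling of a space with the
  limit is obtained by gluing along the discrete cell index. Both the closure of the features under \<open>L\<close>
  and the finiteness of the covering numbers pass to the limit.

  Separability: by \<open>L\<close>-compactness, on finitely many cells of almost full mass the features are,
  up to a small error, the \<open>L\<close>-orbits of finitely many vectors. Hence the space is
  determined up to small box distance by finitely many rational numbers.\<close>

section \<open>Geometric data sets as metric measure spaces\<close>

text \<open>The obstacle is composing couplings together with their matching sets: the box distance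
  asks for a closed set on which all features are matched, while limits and gluings only produce
  measurable events. The relation \<open>near\<close> replaces the infima in \<open>box_dist\<close>
  by explicit real-valued witnesses, and \<open>nearI\<close> recovers a closed set from any
  sufficiently large event. Gluing at a cell index is not exact, but its cost, lost mass and the
  oscillation of features on one cell, is at most \<open>e n\<close>, the error already present at
  that stage. The limit has no ambient space: its metric is a supremum over a possibly uncountable
  set of threads. All estimates along a path are therefore uniform in the thread, and countably many
  cells, small for all threads at once, provide measurability, separability and full support. For
  separability the difficulty is that Ky Fan closeness says nothing about a single point. It does
  say something about a whole cell once the tolerance is no larger than the least mass of the chosen
  cells.\<close>

lemma in_closure_of_pointwise:
  "f \<in> product_topology (\<lambda>_. euclideanreal) S closure_of F \<longleftrightarrow>
     f \<in> extensional S \<and>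
     (\<forall>A \<delta>. finite A \<and> A \<subseteq> S \<and> \<delta> > 0 \<longrightarrow> (\<exists>g\<in>F. g \<in> extensional S \<and> (\<forall>x\<in>A. \<bar>g x - f x\<bar> < \<delta>)))"
    (is "?L = ?R")
proof
  assume L: ?L
  have f: "f \<in> extensional S"
    using L in_closure_of[of f "product_topology (\<lambda>_. euclideanreal) S" F] by (auto simp: PiE_iff)
  moreover have "\<exists>g\<in>F. g \<in> extensional S \<and> (\<forall>x\<in>A. \<bar>g x - f x\<bar> < \<delta>)"
    if "finite A" "A \<subseteq> S" "\<delta> > 0" for A and \<delta> :: real
  proof -
    let ?B = "\<lambda>x. if x \<in> A then ball (f x) \<delta> else UNIV"
    have "finite {x\<in>S. ?B x \<noteq> topspace euclideanreal}"
      using \<open>finite A\<close> by (rule finite_subset[rotated]) auto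
    then have "openin (product_topology (\<lambda>_. euclideanreal) S) (PiE S ?B)"
      unfolding openin_PiE_gen by auto
    moreover have "f \<in> PiE S ?B"
      using f that by (auto simp: PiE_iff)
    ultimately obtain g where "g \<in> F" "g \<in> PiE S ?B"
      using L unfolding in_closure_of by blast
    then show ?thesis
      using \<open>A \<subseteq> S\<close> by (intro bexI[of _ g]) (fastforce simp: PiE_iff dist_real_def abs_minus_commute)+
  qed
  ultimately show ?R by blast
next
  assume R: ?R
  show ?L
    unfolding in_closure_of
  proof (intro conjI allI impI)
    show "f \<in> topspace (product_topology (\<lambda>_. euclideanreal) S)"
      using R by (auto simp: PiE_iff extensional_def)
    fix T assume T: "f \<in> T \<and> openin (product_topology (\<lambda>_. euclideanreal) S) T"
    then obtain U where U: "finite {i \<in> S. U i \<noteq> UNIV}" "\<And>i. i \<in> S \<Longrightarrow> open (U i)"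
        "f \<in> PiE S U" "PiE S U \<subseteq> T"
      by (force simp: openin_product_topology_alt)
    let ?A = "{i \<in> S. U i \<noteq> UNIV}"
    have "\<exists>d>0. \<forall>y. \<bar>y - f i\<bar> < d \<longrightarrow> y \<in> U i" if "i \<in> S" for i
      using U(2)[OF that] U(3) that by (force simp: open_dist dist_real_def PiE_iff)
    then obtain d where d: "\<And>i. i \<in> S \<Longrightarrow> d i > (0::real)"
        "\<And>i y. i \<in> S \<Longrightarrow> \<bar>y - f i\<bar> < d i \<Longrightarrow> y \<in> U i"
      by metis
    define \<delta> where "\<delta> = Min (insert 1 (d ` ?A))"
    have "\<delta> > 0" and \<delta>: "\<And>i. i \<in> ?A \<Longrightarrow> \<delta> \<le> d i"
      unfolding \<delta>_def using U(1) d(1) by auto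
    then obtain g where g: "g \<in> F" "g \<in> extensional S" "\<And>x. x \<in> ?A \<Longrightarrow> \<bar>g x - f x\<bar> < \<delta>"
      using R U(1) by (metis (no_types, lifting) mem_Collect_eq subsetI)
    have "g i \<in> U i" if "i \<in> S" for i
      using g(3)[of i] \<delta>[of i] d(2)[OF that, of "g i"] that by (cases "U i = UNIV") auto
    then have "g \<in> PiE S U"
      using g(2) by (auto simp: PiE_iff)
    then show "\<exists>y. y \<in> F \<and> y \<in> T"
      using U(4) g(1) by blast
  qed
qed

section \<open>Feature closures: Lipschitz bound, continuity, measurability\<close>

locale gds =
  fixes X :: "'a data_set"
  assumes gds: "geometric_data_set X"
begin

sublocale metric: Metric_space "pts X" "fdist X"
  using gds by (simp add: geometric_data_set_def)

sublocale prob: prob_space "msr X"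
  using gds by (simp add: geometric_data_set_def)

lemma feats_extensional: "feats X \<subseteq> extensional (pts X)"
  and feats_nonempty: "feats X \<noteq> {}"
  and space_msr: "space (msr X) = pts X"
  and sets_msr: "sets (msr X) = sigma_sets (pts X) {U. openin (ftop X) U}"
  and bdd_feats: "x \<in> pts X \<Longrightarrow> y \<in> pts X \<Longrightarrow> bdd_above ((\<lambda>f. \<bar>f x - f y\<bar>) ` feats X)"
  and separable: "separable_space (ftop X)"
  using gds by (simp_all add: geometric_data_set_def)

lemma pts_nonempty: "pts X \<noteq> {}"
  using prob.not_empty space_msr by simp

lemma sets_msr_open: "openin (ftop X) U \<Longrightarrow> U \<in> sets (msr X)"
  by (auto simp: sets_msr)

lemma feats_closure_iff:
  "f \<in> feats_closure X \<longleftrightarrow> f \<in> extensional (pts X) \<and>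
     (\<forall>A \<delta>. finite A \<and> A \<subseteq> pts X \<and> \<delta> > 0 \<longrightarrow> (\<exists>g\<in>feats X. \<forall>x\<in>A. \<bar>g x - f x\<bar> < \<delta>))"
  unfolding feats_closure_def in_closure_of_pointwise using feats_extensional by blast

lemma feats_closure_approx:
  assumes "f \<in> feats_closure X" "finite A" "A \<subseteq> pts X" "\<delta> > 0"
  obtains g where "g \<in> feats X" "\<And>x. x \<in> A \<Longrightarrow> \<bar>g x - f x\<bar> < \<delta>"
  using assms feats_closure_iff by meson

lemma feats_closure_extensional: "f \<in> feats_closure X \<Longrightarrow> f \<in> extensional (pts X)"
  by (simp add: feats_closure_iff)

lemma feats_subset_closure: "feats X \<subseteq> feats_closure X"
  unfolding feats_closure_def using feats_extensional by (intro closure_of_subset) (auto simp: PiE_iff subset_iff)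

lemma feats_closure_nonempty: "feats_closure X \<noteq> {}"
  using feats_subset_closure feats_nonempty by blast

lemma feats_closure_lipschitz:
  assumes f: "f \<in> feats_closure X" and xy: "x \<in> pts X" "y \<in> pts X"
  shows "\<bar>f x - f y\<bar> \<le> fdist X x y"
proof (rule field_le_epsilon)
  fix e :: real assume "e > 0"
  obtain g where g: "g \<in> feats X" "\<And>z. z \<in> {x, y} \<Longrightarrow> \<bar>g z - f z\<bar> < e / 2"
    using feats_closure_approx[OF f, of "{x, y}" "e / 2"] xy \<open>e > 0\<close> by auto
  have "\<bar>g x - g y\<bar> \<le> fdist X x y"
    using xy unfolding fdist_def by (auto intro!: cSUP_upper g(1) bdd_feats)
  then show "\<bar>f x - f y\<bar> \<le> fdist X x y + e"
    using g(2)[of x, simplified] g(2)[of y, simplified]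
      abs_triangle_ineq[of "(f x - g x) + (g x - g y)" "g y - f y"] abs_triangle_ineq[of "f x - g x" "g x - g y"]
    by (simp add: abs_minus_commute)
qed

lemma continuous_feats_closure:
  assumes f: "f \<in> feats_closure X"
  shows "continuous_map (ftop X) euclideanreal f"
  unfolding continuous_map_def
proof (intro conjI allI impI)
  fix U assume U: "openin euclideanreal U"
  show "openin (ftop X) {x \<in> topspace (ftop X). f x \<in> U}"
    unfolding metric.openin_mtopology
  proof (intro conjI allI impI)
    fix x assume "x \<in> {x \<in> topspace (ftop X). f x \<in> U}"
    then have x: "x \<in> pts X" "f x \<in> U" by auto
    then obtain e where e: "e > 0" "ball (f x) e \<subseteq> U"
      using U by (auto simp: open_contains_ball)
    have "metric.mball x e \<subseteq> {x \<in> topspace (ftop X). f x \<in> U}"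
      using e feats_closure_lipschitz[OF f x(1)] by (force simp: dist_real_def subset_iff)
    then show "\<exists>r>0. metric.mball x r \<subseteq> {x \<in> topspace (ftop X). f x \<in> U}"
      using e(1) by blast
  qed auto
qed auto

lemma measurable_continuous:
  assumes "continuous_map (ftop X) euclideanreal f"
  shows "f \<in> borel_measurable (msr X)"
proof (rule borel_measurableI)
  fix S :: "real set" assume "open S"
  then have "openin (ftop X) {x \<in> topspace (ftop X). f x \<in> S}"
    using assms by (auto simp: continuous_map_def)
  moreover have "{x \<in> topspace (ftop X). f x \<in> S} = f -` S \<inter> space (msr X)"
    by (auto simp: space_msr)
  ultimately show "f -` S \<inter> space (msr X) \<in> sets (msr X)"
    using sets_msr_open by metis
qed

lemmas measurable_feats_closure = measurable_continuous[OF continuous_feats_closure]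

lemma dense_sequence:
  obtains x :: "nat \<Rightarrow> 'a" where "\<And>k. x k \<in> pts X" "\<And>y e. y \<in> pts X \<Longrightarrow> e > 0 \<Longrightarrow> \<exists>k. fdist X (x k) y < e"
proof -
  obtain C where C: "countable C" "C \<subseteq> pts X" "ftop X closure_of C = pts X"
    using separable unfolding separable_space_def by auto
  then have "C \<noteq> {}" using pts_nonempty by auto
  show thesis
  proof
    show "from_nat_into C k \<in> pts X" for k
      using from_nat_into[OF \<open>C \<noteq> {}\<close>] C(2) by blast
    fix y and e :: real assume "y \<in> pts X" "e > 0"
    then obtain c where "c \<in> C" "c \<in> metric.mball y e"
      using C(3) unfolding metric.metric_closure_of by auto
    moreover obtain k where "from_nat_into C k = c"
      using from_nat_into_surj[OF \<open>countable C\<close> \<open>c \<in> C\<close>] by blast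
    ultimately show "\<exists>k. fdist X (from_nat_into C k) y < e"
      by (auto simp: metric.commute)
  qed
qed

end

text \<open>Couplings live on the product sigma-algebra, while the box distance uses closed sets of
  the product topology. Separability bridges the two: products of balls with centres in dense
  sequences and radii \<open>1 / Suc n\<close> form a countable base.\<close>

lemma openin_prod_measurable:
  assumes X: "geometric_data_set X" and Y: "geometric_data_set Y"
    and U: "openin (prod_topology (ftop X) (ftop Y)) U"
  shows "U \<in> sets (msr X \<Otimes>\<^sub>M msr Y)"
proof -
  interpret X: gds X by (rule gds.intro[OF X])
  interpret Y: gds Y by (rule gds.intro[OF Y])
  obtain a where a: "\<And>k. a k \<in> pts X" "\<And>y e. y \<in> pts X \<Longrightarrow> e > 0 \<Longrightarrow> \<exists>k::nat. fdist X (a k) y < e"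
    using X.dense_sequence by metis
  obtain b where b: "\<And>k. b k \<in> pts Y" "\<And>y e. y \<in> pts Y \<Longrightarrow> e > 0 \<Longrightarrow> \<exists>k::nat. fdist Y (b k) y < e"
    using Y.dense_sequence by metis
  define B where "B = (\<lambda>(i, j, n::nat). X.metric.mball (a i) (1 / Suc n) \<times> Y.metric.mball (b j) (1 / Suc n))"
  have "U = \<Union> {B t | t. B t \<subseteq> U}"
  proof (intro equalityI subsetI)
    fix p assume "p \<in> U"
    obtain x y where p: "p = (x, y)" by force
    obtain V W where VW: "openin (ftop X) V" "openin (ftop Y) W" "x \<in> V" "y \<in> W" "V \<times> W \<subseteq> U"
      using U \<open>p \<in> U\<close> openin_prod_topology_alt[of "ftop X" "ftop Y" U] p by meson
    obtain r where r: "r > 0" "X.metric.mball x r \<subseteq> V"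
      using VW unfolding X.metric.openin_mtopology by blast
    obtain s where s: "s > 0" "Y.metric.mball y s \<subseteq> W"
      using VW unfolding Y.metric.openin_mtopology by blast
    \<comment> \<open>A ball of this radius that contains \<open>x\<close> lies within
      \<open>2 / Suc n < min r s\<close> of \<open>x\<close>, hence inside the ball of radius
      \<open>r\<close>; likewise for \<open>y\<close>.\<close>
    obtain n where n: "1 / Suc n < min r s / 2"
      using nat_approx_posE[of "min r s / 2"] r(1) s(1) by auto
    have xy: "x \<in> pts X" "y \<in> pts Y"
      using VW X.metric.openin_mtopology Y.metric.openin_mtopology by blast+
    obtain i where i: "fdist X (a i) x < 1 / Suc n" using a(2)[OF xy(1)] by force
    obtain j where j: "fdist Y (b j) y < 1 / Suc n" using b(2)[OF xy(2)] by force
    have "X.metric.mball (a i) (1 / Suc n) \<subseteq> X.metric.mball x r"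
    proof
      fix z assume "z \<in> X.metric.mball (a i) (1 / Suc n)"
      then show "z \<in> X.metric.mball x r"
        using X.metric.triangle[of x "a i" z] xy a(1)[of i] i n X.metric.commute[of x "a i"] by auto
    qed
    moreover have "Y.metric.mball (b j) (1 / Suc n) \<subseteq> Y.metric.mball y s"
    proof
      fix z assume "z \<in> Y.metric.mball (b j) (1 / Suc n)"
      then show "z \<in> Y.metric.mball y s"
        using Y.metric.triangle[of y "b j" z] xy b(1)[of j] j n Y.metric.commute[of y "b j"] by auto
    qed
    ultimately have "B (i, j, n) \<subseteq> U" 
      using r s VW unfolding B_def by (simp del: of_nat_Suc) blast
    moreover have "p \<in> B (i, j, n)"
      using i j a b xy unfolding B_def p by auto
    ultimately show "p \<in> \<Union> {B t | t. B t \<subseteq> U}" by blast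
  qed auto
  also have "\<dots> \<in> sets (msr X \<Otimes>\<^sub>M msr Y)"
  proof (rule sets.countable_Union)
    show "countable {B t | t. B t \<subseteq> U}"
      by (rule countable_subset[of _ "range B"]) auto
    show "{B t | t. B t \<subseteq> U} \<subseteq> sets (msr X \<Otimes>\<^sub>M msr Y)"
      unfolding B_def using X.sets_msr_open[OF X.metric.openin_mball] Y.sets_msr_open[OF Y.metric.openin_mball]
      by auto
  qed
  finally show ?thesis .
qed

lemma closedin_prod_measurable:
  assumes "geometric_data_set X" "geometric_data_set Y"
    and "closedin (prod_topology (ftop X) (ftop Y)) S"
  shows "S \<in> sets (msr X \<Otimes>\<^sub>M msr Y)"
proof -
  interpret X: gds X by (rule gds.intro) fact
  interpret Y: gds Y by (rule gds.intro) fact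
  have "pts X \<times> pts Y - S \<in> sets (msr X \<Otimes>\<^sub>M msr Y)"
    using assms by (intro openin_prod_measurable) (auto simp: closedin_def)
  moreover have "S = space (msr X \<Otimes>\<^sub>M msr Y) - (pts X \<times> pts Y - S)"
    using closedin_subset[OF assms(3)] by (auto simp: space_pair_measure X.space_msr Y.space_msr)
  ultimately show ?thesis by (metis sets.compl_sets)
qed

text \<open>Matching a feature with a closure point is a compactness argument: the candidates lie in a
  product of bounded intervals.\<close>

lemma (in gds) match_closure:
  fixes G :: "('b \<Rightarrow> real) set"
  assumes g: "\<And>A \<delta>. finite A \<Longrightarrow> A \<subseteq> snd ` T \<Longrightarrow> \<delta> > 0 \<Longrightarrow> \<exists>g'\<in>G. \<forall>y\<in>A. \<bar>g' y - g y\<bar> < \<delta>"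
    and T: "T \<subseteq> pts X \<times> UNIV" "T \<noteq> {}"
    and match: "\<And>g. g \<in> G \<Longrightarrow> \<exists>f\<in>feats_closure X. \<forall>(x, y)\<in>T. \<bar>f x - g y\<bar> \<le> e"
  shows "\<exists>f\<in>feats_closure X. \<forall>(x, y)\<in>T. \<bar>f x - g y\<bar> \<le> e"
proof -
  let ?P = "product_topology (\<lambda>_. euclideanreal) (pts X)"
  obtain x0 y0 where t0: "(x0, y0) \<in> T" using T by force
  \<comment> \<open>A candidate matches some \<open>g'\<close> within \<open>e\<close>, and
    \<open>g'\<close> is within \<open>1\<close> of \<open>g\<close> at the base point, which bounds
    the candidate at \<open>x0\<close>. The Lipschitz bound spreads this to all of
    \<open>pts X\<close> and yields compact intervals.\<close>
  define K where "K = PiE (pts X) (\<lambda>x. {g y0 - (e + 1) - fdist X x0 x .. g y0 + (e + 1) + fdist X x0 x})"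
  have K: "compactin ?P K"
    unfolding K_def compactin_PiE by auto
  define C where "C = (\<lambda>(A, \<delta>). {f \<in> feats_closure X. \<forall>(x, y)\<in>A. \<bar>f x - g y\<bar> \<le> e + \<delta>})"
  have C: "closedin ?P (C (A, \<delta>))" if A: "finite A" "A \<subseteq> T" for A \<delta>
  proof -
    define D where "D = (\<lambda>p. {f \<in> topspace ?P. f (fst p) \<in> {g (snd p) - (e + \<delta>) .. g (snd p) + (e + \<delta>)}})"
    have "closedin ?P (D p)" if "p \<in> T" for p
      unfolding D_def using T that
      by (intro closedin_continuous_map_preimage[OF continuous_map_product_projection]) auto
    moreover have "closedin ?P (feats_closure X)" by (simp add: feats_closure_def)
    ultimately have "closedin ?P (\<Inter> (insert (feats_closure X) (D ` A)))"
      using A by (intro closedin_Inter) auto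
    moreover have "f \<in> D p \<longleftrightarrow> \<bar>f (fst p) - g (snd p)\<bar> \<le> e + \<delta>" if "f \<in> feats_closure X" for f p
      using feats_closure_extensional[OF that] by (auto simp: D_def PiE_iff)
    then have "C (A, \<delta>) = \<Inter> (insert (feats_closure X) (D ` A))"
      by (auto simp: C_def)
    ultimately show ?thesis by simp
  qed
  have nonempty: "K \<inter> C (A, \<delta>) \<noteq> {}" if A: "finite A" "A \<subseteq> T" and \<delta>: "\<delta> > 0" for A \<delta>
  proof -
    \<comment> \<open>The base point is added to the constraints and the tolerance is capped at
      \<open>1\<close> so that the resulting candidate falls into \<open>K\<close>.\<close>
    have "\<exists>g'\<in>G. \<forall>y\<in>snd ` insert (x0, y0) A. \<bar>g' y - g y\<bar> < min 1 \<delta>"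
      using A \<delta> t0 by (intro g) (auto intro: image_eqI[of _ _ "(x0, y0)"])
    then obtain g' where g': "g' \<in> G" "\<And>y. y \<in> snd ` insert (x0, y0) A \<Longrightarrow> \<bar>g' y - g y\<bar> < min 1 \<delta>"
      by auto
    obtain f where f: "f \<in> feats_closure X" "\<And>x y. (x, y) \<in> T \<Longrightarrow> \<bar>f x - g' y\<bar> \<le> e"
      using match[OF g'(1)] by auto
    have "f \<in> K"
      unfolding K_def
    proof (rule PiE_I)
      fix x assume x: "x \<in> pts X"
      have "x0 \<in> pts X" using t0 T by auto
      then have "\<bar>f x0 - f x\<bar> \<le> fdist X x0 x" by (rule feats_closure_lipschitz[OF f(1) _ x])
      moreover have "\<bar>f x0 - g y0\<bar> \<le> e + 1" using f(2)[OF t0] g'(2)[of y0] by auto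
      ultimately show "f x \<in> {g y0 - (e + 1) - fdist X x0 x .. g y0 + (e + 1) + fdist X x0 x}" by auto
    qed (use feats_closure_extensional[OF f(1)] in \<open>auto simp: extensional_def\<close>)
    moreover have "\<bar>f x - g y\<bar> \<le> e + \<delta>" if "(x, y) \<in> A" for x y
      using f(2)[of x y] g'(2)[of y] A that by force
    then have "f \<in> C (A, \<delta>)" using f(1) by (auto simp: C_def)
    ultimately show ?thesis by blast
  qed
  define \<C> where "\<C> = {C (A, \<delta>) | A \<delta>. finite A \<and> A \<subseteq> T \<and> \<delta> > 0}"
  have "K \<inter> \<Inter> \<C> \<noteq> {}"
  proof (rule compactin_fip[THEN iffD1, OF K, THEN conjunct2, rule_format, OF conjI])
    show "\<forall>B\<in>\<C>. closedin ?P B"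
      using C by (auto simp: \<C>_def)
    show "\<forall>\<F>. finite \<F> \<and> \<F> \<subseteq> \<C> \<longrightarrow> K \<inter> \<Inter> \<F> \<noteq> {}"
    proof (intro allI impI)
      fix \<F> assume "finite \<F> \<and> \<F> \<subseteq> \<C>"
      then have fin: "finite \<F>" and "\<forall>B\<in>\<F>. \<exists>A \<delta>. B = C (A, \<delta>) \<and> finite A \<and> A \<subseteq> T \<and> \<delta> > 0"
        by (auto simp: \<C>_def)
      then obtain a d where ad: "\<And>B. B \<in> \<F> \<Longrightarrow> B = C (a B, d B) \<and> finite (a B) \<and> a B \<subseteq> T \<and> d B > 0"
        by metis
      \<comment> \<open>Pooling all the finite constraint sets at the smallest tolerance gives a
        single set contained in every member of \<open>\<F>\<close>.\<close>
      define \<delta> where "\<delta> = Min (insert 1 (d ` \<F>))"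
      have "\<delta> > 0" "\<And>B. B \<in> \<F> \<Longrightarrow> \<delta> \<le> d B"
        unfolding \<delta>_def using fin ad by auto
      then have "C (\<Union> (a ` \<F>), \<delta>) \<subseteq> B" if "B \<in> \<F>" for B
        using ad[OF that] that unfolding C_def by fastforce
      moreover have "K \<inter> C (\<Union> (a ` \<F>), \<delta>) \<noteq> {}"
        by (rule nonempty) (use fin ad \<open>\<delta> > 0\<close> in auto)
      ultimately show "K \<inter> \<Inter> \<F> \<noteq> {}" by blast
    qed
  qed
  then obtain f where "f \<in> \<Inter> \<C>"
    by (metis IntE all_not_in_conv)
  then have f: "f \<in> C (A, \<delta>)" if "finite A" "A \<subseteq> T" "\<delta> > 0" for A \<delta>
    by (rule InterD) (use that in \<open>auto simp: \<C>_def\<close>)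
  have "f \<in> feats_closure X" using f[of "{}" 1] by (auto simp: C_def)
  moreover have "\<bar>f x - g y\<bar> \<le> e" if "(x, y) \<in> T" for x y
  proof (rule field_le_epsilon)
    fix \<delta> :: real assume "\<delta> > 0"
    then show "\<bar>f x - g y\<bar> \<le> e + \<delta>"
      using f[of "{(x, y)}" \<delta>] that by (auto simp: C_def)
  qed
  ultimately show ?thesis by auto
qed

section \<open>Couplings along a discrete partition\<close>

text \<open>By Tonelli the two partial integrals of \<open>h\<close> are the densities of the
  marginals. The value \<open>1\<close> is asked for only almost everywhere, which is all that
  \<open>coupling_of_cells\<close> delivers when the matched mass is \<open>1\<close>.\<close>

lemma density_couplings:
  fixes M :: "'a measure" and N :: "'b measure"
  assumes M: "prob_space M" and N: "prob_space N"
    and h[measurable]: "h \<in> borel_measurable (M \<Otimes>\<^sub>M N)"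
    and 1: "AE x in M. (\<integral>\<^sup>+ y. h (x, y) \<partial>N) = 1"
    and 2: "AE y in N. (\<integral>\<^sup>+ x. h (x, y) \<partial>M) = 1"
  shows "density (M \<Otimes>\<^sub>M N) h \<in> couplings M N"
proof -
  interpret M: prob_space M by fact
  interpret N: prob_space N by fact
  interpret pair_sigma_finite M N ..
  let ?\<pi> = "density (M \<Otimes>\<^sub>M N) h"
  have "distr ?\<pi> M fst = M"
  proof (rule measure_eqI)
    fix A assume "A \<in> sets (distr ?\<pi> M fst)"
    then have A[measurable]: "A \<in> sets M" by simp
    have "emeasure (distr ?\<pi> M fst) A = (\<integral>\<^sup>+ p. h p * indicator A (fst p) \<partial>(M \<Otimes>\<^sub>M N))"
      by (subst emeasure_distr) (auto simp: emeasure_density space_pair_measure indicator_def intro!: nn_integral_cong)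
    also have "\<dots> = (\<integral>\<^sup>+ x. (\<integral>\<^sup>+ y. h (x, y) * indicator A x \<partial>N) \<partial>M)"
      by (subst N.nn_integral_fst[symmetric]) auto
    also have "\<dots> = (\<integral>\<^sup>+ x. indicator A x \<partial>M)"
      by (rule nn_integral_cong_AE) (use 1 in \<open>auto simp: nn_integral_multc\<close>)
    finally show "emeasure (distr ?\<pi> M fst) A = emeasure M A" by simp
  qed simp
  moreover have "distr ?\<pi> N snd = N"
  proof (rule measure_eqI)
    fix A assume "A \<in> sets (distr ?\<pi> N snd)"
    then have A[measurable]: "A \<in> sets N" by simp
    have "emeasure (distr ?\<pi> N snd) A = (\<integral>\<^sup>+ p. h p * indicator A (snd p) \<partial>(M \<Otimes>\<^sub>M N))"
      by (subst emeasure_distr) (auto simp: emeasure_density space_pair_measure indicator_def intro!: nn_integral_cong)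
    also have "\<dots> = (\<integral>\<^sup>+ y. (\<integral>\<^sup>+ x. h (x, y) * indicator A y \<partial>M) \<partial>N)"
      by (subst nn_integral_snd[symmetric]) auto
    also have "\<dots> = (\<integral>\<^sup>+ y. indicator A y \<partial>N)"
      by (rule nn_integral_cong_AE) (use 2 in \<open>auto simp: nn_integral_multc\<close>)
    finally show "emeasure (distr ?\<pi> N snd) A = emeasure N A" by simp
  qed simp
  ultimately show ?thesis by (simp add: couplings_def)
qed

lemma couplings_prob_space:
  assumes "\<pi> \<in> couplings M N" "prob_space M"
  shows "prob_space \<pi>"
proof (rule prob_space_distrD[of fst \<pi> M])
  show "fst \<in> \<pi> \<rightarrow>\<^sub>M M"
    using assms by (simp add: couplings_def cong: measurable_cong_sets)
qed (use assms in \<open>simp add: couplings_def\<close>)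

lemma (in prob_space) prob_Int_ge:
  assumes AB: "A \<in> events" "B \<in> events" and "1 - a \<le> prob A" "1 - b \<le> prob B"
  shows "1 - (a + b) \<le> prob (A \<inter> B)"
proof -
  have "prob (A - B) \<le> prob (space M - B)"
    using AB sets.sets_into_space[OF AB(1)] by (intro finite_measure_mono) auto
  then show ?thesis
    using assms finite_measure_Diff'[OF AB] prob_compl[OF AB(2)] by simp
qed

lemma (in prob_space) prob_cells:
  fixes c :: "'a \<Rightarrow> nat"
  assumes c[measurable]: "c \<in> measurable M (count_space UNIV)" and J: "finite J"
  shows "prob {x\<in>space M. c x \<in> J} = (\<Sum>i\<in>J. prob {x\<in>space M. c x = i})"
proof -
  have "prob (\<Union>i\<in>J. {x\<in>space M. c x = i}) = (\<Sum>i\<in>J. prob {x\<in>space M. c x = i})"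
    using J by (intro finite_measure_finite_Union) (auto simp: disjoint_family_on_def)
  moreover have "(\<Union>i\<in>J. {x\<in>space M. c x = i}) = {x\<in>space M. c x \<in> J}" by auto
  ultimately show ?thesis by simp
qed

text \<open>In \<open>coupling_of_cells\<close>, \<open>t i\<close> is the fraction of cell
  \<open>i\<close> that gets matched; the two integrals are then the matched and the leftover
  mass.\<close>

lemma (in prob_space) nn_integral_one_minus_cells:
  fixes c :: "'a \<Rightarrow> nat" and t :: "nat \<Rightarrow> real"
  assumes c[measurable]: "c \<in> measurable M (count_space UNIV)" and I: "finite I"
    and t: "\<And>i. i \<in> I \<Longrightarrow> 0 \<le> t i" "\<And>i. i \<in> I \<Longrightarrow> t i \<le> 1"
  defines "u \<equiv> \<lambda>x. if c x \<in> I then t (c x) else 0"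
  shows "(\<integral>\<^sup>+ x. ennreal (u x) \<partial>M) = ennreal (\<Sum>i\<in>I. t i * prob {x\<in>space M. c x = i})"
    and "(\<integral>\<^sup>+ x. ennreal (1 - u x) \<partial>M) = ennreal (1 - (\<Sum>i\<in>I. t i * prob {x\<in>space M. c x = i}))"
proof -
  define B where "B i = {x\<in>space M. c x = i}" for i
  have B[measurable]: "B i \<in> sets M" for i unfolding B_def by measurable
  have u: "u x = (\<Sum>i\<in>I. t i * indicator (B i) x)" if "x \<in> space M" for x
    using I that by (auto simp: u_def indicator_def B_def sum.delta' if_distrib cong: if_cong)
  have [measurable]: "u \<in> borel_measurable M" unfolding u_def by measurable
  have bnd: "0 \<le> u x" "u x \<le> 1" for x using t by (auto simp: u_def)
  have int: "integrable M u"
    by (rule integrable_const_bound[of _ 1]) (use bnd in auto)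
  have "(\<integral>x. u x \<partial>M) = (\<integral>x. (\<Sum>i\<in>I. t i * indicator (B i) x) \<partial>M)"
    by (rule Bochner_Integration.integral_cong) (use u in auto)
  also have "\<dots> = (\<Sum>i\<in>I. t i * prob (B i))"
    by (subst Bochner_Integration.integral_sum) (auto simp: Int_absorb2 sets.sets_into_space emeasure_eq_measure)
  finally have eq: "(\<integral>x. u x \<partial>M) = (\<Sum>i\<in>I. t i * prob {x\<in>space M. c x = i})"
    by (simp add: B_def)
  show "(\<integral>\<^sup>+ x. ennreal (u x) \<partial>M) = ennreal (\<Sum>i\<in>I. t i * prob {x\<in>space M. c x = i})"
    using int bnd by (subst nn_integral_eq_integral) (auto simp: eq)
  show "(\<integral>\<^sup>+ x. ennreal (1 - u x) \<partial>M) = ennreal (1 - (\<Sum>i\<in>I. t i * prob {x\<in>space M. c x = i}))"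
    using int bnd by (subst nn_integral_eq_integral) (auto simp: eq prob_space)
qed

text \<open>The density is the conditionally independent coupling on the matching cells, plus the product
  of the leftover masses.\<close>

lemma coupling_of_cells:
  fixes M :: "'a measure" and N :: "'b measure" and c :: "'a \<Rightarrow> nat" and c' :: "'b \<Rightarrow> nat"
  assumes M: "prob_space M" and N: "prob_space N"
    and c[measurable]: "c \<in> measurable M (count_space UNIV)" "c' \<in> measurable N (count_space UNIV)"
    and I: "finite I"
  shows "\<exists>\<pi>\<in>couplings M N.
    (\<Sum>i\<in>I. min (measure M {x\<in>space M. c x = i}) (measure N {y\<in>space N. c' y = i}))
      \<le> measure \<pi> {p\<in>space M \<times> space N. c (fst p) = c' (snd p) \<and> c (fst p) \<in> I}"
proof -
  interpret M: prob_space M by fact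
  interpret N: prob_space N by fact
  interpret pair_sigma_finite M N ..
  define a where "a i = measure M {x\<in>space M. c x = i}" for i
  define b where "b i = measure N {y\<in>space N. c' y = i}" for i
  define m where "m i = min (a i) (b i)" for i
  define s where "s = (\<Sum>i\<in>I. m i)"
  define u where "u x = (if c x \<in> I then m (c x) / a (c x) else 0)" for x
  define v where "v y = (if c' y \<in> I then m (c' y) / b (c' y) else 0)" for y
  \<comment> \<open>The product measure gives the block of cell \<open>i\<close> the mass
    \<open>a i * b i\<close>, so this density gives it mass \<open>m i\<close>. If
    \<open>a i\<close> or \<open>b i\<close> vanishes then so does \<open>m i\<close>, and division
    by zero returns the right value \<open>0\<close>.\<close>
  define k where "k = (\<lambda>(x, y). if c x \<in> I \<and> c x = c' y then m (c x) / (a (c x) * b (c x)) else 0)"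
  \<comment> \<open>Both leftovers have mass \<open>1 - s\<close>; dividing their product by
    \<open>1 - s\<close> makes each marginal equal to its own leftover.\<close>
  define h where "h = (\<lambda>(x, y). k (x, y) + (1 - u x) * (1 - v y) / (1 - s))"
  have ab: "0 \<le> a i" "0 \<le> b i" "0 \<le> m i" "m i \<le> a i" "m i \<le> b i" for i
    by (auto simp: a_def b_def m_def)
  have ab0: "m i / a i * a i = m i" "m i / b i * b i = m i" for i
    using ab[of i] by (cases "a i = 0"; cases "b i = 0"; auto)+
  have t: "0 \<le> m i / a i" "m i / a i \<le> 1" "0 \<le> m i / b i" "m i / b i \<le> 1" for i
    using ab[of i] by (auto simp: divide_le_eq_1)
  have uv: "0 \<le> u x" "u x \<le> 1" "0 \<le> v y" "v y \<le> 1" for x y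
    using t by (auto simp: u_def v_def)
  have k0: "0 \<le> k p" for p using ab by (auto simp: k_def split: prod.split)
  have iu: "(\<integral>\<^sup>+ x. ennreal (u x) \<partial>M) = ennreal s" "(\<integral>\<^sup>+ x. ennreal (1 - u x) \<partial>M) = ennreal (1 - s)"
    using M.nn_integral_one_minus_cells[OF c(1) I, of "\<lambda>i. m i / a i", OF t(1) t(2)]
    unfolding a_def[symmetric] ab0 u_def s_def by auto
  have iv: "(\<integral>\<^sup>+ y. ennreal (1 - v y) \<partial>N) = ennreal (1 - s)"
    using N.nn_integral_one_minus_cells(2)[OF c(2) I, of "\<lambda>i. m i / b i", OF t(3) t(4)]
    unfolding b_def[symmetric] ab0 v_def s_def by auto
  have s1: "s \<le> 1"
  proof -
    have "ennreal s \<le> (\<integral>\<^sup>+ x. 1 \<partial>M)"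
      unfolding iu(1)[symmetric] using uv by (intro nn_integral_mono) (auto simp: ennreal_le_1)
    then show ?thesis by (simp add: M.emeasure_space_1 ennreal_le_1)
  qed
  have mk[measurable]: "k \<in> borel_measurable (M \<Otimes>\<^sub>M N)"
  proof -
    have "(\<lambda>p. (c (fst p), c' (snd p))) \<in> M \<Otimes>\<^sub>M N \<rightarrow>\<^sub>M count_space UNIV \<Otimes>\<^sub>M count_space UNIV"
      by measurable
    then have cc: "(\<lambda>p. (c (fst p), c' (snd p))) \<in> M \<Otimes>\<^sub>M N \<rightarrow>\<^sub>M count_space UNIV"
      by (simp add: pair_measure_countable)
    have "k = (\<lambda>(i, j). if i \<in> I \<and> i = j then m i / (a i * b i) else 0) \<circ> (\<lambda>p. (c (fst p), c' (snd p)))"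
      by (auto simp: k_def)
    then show ?thesis using cc by (simp add: measurable_comp[OF cc])
  qed
  have mk1[measurable]: "(\<lambda>y. k (x, y)) \<in> borel_measurable N"
    and mk2[measurable]: "(\<lambda>x. k (x, y)) \<in> borel_measurable M" for x y
    unfolding k_def prod.case by measurable
  have mu[measurable]: "u \<in> borel_measurable M" and mv[measurable]: "v \<in> borel_measurable N"
    unfolding u_def v_def by measurable
  have mh[measurable]: "h \<in> borel_measurable (M \<Otimes>\<^sub>M N)"
    unfolding h_def by measurable
  have hk: "ennreal (h (x, y)) = ennreal (k (x, y)) + ennreal ((1 - u x) / (1 - s)) * ennreal (1 - v y)"
           "ennreal (h (x, y)) = ennreal (k (x, y)) + ennreal ((1 - v y) / (1 - s)) * ennreal (1 - u x)" for x y
    using k0[of "(x, y)"] uv(1,2)[of x] uv(3,4)[of y] s1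
    by (simp_all add: h_def mult.commute flip: ennreal_plus ennreal_mult)
  have kx: "(\<integral>\<^sup>+ y. ennreal (k (x, y)) \<partial>N) = ennreal (u x)" for x
  proof -
    have "(\<integral>\<^sup>+ y. ennreal (k (x, y)) \<partial>N) =
        (\<integral>\<^sup>+ y. ennreal (if c x \<in> I then m (c x) / (a (c x) * b (c x)) else 0) * indicator {y\<in>space N. c' y = c x} y \<partial>N)"
      by (rule nn_integral_cong) (auto simp: k_def indicator_def)
    also have "\<dots> = ennreal (if c x \<in> I then m (c x) / (a (c x) * b (c x)) else 0) * ennreal (b (c x))"
      by (subst nn_integral_cmult_indicator) (auto simp: b_def N.emeasure_eq_measure)
    also have "\<dots> = ennreal (u x)"
      using ab[of "c x"] by (auto simp: u_def field_simps simp flip: ennreal_mult)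
    finally show ?thesis .
  qed
  have ky: "(\<integral>\<^sup>+ x. ennreal (k (x, y)) \<partial>M) = ennreal (v y)" for y
  proof -
    have "(\<integral>\<^sup>+ x. ennreal (k (x, y)) \<partial>M) =
        (\<integral>\<^sup>+ x. ennreal (if c' y \<in> I then m (c' y) / (a (c' y) * b (c' y)) else 0) * indicator {x\<in>space M. c x = c' y} x \<partial>M)"
      by (rule nn_integral_cong) (auto simp: k_def indicator_def)
    also have "\<dots> = ennreal (if c' y \<in> I then m (c' y) / (a (c' y) * b (c' y)) else 0) * ennreal (a (c' y))"
      by (subst nn_integral_cmult_indicator) (auto simp: a_def M.emeasure_eq_measure)
    also have "\<dots> = ennreal (v y)"
      using ab[of "c' y"] by (auto simp: v_def field_simps simp flip: ennreal_mult)
    finally show ?thesis .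
  qed
  \<comment> \<open>For \<open>s = 1\<close> the second summand of \<open>h\<close> is
    \<open>0\<close> by division by zero, so the marginal densities are just \<open>u\<close> and
    \<open>v\<close>. They equal \<open>1\<close> almost everywhere because the leftovers have
    integral \<open>0\<close>.\<close>
  have zero: "AE x in M. s = 1 \<longrightarrow> u x = 1" "AE y in N. s = 1 \<longrightarrow> v y = 1"
  proof -
    have "AE x in M. ennreal (1 - u x) = 0" if "s = 1"
      using iu(2) that by (subst nn_integral_0_iff_AE[symmetric]) auto
    then show "AE x in M. s = 1 \<longrightarrow> u x = 1"
      by (cases "s = 1") (use uv(2) in \<open>auto simp: ennreal_eq_0_iff elim!: eventually_mono intro: antisym\<close>)
    have "AE y in N. ennreal (1 - v y) = 0" if "s = 1"
      using iv that by (subst nn_integral_0_iff_AE[symmetric]) auto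
    then show "AE y in N. s = 1 \<longrightarrow> v y = 1"
      by (cases "s = 1") (use uv(4) in \<open>auto simp: ennreal_eq_0_iff elim!: eventually_mono intro: antisym\<close>)
  qed
  have coupl: "density (M \<Otimes>\<^sub>M N) (\<lambda>p. ennreal (h p)) \<in> couplings M N"
  proof (rule density_couplings[OF M N])
    have "(\<integral>\<^sup>+ y. ennreal (h (x, y)) \<partial>N) = 1" if "s = 1 \<longrightarrow> u x = 1" for x
    proof -
      have "(\<integral>\<^sup>+ y. ennreal (h (x, y)) \<partial>N) = ennreal (u x) + ennreal ((1 - u x) / (1 - s)) * ennreal (1 - s)"
        unfolding hk(1) using kx[of x] iv by (subst nn_integral_add) (auto simp: nn_integral_cmult)
      also have "\<dots> = ennreal (u x + (1 - u x) / (1 - s) * (1 - s))"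
        using uv(1,2)[of x] s1 by (subst ennreal_mult[symmetric]) (auto simp flip: ennreal_plus)
      also have "\<dots> = 1" using that by (cases "s = 1") auto
      finally show ?thesis .
    qed
    then show "AE x in M. (\<integral>\<^sup>+ y. ennreal (h (x, y)) \<partial>N) = 1"
      using zero(1) by (auto elim!: eventually_mono)
    have "(\<integral>\<^sup>+ x. ennreal (h (x, y)) \<partial>M) = 1" if "s = 1 \<longrightarrow> v y = 1" for y
    proof -
      have "(\<integral>\<^sup>+ x. ennreal (h (x, y)) \<partial>M) = ennreal (v y) + ennreal ((1 - v y) / (1 - s)) * ennreal (1 - s)"
        unfolding hk(2) using ky[of y] iu(2) by (subst nn_integral_add) (auto simp: nn_integral_cmult)
      also have "\<dots> = ennreal (v y + (1 - v y) / (1 - s) * (1 - s))"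
        using uv(3,4)[of y] s1 by (subst ennreal_mult[symmetric]) (auto simp flip: ennreal_plus)
      also have "\<dots> = 1" using that by (cases "s = 1") auto
      finally show ?thesis .
    qed
    then show "AE y in N. (\<integral>\<^sup>+ x. ennreal (h (x, y)) \<partial>M) = 1"
      using zero(2) by (auto elim!: eventually_mono)
  qed measurable
  let ?\<pi> = "density (M \<Otimes>\<^sub>M N) (\<lambda>p. ennreal (h p))"
  let ?S = "{p\<in>space M \<times> space N. c (fst p) = c' (snd p) \<and> c (fst p) \<in> I}"
  have S[measurable]: "?S \<in> sets (M \<Otimes>\<^sub>M N)"
  proof -
    have "?S = (\<Union>i\<in>I. {x\<in>space M. c x = i} \<times> {y\<in>space N. c' y = i})" by auto
    also have "\<dots> \<in> sets (M \<Otimes>\<^sub>M N)" using I by measurable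
    finally show ?thesis .
  qed
  have "ennreal s = (\<integral>\<^sup>+ x. \<integral>\<^sup>+ y. ennreal (k (x, y)) \<partial>N \<partial>M)"
    by (simp add: kx iu)
  also have "\<dots> = (\<integral>\<^sup>+ p. ennreal (k p) \<partial>(M \<Otimes>\<^sub>M N))"
    by (rule N.nn_integral_fst) measurable
  also have "\<dots> \<le> (\<integral>\<^sup>+ p. ennreal (h p) * indicator ?S p \<partial>(M \<Otimes>\<^sub>M N))"
  proof (rule nn_integral_mono)
    fix p assume "p \<in> space (M \<Otimes>\<^sub>M N)"
    then show "ennreal (k p) \<le> ennreal (h p) * indicator ?S p"
      using uv s1 by (auto simp: h_def k_def space_pair_measure indicator_def intro!: ennreal_leI)
  qed
  also have "\<dots> = emeasure ?\<pi> ?S"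
    by (subst emeasure_density) auto
  finally have "ennreal s \<le> emeasure ?\<pi> ?S" .
  moreover have "emeasure ?\<pi> ?S \<noteq> \<infinity>"
    using prob_space.axioms(1)[OF couplings_prob_space[OF coupl M]] by (simp add: finite_measure.emeasure_finite)
  ultimately have "s \<le> measure ?\<pi> ?S"
    by (simp add: emeasure_eq_ennreal_measure)
  then show ?thesis
    using coupl unfolding s_def m_def a_def b_def by blast
qed

section \<open>Markov chains with prescribed two-step laws\<close>

text \<open>Elementary conditioning on the atoms of a countable state space gives the kernels, and
  Ionescu-Tulcea gives the chain. \<open>consistent\<close> carries the one-point laws along: the
  second marginal of \<open>Q n\<close> is the starting law for the step governed by
  \<open>Q (Suc n)\<close>.\<close>

lemma markov_chain_exists:
  fixes Q :: "nat \<Rightarrow> (nat \<times> nat) measure"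
  assumes Q: "\<And>n. prob_space (Q n)" and sets_Q: "\<And>n. sets (Q n) = UNIV"
    and consistent: "\<And>n b. emeasure (Q n) (UNIV \<times> {b}) = emeasure (Q (Suc n)) ({b} \<times> UNIV)"
  obtains P :: "(nat \<Rightarrow> nat) measure" where "prob_space P"
    "\<And>n. (\<lambda>\<omega>. \<omega> n) \<in> measurable P (count_space UNIV)"
    "\<And>n a b. emeasure P {\<omega>\<in>space P. \<omega> n = a \<and> \<omega> (Suc n) = b} = emeasure (Q n) {(a, b)}"
proof -
  interpret Q: prob_space "Q n" for n by (rule Q)
  have space_Q: "space (Q n) = UNIV" for n using sets_eq_imp_space_eq[of "Q n" "count_space UNIV"] sets_Q by simp
  have meas_Q: "f \<in> measurable (Q n) M' \<longleftrightarrow> f \<in> UNIV \<rightarrow> space M'" for f n and M' :: "'z measure"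
    by (auto simp: measurable_def space_Q sets_Q)
  \<comment> \<open>At a state of mass zero there is nothing to condition on; the point mass at
    \<open>0\<close> merely keeps the kernel a probability measure.\<close>
  define K where "K n a = (if emeasure (Q n) ({a} \<times> UNIV) = 0 then return (count_space UNIV) 0
      else distr (uniform_measure (Q n) ({a} \<times> UNIV)) (count_space UNIV) snd)" for n and a :: nat
  have K_prob: "prob_space (K n a)" for n a
  proof (cases "emeasure (Q n) ({a} \<times> UNIV) = 0")
    case False
    then interpret U: prob_space "uniform_measure (Q n) ({a} \<times> UNIV)"
      by (intro prob_space_uniform_measure) auto
    show ?thesis using False unfolding K_def 
      by (auto intro!: U.prob_space_distr simp: measurable_def sets_Q)
  qed (auto simp: K_def intro!: prob_space_return)
  have K_sets: "sets (K n a) = UNIV" for n a by (simp add: K_def)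
  have K: "emeasure (Q n) ({a} \<times> UNIV) * emeasure (K n a) {b} = emeasure (Q n) {(a, b)}" for n a b
  proof (cases "emeasure (Q n) ({a} \<times> UNIV) = 0")
    case True
    then have "emeasure (Q n) {(a, b)} = 0"
      using emeasure_mono[of "{(a, b)}" "{a} \<times> UNIV" "Q n"] by (auto simp: sets_Q)
    then show ?thesis using True by simp
  next
    case False
    have "emeasure (K n a) {b} = emeasure (Q n) (({a} \<times> UNIV) \<inter> (snd -` {b})) / emeasure (Q n) ({a} \<times> UNIV)"
      using False unfolding K_def
      by (auto simp: emeasure_distr measurable_def sets_Q space_Q)
    also have "({a} \<times> UNIV) \<inter> (snd -` {b}) = {(a, b)}" by auto
    finally show ?thesis
      using False by (simp add: ennreal_times_divide mult.commute ennreal_mult_divide_eq)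
  qed
  define \<K> where "\<K> i \<omega> = (if i = 0 then distr (Q 0) (count_space UNIV) fst else K (i - 1) (\<omega> (i - 1)))" for i and \<omega> :: "nat \<Rightarrow> nat"
  have \<K>_prob: "prob_space (\<K> i \<omega>)" for i \<omega>
    by (auto simp: \<K>_def K_prob intro!: Q.prob_space_distr simp: meas_Q)
  have \<K>_sets: "sets (\<K> i \<omega>) = UNIV" for i \<omega> by (simp add: \<K>_def K_sets)
  interpret Ionescu_Tulcea \<K> "\<lambda>_. count_space UNIV"
  proof (rule Ionescu_Tulcea.intro)
    fix i
    have S: "\<K> i \<omega> \<in> space (subprob_algebra (count_space UNIV))" for \<omega>
      unfolding space_subprob_algebra using \<K>_prob \<K>_sets by (auto intro: prob_space_imp_subprob_space)
    show "\<K> i \<in> measurable (PiM {0..<i} (\<lambda>_. count_space UNIV)) (subprob_algebra (count_space UNIV))"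
    proof (cases i)
      case 0
      then have "\<K> i = (\<lambda>_. \<K> i undefined)" by (simp add: \<K>_def fun_eq_iff)
      then show ?thesis using S by (metis measurable_const)
    next
      case (Suc j)
      have "K j \<in> measurable (count_space UNIV) (subprob_algebra (count_space UNIV))"
        using S[of "\<lambda>_. _"] Suc by (auto simp: \<K>_def)
      moreover have "(\<lambda>\<omega>. \<omega> j) \<in> measurable (PiM {0..<i} (\<lambda>_. count_space UNIV)) (count_space (UNIV :: nat set))"
        using Suc by (intro measurable_component_singleton) auto
      ultimately have "(\<lambda>\<omega>. K j (\<omega> j)) \<in> measurable (PiM {0..<i} (\<lambda>_. count_space UNIV)) (subprob_algebra (count_space UNIV))"
        by (rule measurable_compose[rotated])
      then show ?thesis using Suc by (simp add: \<K>_def[abs_def])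
    qed
  qed (rule \<K>_prob)
  let ?M = "\<lambda>n. PiM {0..<n} (\<lambda>_. count_space (UNIV :: nat set))"
  let ?u = "\<lambda>_::nat. undefined :: nat"
  have u: "?u \<in> space (?M 0)" by (simp add: space_PiM)
  have step: "emeasure (C 0 (Suc n) ?u) A = (\<integral>\<^sup>+ \<omega>. emeasure (\<K> n \<omega>) {x. fun_upd \<omega> n x \<in> A} \<partial>C 0 n ?u)"
    if A: "A \<in> sets (?M (Suc n))" for n A
  proof -
    have "emeasure (C 0 (Suc n) ?u) A = (\<integral>\<^sup>+ \<omega>. emeasure (eP n \<omega>) A \<partial>C 0 n ?u)"
      using A measurable_eP[of n] space_C[OF u, of n] sets_C[OF u, of n]
      by (simp, subst emeasure_bind[where N="?M (Suc n)"])
         (auto simp: space_PiM_empty_iff cong: measurable_cong_sets)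
    also have "\<dots> = (\<integral>\<^sup>+ \<omega>. emeasure (\<K> n \<omega>) {x. fun_upd \<omega> n x \<in> A} \<partial>C 0 n ?u)"
      using space_C[OF u, of n] A
      by (intro nn_integral_cong) (simp add: emeasure_eP vimage_def)
    finally show ?thesis .
  qed
  have sets_cell[measurable]: "{\<omega> \<in> space (?M (Suc n)). \<omega> n = a} \<in> sets (?M (Suc n))" for n a
    by measurable
  have sets_cell2[measurable]: "{\<omega> \<in> space (?M (Suc (Suc n))). \<omega> n = a \<and> \<omega> (Suc n) = b} \<in> sets (?M (Suc (Suc n)))" for n a b
    by measurable
  have upd: "fun_upd \<omega> n x \<in> space (?M (Suc n))" if "\<omega> \<in> space (?M n)" for \<omega> n x
    using that by (auto simp: space_PiM PiE_iff extensional_def)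
  \<comment> \<open>Given the one-point law at time \<open>n\<close>, weight times kernel gives back
    \<open>Q n\<close>. The induction for \<open>cell\<close> then sums over the previous state and
    applies \<open>consistent\<close>.\<close>
  have pair: "emeasure (C 0 (Suc (Suc n)) ?u) {\<omega> \<in> space (?M (Suc (Suc n))). \<omega> n = a \<and> \<omega> (Suc n) = b}
      = emeasure (Q n) {(a, b)}"
    if cell: "emeasure (C 0 (Suc n) ?u) {\<omega> \<in> space (?M (Suc n)). \<omega> n = a} = emeasure (Q n) ({a} \<times> UNIV)" for n a b
  proof -
    have "emeasure (C 0 (Suc (Suc n)) ?u) {\<omega> \<in> space (?M (Suc (Suc n))). \<omega> n = a \<and> \<omega> (Suc n) = b}
        = (\<integral>\<^sup>+ \<omega>. emeasure (K n a) {b} * indicator {\<omega> \<in> space (?M (Suc n)). \<omega> n = a} \<omega> \<partial>C 0 (Suc n) ?u)"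
      using space_C[OF u, of "Suc n"]
      by (subst step[OF sets_cell2], intro nn_integral_cong) (auto simp: upd \<K>_def indicator_def simp del: C.simps)
    also have "\<dots> = emeasure (K n a) {b} * emeasure (C 0 (Suc n) ?u) {\<omega> \<in> space (?M (Suc n)). \<omega> n = a}"
      using sets_C[OF u, of "Suc n"] by (subst nn_integral_cmult_indicator) (auto simp del: C.simps)
    finally show ?thesis
      unfolding cell using K[of n a b] by (simp add: mult.commute del: C.simps)
  qed
  have cell: "emeasure (C 0 (Suc n) ?u) {\<omega> \<in> space (?M (Suc n)). \<omega> n = a} = emeasure (Q n) ({a} \<times> UNIV)" for n a
  proof (induction n arbitrary: a)
    case 0
    interpret C0: prob_space "C 0 0 ?u" by (rule prob_space_C[OF u])
    have "emeasure (C 0 (Suc 0) ?u) {\<omega> \<in> space (?M (Suc 0)). \<omega> 0 = a} =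
        (\<integral>\<^sup>+ \<omega>. emeasure (Q 0) ({a} \<times> UNIV) \<partial>C 0 0 ?u)"
      using space_C[OF u, of 0] upd[of _ 0]
      by (subst step[OF sets_cell], intro nn_integral_cong)
         (auto simp: \<K>_def emeasure_distr meas_Q space_Q intro!: arg_cong[where f="emeasure (Q 0)"])
    then show ?case using C0.emeasure_space_1 by (simp del: C.simps)
  next
    case (Suc n)
    let ?B = "\<lambda>a'. {\<omega> \<in> space (?M (Suc (Suc n))). \<omega> n = a' \<and> \<omega> (Suc n) = a}"
    have "{\<omega> \<in> space (?M (Suc (Suc n))). \<omega> (Suc n) = a} = (\<Union>a'. ?B a')" by auto
    then have "emeasure (C 0 (Suc (Suc n)) ?u) {\<omega> \<in> space (?M (Suc (Suc n))). \<omega> (Suc n) = a} =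
        (\<Sum>a'. emeasure (C 0 (Suc (Suc n)) ?u) (?B a'))"
      using sets_C[OF u, of "Suc (Suc n)"]
      by (simp only:, subst suminf_emeasure) (auto simp: disjoint_family_on_def simp del: C.simps)
    also have "\<dots> = (\<Sum>a'. emeasure (Q n) {(a', a)})"
      using pair[OF Suc] by simp
    also have "\<dots> = emeasure (Q n) (\<Union>a'. {(a', a)})"
      by (rule suminf_emeasure) (auto simp: disjoint_family_on_def sets_Q)
    also have "(\<Union>a'. {(a', a)}) = UNIV \<times> {a}" by auto
    finally show ?case by (simp only: consistent)
  qed
  show thesis
  proof
    show "prob_space PF.lim"
    \<comment> \<open>Restricting to no coordinates at all maps the limit to a trivial product,
      where the total mass \<open>1\<close> can be read off.\<close>
    proof (rule prob_space_distrD)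
      show "(\<lambda>\<omega>. restrict \<omega> {}) \<in> PF.lim \<rightarrow>\<^sub>M PiM {} (\<lambda>_. count_space UNIV)"
        by (simp add: measurable_cong_sets[OF PF.sets_lim refl] measurable_restrict_subset)
      show "prob_space (distr PF.lim (PiM {} (\<lambda>_. count_space UNIV)) (\<lambda>\<omega>. restrict \<omega> {}))"
        by (simp add: distr_lim PF.prob_space_P)
    qed
    show "(\<lambda>\<omega>. \<omega> n) \<in> measurable PF.lim (count_space UNIV)" for n
      by (simp add: measurable_cong_sets[OF PF.sets_lim refl] measurable_component_singleton)
    fix n a b
    let ?J = "{0..<Suc (Suc n)}" and ?X = "{\<omega> \<in> space (?M (Suc (Suc n))). \<omega> n = a \<and> \<omega> (Suc n) = b}"
    have "emeasure PF.lim (PF.emb UNIV ?J ?X) = emeasure (CI ?J) ?X"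
      by (rule lim) auto
    also have "\<dots> = emeasure (C 0 (Suc (Suc n)) ?u) (PF.emb ?J ?J ?X)"
      by (rule emeasure_CI) auto
    also have "PF.emb ?J ?J ?X = ?X"
      by (rule prod_emb_id) (auto simp: space_PiM)
    also have "PF.emb UNIV ?J ?X = {\<omega>\<in>space PF.lim. \<omega> n = a \<and> \<omega> (Suc n) = b}"
      by (auto simp: prod_emb_def space_PiM)
    finally show "emeasure PF.lim {\<omega>\<in>space PF.lim. \<omega> n = a \<and> \<omega> (Suc n) = b} = emeasure (Q n) {(a, b)}"
      using pair[OF cell] by (simp del: C.simps)
  qed
qed

section \<open>The data set generated by a feature process\<close>

text \<open>The cells \<open>C k\<close> are small for the pseudometric \<open>sup\<^sub>i |ev \<omega> i - ev \<omega>' i|\<close>. They replace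
  measurability of the evaluation map: every set open for this pseudometric is a countable union
  of cells.\<close>

locale feature_process = prob_space P for P :: "'w measure" +
  fixes W :: "'w set" and C :: "nat \<Rightarrow> 'w set" and I :: "'i set" and ev :: "'w \<Rightarrow> 'i \<Rightarrow> real"
  assumes W[measurable]: "W \<in> events" and prob_W: "prob W = 1"
    and C[measurable]: "\<And>k. C k \<in> events"
    and I: "I \<noteq> {}"
    and small_cell: "\<And>\<omega> e. \<omega> \<in> W \<Longrightarrow> e > 0 \<Longrightarrow>
          \<exists>k. \<omega> \<in> C k \<and> (\<forall>\<omega>'\<in>C k \<inter> W. \<forall>i\<in>I. \<bar>ev \<omega> i - ev \<omega>' i\<bar> \<le> e)"
    and bounded: "\<And>\<omega> \<omega>'. \<omega> \<in> W \<Longrightarrow> \<omega>' \<in> W \<Longrightarrow> \<exists>B. \<forall>i\<in>I. \<bar>ev \<omega> i - ev \<omega>' i\<bar> \<le> B"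
begin

text \<open>Full support of the limit measure forces the null cells out. There are countably many
  cells, so only a null set is removed.\<close>

definition essential :: "'w set" where
  "essential = W - (\<Union>k\<in>{k. prob (C k \<inter> W) = 0}. C k \<inter> W)"

lemma essential_subset: "essential \<subseteq> W" by (auto simp: essential_def)

lemma essential_events[measurable]: "essential \<in> events"
  unfolding essential_def by measurable

lemma prob_essential: "prob essential = 1"
proof -
  have "(\<Union>k\<in>{k. prob (C k \<inter> W) = 0}. C k \<inter> W) \<in> null_sets P"
    by (rule null_sets_UN') (auto simp: null_sets_def emeasure_eq_measure)
  then have "prob (\<Union>k\<in>{k. prob (C k \<inter> W) = 0}. C k \<inter> W) = 0"
    by (simp add: null_sets_def measure_def)
  then show ?thesis
    unfolding essential_def using prob_W
    by (subst finite_measure_Diff) auto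
qed

lemma essential_cell:
  assumes "\<omega> \<in> essential" "\<omega> \<in> C k"
  shows "prob (C k \<inter> essential) > 0"
proof -
  have "prob (C k \<inter> W) \<noteq> 0" using assms by (auto simp: essential_def)
  moreover have "AE \<omega> in P. \<omega> \<in> essential"
    using prob_essential by (subst prob_eq_1[symmetric]) auto
  then have "prob (C k \<inter> W) = prob (C k \<inter> essential)"
    by (intro finite_measure_eq_AE) (use essential_subset in auto)
  ultimately show ?thesis by (simp add: zero_less_measure_iff)
qed

lemma essential_small_cell:
  assumes "\<omega> \<in> essential" "e > 0"
  obtains k where "\<omega> \<in> C k"
    "\<And>\<omega>' i. \<omega>' \<in> C k \<Longrightarrow> \<omega>' \<in> essential \<Longrightarrow> i \<in> I \<Longrightarrow> \<bar>ev \<omega> i - ev \<omega>' i\<bar> \<le> e"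
proof -
  have "\<omega> \<in> W" using assms(1) essential_subset by blast
  from small_cell[OF this assms(2)] show thesis
    using that essential_subset by blast
qed

lemma essential_nonempty: "essential \<noteq> {}"
  using prob_essential by auto

text \<open>Every cell around an essential path has positive probability, so the closure of the essential
  evaluations is exactly the support of the law of the evaluation.\<close>

definition states :: "('i \<Rightarrow> real) set" where
  "states = {\<phi> \<in> extensional I. \<forall>e>0. \<exists>\<omega>\<in>essential. \<forall>i\<in>I. \<bar>\<phi> i - ev \<omega> i\<bar> \<le> e}"

lemma ev_states: "\<omega> \<in> essential \<Longrightarrow> restrict (ev \<omega>) I \<in> states"
  by (auto simp: states_def intro!: bexI[of _ \<omega>])

lemma states_approx:
  assumes "\<phi> \<in> states" "e > 0"
  obtains \<omega> where "\<omega> \<in> essential" "\<And>i. i \<in> I \<Longrightarrow> \<bar>\<phi> i - ev \<omega> i\<bar> \<le> e"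
  using assms unfolding states_def by blast

lemma states_bounded:
  assumes "\<phi> \<in> states" "\<psi> \<in> states"
  shows "\<exists>B. \<forall>i\<in>I. \<bar>\<phi> i - \<psi> i\<bar> \<le> B"
proof -
  obtain \<omega> where 1: "\<omega> \<in> essential" "\<And>i. i \<in> I \<Longrightarrow> \<bar>\<phi> i - ev \<omega> i\<bar> \<le> 1"
    using states_approx[OF assms(1), of 1] by auto
  obtain \<omega>' where 2: "\<omega>' \<in> essential" "\<And>i. i \<in> I \<Longrightarrow> \<bar>\<psi> i - ev \<omega>' i\<bar> \<le> 1"
    using states_approx[OF assms(2), of 1] by auto
  obtain B where B: "\<And>i. i \<in> I \<Longrightarrow> \<bar>ev \<omega> i - ev \<omega>' i\<bar> \<le> B"
    using bounded 1(1) 2(1) essential_subset by blast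
  have "\<bar>\<phi> i - \<psi> i\<bar> \<le> B + 2" if "i \<in> I" for i
    using 1(2)[OF that] 2(2)[OF that] B[OF that] unfolding abs_le_iff by linarith
  then show ?thesis by blast
qed

text \<open>A state is determined by the set of cells to which it is close, at each scale.\<close>

lemma states_lepoll: "states \<lesssim> (UNIV :: nat set set)"
  unfolding lepoll_def
proof (intro exI conjI)
  define S where "S \<phi> = {(k, l). \<forall>\<omega>\<in>C k \<inter> essential. \<forall>i\<in>I. \<bar>\<phi> i - ev \<omega> i\<bar> \<le> 1 / Suc l}" for \<phi>
  let ?code = "\<lambda>\<phi>. prod_encode ` S \<phi>"
  show "inj_on ?code states"
  proof (rule inj_onI)
    fix \<phi> \<psi> assume \<phi>: "\<phi> \<in> states" and \<psi>: "\<psi> \<in> states" and eq: "?code \<phi> = ?code \<psi>"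
    have SS: "S \<phi> = S \<psi>" using eq inj_image_eq_iff[OF inj_prod_encode[of UNIV]] by blast
    have close: "\<bar>\<phi> i - \<psi> i\<bar> \<le> 2 / Suc l" if "i \<in> I" for i l
    proof -
      \<comment> \<open>Two halves of \<open>1 / Suc l\<close>: one for the path
        \<open>\<omega>\<close> that approximates \<open>\<phi>\<close>, one for the size of its
        cell. Membership in the common code then places both states near
        \<open>ev \<omega>\<close>.\<close>
      define d where "d = 1 / (2 * real (Suc l))"
      have "d > 0" and half: "1 / real (Suc l) = d + d" "2 / real (Suc l) = d + d + d + d"
        by (simp_all add: d_def field_simps)
      obtain \<omega> where \<omega>: "\<omega> \<in> essential" "\<And>i. i \<in> I \<Longrightarrow> \<bar>\<phi> i - ev \<omega> i\<bar> \<le> d"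
        using states_approx[OF \<phi> \<open>d > 0\<close>] by auto
      obtain k where k: "\<omega> \<in> C k" "\<And>\<omega>' i. \<omega>' \<in> C k \<Longrightarrow> \<omega>' \<in> essential \<Longrightarrow> i \<in> I \<Longrightarrow> \<bar>ev \<omega> i - ev \<omega>' i\<bar> \<le> d"
        using essential_small_cell[OF \<omega>(1) \<open>d > 0\<close>] by auto
      have "\<bar>\<phi> i - ev \<omega>' i\<bar> \<le> 1 / Suc l" if "\<omega>' \<in> C k \<inter> essential" "i \<in> I" for \<omega>' i
        using \<omega>(2)[OF that(2)] k(2)[of \<omega>' i] that unfolding half abs_le_iff by auto
      then have "(k, l) \<in> S \<phi>" unfolding S_def by blast
      then have "(k, l) \<in> S \<psi>" using SS by simp
      then have "\<bar>\<psi> i - ev \<omega> i\<bar> \<le> 1 / Suc l" using k(1) \<omega>(1) \<open>i \<in> I\<close> unfolding S_def by blast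
      then show ?thesis
        using \<omega>(2)[OF \<open>i \<in> I\<close>] \<open>d > 0\<close> unfolding half abs_le_iff by linarith
    qed
    show "\<phi> = \<psi>"
    proof (rule extensionalityI[of _ I])
      fix i assume "i \<in> I"
      have "(\<lambda>l. 2 / real (Suc l)) \<longlonglongrightarrow> 0"
        using LIMSEQ_Suc[OF lim_const_over_n[of "2::real"]] .
      then have "\<bar>\<phi> i - \<psi> i\<bar> \<le> 0"
        by (rule LIMSEQ_le_const) (use close[OF \<open>i \<in> I\<close>] in auto)
      then show "\<phi> i = \<psi> i" by simp
    qed (use \<phi> \<psi> in \<open>auto simp: states_def\<close>)
  qed
qed simp

end

text \<open>States are functions on the index set, whereas the limit must have points of type
  \<open>'a\<close>; \<open>emb\<close> transports them.\<close>

locale feature_process_points = feature_process P W C I ev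
  for P :: "'w measure" and W C and I :: "'i set" and ev +
  fixes emb :: "('i \<Rightarrow> real) \<Rightarrow> 'a"
  assumes inj_emb: "inj_on emb states"
begin

definition "points = emb ` states"
definition "val x = inv_into states emb x"
definition "feature i = (\<lambda>x\<in>points. val x i)"
text \<open>Paths outside \<open>essential\<close> form a null set; sending all of them to one
  arbitrary state keeps the map total and measurable.\<close>

definition "point \<omega> = emb (if \<omega> \<in> essential then restrict (ev \<omega>) I else (SOME \<phi>. \<phi> \<in> states))"
text \<open>Stated ahead of \<open>limit_set\<close> because the sigma-algebra there already refers
  to this topology; \<open>fdist_limit_set\<close> identifies it with the distance given by the
  features.\<close>

definition "dst x y = (if x \<in> points \<and> y \<in> points then (SUP i\<in>I. \<bar>val x i - val y i\<bar>) else 0)"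

definition limit_set :: "'a data_set" where
  "limit_set = \<lparr>pts = points, feats = feature ` I,
     msr = distr P (sigma points {U. openin (Metric_space.mtopology points dst) U}) point\<rparr>"

lemma val_emb: "\<phi> \<in> states \<Longrightarrow> val (emb \<phi>) = \<phi>"
  using inj_emb by (simp add: val_def)

lemma val_states: "x \<in> points \<Longrightarrow> val x \<in> states"
  by (auto simp: points_def val_emb)

lemma emb_val: "x \<in> points \<Longrightarrow> emb (val x) = x"
  by (auto simp: points_def val_emb)

lemma point_points: "point \<omega> \<in> points"
proof -
  obtain \<omega>' where "\<omega>' \<in> essential" using essential_nonempty by blast
  then have "(SOME \<phi>. \<phi> \<in> states) \<in> states"
    using ev_states someI[of "\<lambda>\<phi>. \<phi> \<in> states"] by blast
  then show ?thesis using ev_states by (auto simp: point_def points_def)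
qed

lemma val_point: "\<omega> \<in> essential \<Longrightarrow> i \<in> I \<Longrightarrow> val (point \<omega>) i = ev \<omega> i"
  by (simp add: point_def val_emb ev_states)

lemma dense: 
  assumes "x \<in> points" "e > 0" 
  obtains \<omega> where "\<omega> \<in> essential" "\<And>i. i \<in> I \<Longrightarrow> \<bar>val x i - ev \<omega> i\<bar> \<le> e"
  using states_approx[OF val_states[OF assms(1)] assms(2)] by blast

lemma bdd_val: "x \<in> points \<Longrightarrow> y \<in> points \<Longrightarrow> bdd_above ((\<lambda>i. \<bar>val x i - val y i\<bar>) ` I)"
  using states_bounded[OF val_states val_states] by (fastforce simp: bdd_above_def)

lemma dst_le_iff: "x \<in> points \<Longrightarrow> y \<in> points \<Longrightarrow> dst x y \<le> e \<longleftrightarrow> (\<forall>i\<in>I. \<bar>val x i - val y i\<bar> \<le> e)"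
  using cSUP_le_iff[OF I bdd_val] by (simp add: dst_def)

lemma val_le_dst: "x \<in> points \<Longrightarrow> y \<in> points \<Longrightarrow> i \<in> I \<Longrightarrow> \<bar>val x i - val y i\<bar> \<le> dst x y"
  using dst_le_iff by blast

sublocale D: Metric_space points dst
proof
  have c: "dst x y = dst y x" for x y by (simp add: dst_def abs_minus_commute)
  then show "dst x y = dst y x" for x y .
  obtain i0 where i0: "i0 \<in> I" using I by blast
  show "0 \<le> dst x y" for x y
    using val_le_dst[of x y i0] i0 by (cases "x \<in> points \<and> y \<in> points") (auto simp: dst_def[of x y])
  fix x y assume xy: "x \<in> points" "y \<in> points"
  show "dst x y = 0 \<longleftrightarrow> x = y"
  proof
    assume "dst x y = 0"
    then have "val x i = val y i" if "i \<in> I" for i using val_le_dst[OF xy that] by simp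
    then have "val x = val y"
      using val_states[OF xy(1)] val_states[OF xy(2)] by (auto simp: states_def intro: extensionalityI)
    then show "x = y" using emb_val xy by metis
  qed (use I xy in \<open>auto simp: dst_def\<close>)
  fix z assume z: "z \<in> points"
  have "\<bar>val x i - val z i\<bar> \<le> dst x y + dst y z" if "i \<in> I" for i
    using val_le_dst[OF xy that] val_le_dst[OF xy(2) z that] by linarith
  then show "dst x z \<le> dst x y + dst y z"
    using dst_le_iff[OF xy(1) z] by blast
qed

lemma fdist_limit_set: "fdist limit_set = dst"
proof (intro ext)
  fix x y
  have "(\<lambda>f. \<bar>f x - f y\<bar>) ` feature ` I = (\<lambda>i. \<bar>val x i - val y i\<bar>) ` I" if "x \<in> points" "y \<in> points"
    using that by (simp add: image_image feature_def)
  then show "fdist limit_set x y = dst x y"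
    by (auto simp: fdist_def dst_def limit_set_def)
qed

lemma small_cell_points:
  assumes "\<omega> \<in> essential" "openin D.mtopology U" "point \<omega> \<in> U"
  obtains k where "\<omega> \<in> C k" "point ` (C k \<inter> essential) \<subseteq> U"
proof -
  obtain r where r: "r > 0" "D.mball (point \<omega>) r \<subseteq> U"
    using assms D.openin_mtopology by blast
  obtain k where k: "\<omega> \<in> C k" "\<And>\<omega>' i. \<omega>' \<in> C k \<Longrightarrow> \<omega>' \<in> essential \<Longrightarrow> i \<in> I \<Longrightarrow> \<bar>ev \<omega> i - ev \<omega>' i\<bar> \<le> r / 2"
    using essential_small_cell[OF assms(1), of "r / 2"] r(1) by auto
  have "point \<omega>' \<in> U" if \<omega>': "\<omega>' \<in> C k" "\<omega>' \<in> essential" for \<omega>'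
  proof -
    have "dst (point \<omega>) (point \<omega>') \<le> r / 2"
      unfolding dst_le_iff[OF point_points point_points]
      using k(2)[OF \<omega>'] \<omega>' assms(1) by (simp add: val_point)
    then show ?thesis using r point_points by (auto simp: D.in_mball subset_iff)
  qed
  then show thesis using that k(1) by blast
qed

lemma measurable_point[measurable]:
  "point \<in> measurable P (sigma points {U. openin D.mtopology U})"
proof (rule measurable_measure_of)
  show "{U. openin D.mtopology U} \<subseteq> Pow points"
    using openin_subset[of D.mtopology] by auto
  fix U assume "U \<in> {U. openin D.mtopology U}"
  then have U: "openin D.mtopology U" by simp
  define K where "K = {k. point ` (C k \<inter> essential) \<subseteq> U}"
  \<comment> \<open>Each essential path in the preimage has a cell around it whose essential part
    stays inside; off \<open>essential\<close> the map is constant, so that part of the preimage is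
    everything or nothing.\<close>
  have "point -` U \<inter> space P = (essential \<inter> (\<Union>k\<in>K. C k)) \<union> ((space P - essential) \<inter> (if emb (SOME \<phi>. \<phi> \<in> states) \<in> U then space P else {}))"
  proof (intro equalityI subsetI)
    fix \<omega> assume \<omega>: "\<omega> \<in> point -` U \<inter> space P"
    show "\<omega> \<in> (essential \<inter> (\<Union>k\<in>K. C k)) \<union> ((space P - essential) \<inter> (if emb (SOME \<phi>. \<phi> \<in> states) \<in> U then space P else {}))"
    proof (cases "\<omega> \<in> essential")
      case True
      then obtain k where "\<omega> \<in> C k" "k \<in> K"
        using small_cell_points[OF _ U, of \<omega>] \<omega> by (auto simp: K_def)
      then show ?thesis using True by blast
    qed (use \<omega> in \<open>auto simp: point_def\<close>)
  next
    fix \<omega> assume "\<omega> \<in> (essential \<inter> (\<Union>k\<in>K. C k)) \<union> ((space P - essential) \<inter> (if emb (SOME \<phi>. \<phi> \<in> states) \<in> U then space P else {}))"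
    then show "\<omega> \<in> point -` U \<inter> space P"
      using sets.sets_into_space[OF essential_events] by (auto simp: K_def point_def split: if_splits)
  qed
  also have "\<dots> \<in> events" by auto
  finally show "point -` U \<inter> space P \<in> events" .
qed (use point_points in auto)

lemma geometric_limit_set: "geometric_data_set limit_set"
proof -
  have sets: "sets (msr limit_set) = sigma_sets points {U. openin D.mtopology U}"
    unfolding limit_set_def using openin_subset[of D.mtopology] by (auto intro!: sets_measure_of)
  have space: "space (msr limit_set) = points"
    by (simp add: limit_set_def space_measure_of_conv)
  have pts: "pts limit_set = points" and feats: "feats limit_set = feature ` I"
    by (simp_all add: limit_set_def)
  have "D.mcomplete"
    unfolding D.mcomplete_def
  proof (intro allI impI)
    fix \<sigma> assume \<sigma>: "D.MCauchy \<sigma>"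
    then have \<sigma>p: "\<sigma> n \<in> points" for n by (auto simp: D.MCauchy_def)
    have cauchy: "Cauchy (\<lambda>n. val (\<sigma> n) i)" if "i \<in> I" for i
    proof (rule metric_CauchyI)
      fix e :: real assume "e > 0"
      then obtain N where N: "\<And>m n. m \<ge> N \<Longrightarrow> n \<ge> N \<Longrightarrow> dst (\<sigma> m) (\<sigma> n) < e"
        using \<sigma> unfolding D.MCauchy_def by blast
      show "\<exists>N. \<forall>m\<ge>N. \<forall>n\<ge>N. dist (val (\<sigma> m) i) (val (\<sigma> n) i) < e"
        unfolding dist_real_def using N val_le_dst[OF \<sigma>p \<sigma>p that]
        by (intro exI[of _ N] allI impI) (rule le_less_trans)
    qed
    define \<phi> where "\<phi> = (\<lambda>i\<in>I. lim (\<lambda>n. val (\<sigma> n) i))"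
    have lim: "(\<lambda>n. val (\<sigma> n) i) \<longlonglongrightarrow> \<phi> i" if "i \<in> I" for i
      using cauchy[OF that] that by (auto simp: \<phi>_def Cauchy_convergent_iff convergent_LIMSEQ_iff)
    \<comment> \<open>Letting \<open>m\<close> tend to infinity in the Cauchy estimate makes the
      convergence uniform in \<open>i\<close>. This both places \<open>\<phi>\<close> among the
      states and gives convergence for \<open>dst\<close>.\<close>
    have unif: "\<exists>N. \<forall>n\<ge>N. \<forall>i\<in>I. \<bar>val (\<sigma> n) i - \<phi> i\<bar> \<le> e" if e: "e > 0" for e
    proof -
      obtain N where N: "\<And>m n. m \<ge> N \<Longrightarrow> n \<ge> N \<Longrightarrow> dst (\<sigma> m) (\<sigma> n) < e"
        using \<sigma> e unfolding D.MCauchy_def by blast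
      have "\<bar>val (\<sigma> n) i - \<phi> i\<bar> \<le> e" if "n \<ge> N" "i \<in> I" for n i
      proof (rule LIMSEQ_le_const2)
        show "(\<lambda>m. \<bar>val (\<sigma> n) i - val (\<sigma> m) i\<bar>) \<longlonglongrightarrow> \<bar>val (\<sigma> n) i - \<phi> i\<bar>"
          by (intro tendsto_intros lim that)
        show "\<exists>N. \<forall>m\<ge>N. \<bar>val (\<sigma> n) i - val (\<sigma> m) i\<bar> \<le> e"
          using N[OF that(1)] val_le_dst[OF \<sigma>p \<sigma>p that(2)] by (meson less_imp_le order_trans)
      qed
      then show ?thesis by blast
    qed
    have \<phi>: "\<phi> \<in> states"
      unfolding states_def
    proof (intro CollectI conjI allI impI)
      fix e :: real assume "e > 0"
      then obtain n where n: "\<And>i. i \<in> I \<Longrightarrow> \<bar>val (\<sigma> n) i - \<phi> i\<bar> \<le> e / 2"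
        using unif[of "e / 2"] by auto
      obtain \<omega> where \<omega>: "\<omega> \<in> essential" "\<And>i. i \<in> I \<Longrightarrow> \<bar>val (\<sigma> n) i - ev \<omega> i\<bar> \<le> e / 2"
        using dense[OF \<sigma>p, of "e / 2"] \<open>e > 0\<close> by auto
      have "\<bar>\<phi> i - ev \<omega> i\<bar> \<le> e" if "i \<in> I" for i
        using n[OF that] \<omega>(2)[OF that] by linarith
      then show "\<exists>\<omega>\<in>essential. \<forall>i\<in>I. \<bar>\<phi> i - ev \<omega> i\<bar> \<le> e" using \<omega>(1) by blast
    qed (simp add: \<phi>_def)
    then have \<phi>p: "emb \<phi> \<in> points" by (simp add: points_def)
    have "limitin D.mtopology \<sigma> (emb \<phi>) sequentially"
      unfolding D.limit_metric_sequentially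
    proof (intro conjI allI impI \<phi>p)
      fix e :: real assume "e > 0"
      then obtain N where N: "\<And>n i. n \<ge> N \<Longrightarrow> i \<in> I \<Longrightarrow> \<bar>val (\<sigma> n) i - \<phi> i\<bar> \<le> e / 2"
        using unif[of "e / 2"] by auto
      have "dst (\<sigma> n) (emb \<phi>) < e" if "n \<ge> N" for n
      proof -
        have "dst (\<sigma> n) (emb \<phi>) \<le> e / 2"
          unfolding dst_le_iff[OF \<sigma>p \<phi>p] val_emb[OF \<phi>] using N[OF that] by blast
        then show ?thesis using \<open>e > 0\<close> by linarith
      qed
      then show "\<exists>N. \<forall>n\<ge>N. \<sigma> n \<in> points \<and> dst (\<sigma> n) (emb \<phi>) < e"
        using \<sigma>p by blast
    qed
    then show "\<exists>x. limitin D.mtopology \<sigma> x sequentially" by blast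
  qed
  moreover have "separable_space D.mtopology"
    unfolding separable_space_def
  proof (intro exI conjI)
    \<comment> \<open>One path from every cell that meets \<open>essential\<close>; since small
      cells exist around every essential path, these countably many points are dense.\<close>
    define w where "w k = (SOME \<omega>. \<omega> \<in> C k \<inter> essential)" for k
    let ?S = "{point (w k) | k. C k \<inter> essential \<noteq> {}}"
    show "countable ?S" by (rule countable_subset[of _ "range (\<lambda>k. point (w k))"]) auto
    show "?S \<subseteq> topspace D.mtopology" using point_points by auto
    have "x \<in> D.mtopology closure_of ?S" if x: "x \<in> points" for x
      unfolding D.metric_closure_of
    proof (intro CollectI conjI allI impI x)
      fix r :: real assume "r > 0"
      then obtain \<omega> where \<omega>: "\<omega> \<in> essential" "\<And>i. i \<in> I \<Longrightarrow> \<bar>val x i - ev \<omega> i\<bar> \<le> r / 2"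
        using dense[OF x, of "r / 2"] by auto
      have "dst x (point \<omega>) \<le> r / 2"
        unfolding dst_le_iff[OF x point_points] using \<omega> by (simp add: val_point)
      then have "point \<omega> \<in> D.mball x r" using \<open>r > 0\<close> x point_points by (simp add: D.in_mball)
      then obtain k where k: "\<omega> \<in> C k" "point ` (C k \<inter> essential) \<subseteq> D.mball x r"
        using small_cell_points[OF \<omega>(1) D.openin_mball] by blast
      then have ne: "C k \<inter> essential \<noteq> {}" using \<omega>(1) by blast
      then have "w k \<in> C k \<inter> essential" unfolding w_def by (rule some_in_eq[THEN iffD2])
      then show "\<exists>y\<in>?S. y \<in> D.mball x r" using k(2) ne by blast
    qed
    then show "D.mtopology closure_of ?S = topspace D.mtopology"
      using closure_of_subset_topspace[of D.mtopology ?S] by auto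
  qed
  moreover have "prob_space (msr limit_set)"
    unfolding limit_set_def by (simp add: prob_space_distr)
  \<comment> \<open>A nonempty open set contains the image of the essential part of some cell around
    an essential path, and that part is never null.\<close>
  moreover have "measure (msr limit_set) U > 0" if U: "openin D.mtopology U" "U \<noteq> {}" for U
  proof -
    obtain x where x: "x \<in> U" "x \<in> points" using U D.openin_mtopology by blast
    obtain r where r: "r > 0" "D.mball x r \<subseteq> U" using U x D.openin_mtopology by blast
    obtain \<omega> where \<omega>: "\<omega> \<in> essential" "\<And>i. i \<in> I \<Longrightarrow> \<bar>val x i - ev \<omega> i\<bar> \<le> r / 2"
      using dense[OF x(2), of "r / 2"] r by auto
    have "dst x (point \<omega>) \<le> r / 2"
      unfolding dst_le_iff[OF x(2) point_points] using \<omega> by (simp add: val_point)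
    then have "point \<omega> \<in> U" using r x point_points by (auto simp: D.in_mball subset_iff)
    then obtain k where k: "\<omega> \<in> C k" "point ` (C k \<inter> essential) \<subseteq> U"
      using small_cell_points[OF \<omega>(1) U(1)] by blast
    have meas: "U \<in> sets (sigma points {U. openin D.mtopology U})"
      using openin_subset[of D.mtopology] U(1) by (subst sets_measure_of) (auto intro: sigma_sets.Basic)
    have "0 < prob (C k \<inter> essential)" by (rule essential_cell) fact+
    also have "\<dots> \<le> prob (point -` U \<inter> space P)"
      using k(2) sets.sets_into_space[OF essential_events]
      by (intro finite_measure_mono measurable_sets[OF measurable_point meas]) auto
    also have "\<dots> = measure (msr limit_set) U"
      using measure_distr[OF measurable_point meas] by (simp add: limit_set_def)
    finally show ?thesis .
  qed
  moreover have "(\<lambda>f. \<bar>f x - f y\<bar>) ` feature ` I = (\<lambda>i. \<bar>val x i - val y i\<bar>) ` I" if "x \<in> points" "y \<in> points" for x y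
    using that by (simp add: image_image feature_def)
  moreover have "feature ` I \<subseteq> extensional points" by (auto simp: feature_def)
  ultimately show ?thesis
    unfolding geometric_data_set_def pts feats fdist_limit_set
    using sets space D.Metric_space_axioms bdd_val I by simp
qed

end

text \<open>The injections from states to sets of naturals, to reals, to \<open>'a\<close> supply
  \<open>emb\<close>. Only what the limit argument uses is exported: the law of
  \<open>\<xi>\<close>, its evaluations on an event of full measure, and the uniform density of
  these evaluations.\<close>

lemma (in feature_process) data_set_exists:
  assumes "(UNIV :: real set) \<lesssim> (UNIV :: 'a set)"
  obtains D :: "'a data_set" and g \<xi> V where
    "geometric_data_set D" "feats D = g ` I" "\<xi> \<in> measurable P (msr D)" "distr P (msr D) \<xi> = msr D"
    "V \<in> events" "prob V = 1" "V \<subseteq> W" "\<And>\<omega> i. \<omega> \<in> V \<Longrightarrow> i \<in> I \<Longrightarrow> g i (\<xi> \<omega>) = ev \<omega> i"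
    "\<And>x e. x \<in> pts D \<Longrightarrow> e > 0 \<Longrightarrow> \<exists>\<omega>\<in>V. \<forall>i\<in>I. \<bar>g i x - ev \<omega> i\<bar> \<le> e"
proof -
  have "states \<lesssim> (UNIV :: 'a set)"
    using states_lepoll nat_sets_eqpoll_reals assms by (meson eqpoll_imp_lepoll lepoll_trans)
  then obtain emb :: "_ \<Rightarrow> 'a" where "inj_on emb states"
    by (auto simp: lepoll_def)
  then interpret feature_process_points P W C I ev emb by unfold_locales
  have m: "sets (msr limit_set) = sets (sigma points {U. openin D.mtopology U})"
    by (simp add: limit_set_def)
  show thesis
  proof (rule that[of limit_set feature point essential])
    show "point \<in> measurable P (msr limit_set)"
      using measurable_point by (simp cong: measurable_cong_sets add: m)
    show "distr P (msr limit_set) point = msr limit_set"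
      by (subst distr_cong[OF refl m refl]) (simp add: limit_set_def)
    show "\<exists>\<omega>\<in>essential. \<forall>i\<in>I. \<bar>feature i x - ev \<omega> i\<bar> \<le> e" if x': "x \<in> pts limit_set" and e: "e > 0" for x and e :: real
    proof -
      have x: "x \<in> points" using x' by (simp add: limit_set_def)
      obtain \<omega> where "\<omega> \<in> essential" "\<And>i. i \<in> I \<Longrightarrow> \<bar>val x i - ev \<omega> i\<bar> \<le> e"
        using dense[OF x e] by blast
      then show ?thesis using x by (auto simp: feature_def)
    qed
  qed (use geometric_limit_set essential_subset prob_essential point_points in
       \<open>auto simp: limit_set_def feature_def val_point\<close>)
qed

section \<open>Closeness in the box distance\<close>

text \<open>A real-valued stand-in for the box distance, with witnesses in place of infima. The
  factor \<open>2\<close> before the Hausdorff distance is left out, which accounts for the loss in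
  \<open>near_imp_box_dist_le\<close>.\<close>

definition near :: "real \<Rightarrow> 'a data_set \<Rightarrow> 'b data_set \<Rightarrow> bool" where
  "near e X Y \<longleftrightarrow>
     (\<exists>\<pi>\<in>couplings (msr X) (msr Y). \<exists>T. closedin (prod_topology (ftop X) (ftop Y)) T \<and> T \<noteq> {} \<and>
        1 - e \<le> measure \<pi> T \<and>
        (\<forall>f\<in>feats_closure X. \<exists>g\<in>feats_closure Y. \<forall>(x, y)\<in>T. \<bar>f x - g y\<bar> \<le> e) \<and>
        (\<forall>g\<in>feats_closure Y. \<exists>f\<in>feats_closure X. \<forall>(x, y)\<in>T. \<bar>f x - g y\<bar> \<le> e))"

text \<open>Couplings arise as joint laws of two maps on an auxiliary space, with matching
  controlled on an event \<open>T\<close>. The event is replaced by the set of all pairs of points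
  at which every compatible pair of features differs by at most \<open>e\<close>: it is closed by
  continuity and contains the image of \<open>T\<close>. On the side of \<open>Y\<close> the
  generating features suffice, by \<open>match_closure\<close>.\<close>

lemma nearI:
  fixes X :: "'a data_set" and Y :: "'b data_set" and Q :: "'w measure"
  assumes X: "geometric_data_set X" and Y: "geometric_data_set Y" and Q: "prob_space Q"
    and u[measurable]: "u \<in> measurable Q (msr X)" and du: "distr Q (msr X) u = msr X"
    and v[measurable]: "v \<in> measurable Q (msr Y)" and dv: "distr Q (msr Y) v = msr Y"
    and T: "T \<in> sets Q" "1 - e \<le> measure Q T" and e: "e < 1"
    and match: "\<And>f. f \<in> feats_closure X \<Longrightarrow> \<exists>g\<in>feats_closure Y. \<forall>\<omega>\<in>T. \<bar>f (u \<omega>) - g (v \<omega>)\<bar> \<le> e"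
      "\<And>g. g \<in> feats Y \<Longrightarrow> \<exists>f\<in>feats_closure X. \<forall>\<omega>\<in>T. \<bar>f (u \<omega>) - g (v \<omega>)\<bar> \<le> e"
  shows "near e X Y"
proof -
  interpret X: gds X by (rule gds.intro) fact
  interpret Y: gds Y by (rule gds.intro) fact
  interpret Q: prob_space Q by fact
  have uv: "u \<omega> \<in> pts X" "v \<omega> \<in> pts Y" if "\<omega> \<in> space Q" for \<omega>
    using measurable_space[OF u that] measurable_space[OF v that] by (simp_all add: X.space_msr Y.space_msr)
  have T0: "T \<noteq> {}" and TQ: "T \<subseteq> space Q"
    using T e sets.sets_into_space by auto
  define R where "R = {(f, g). f \<in> feats_closure X \<and> g \<in> feats_closure Y \<and> (\<forall>\<omega>\<in>T. \<bar>f (u \<omega>) - g (v \<omega>)\<bar> \<le> e)}"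
  have R1: "\<exists>g. (f, g) \<in> R" if "f \<in> feats_closure X" for f
    using match(1)[OF that] that by (auto simp: R_def)
  have R2: "\<exists>f. (f, g) \<in> R" if g: "g \<in> feats_closure Y" for g
  proof -
    have "\<exists>f\<in>feats_closure X. \<forall>(x, y)\<in>(\<lambda>\<omega>. (u \<omega>, v \<omega>)) ` T. \<bar>f x - g y\<bar> \<le> e"
    proof (rule X.match_closure[where G="feats Y"])
      fix A \<delta> assume "finite A" "A \<subseteq> snd ` (\<lambda>\<omega>. (u \<omega>, v \<omega>)) ` T" "(\<delta>::real) > 0"
      moreover from this have "A \<subseteq> v ` T" by (simp add: image_image)
      then have "A \<subseteq> pts Y" using uv(2) TQ by blast
      ultimately obtain g' where "g' \<in> feats Y" "\<And>y. y \<in> A \<Longrightarrow> \<bar>g' y - g y\<bar> < \<delta>"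
        using Y.feats_closure_approx[OF g, of A \<delta>] by blast
      then show "\<exists>g'\<in>feats Y. \<forall>y\<in>A. \<bar>g' y - g y\<bar> < \<delta>" by blast
    next
      show "\<exists>f\<in>feats_closure X. \<forall>(x, y)\<in>(\<lambda>\<omega>. (u \<omega>, v \<omega>)) ` T. \<bar>f x - g y\<bar> \<le> e" if "g \<in> feats Y" for g
        using match(2)[OF that] by auto
    qed (use uv TQ T0 in auto)
    then show ?thesis using g by (auto simp: R_def)
  qed
  have "R \<noteq> {}" using R1 X.feats_closure_nonempty by blast
  define S where "S r = {p \<in> topspace (prod_topology (ftop X) (ftop Y)). fst r (fst p) - snd r (snd p) \<in> {-e..e}}" for r
  have S: "closedin (prod_topology (ftop X) (ftop Y)) (S r)" if "r \<in> R" for r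
    unfolding S_def using that
    by (intro closedin_continuous_map_preimage[where Y=euclideanreal] continuous_intros
          continuous_map_compose[OF continuous_map_fst X.continuous_feats_closure, unfolded o_def]
          continuous_map_compose[OF continuous_map_snd Y.continuous_feats_closure, unfolded o_def])
       (auto simp: R_def)
  define T' where "T' = \<Inter> (S ` R)"
  have T': "closedin (prod_topology (ftop X) (ftop Y)) T'"
    unfolding T'_def using S \<open>R \<noteq> {}\<close> by (intro closedin_Inter) auto
  have T'm[measurable]: "T' \<in> sets (msr X \<Otimes>\<^sub>M msr Y)" by (rule closedin_prod_measurable[OF X Y T'])
  have TT': "(u \<omega>, v \<omega>) \<in> T'" if "\<omega> \<in> T" for \<omega>
    using that uv TQ by (auto simp: T'_def S_def R_def abs_le_iff)
  have T'R: "\<bar>f x - g y\<bar> \<le> e" if "(f, g) \<in> R" "(x, y) \<in> T'" for f g x y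
    using that by (force simp: T'_def S_def abs_le_iff)
  let ?\<pi> = "distr Q (msr X \<Otimes>\<^sub>M msr Y) (\<lambda>\<omega>. (u \<omega>, v \<omega>))"
  have "?\<pi> \<in> couplings (msr X) (msr Y)"
    by (simp add: couplings_def distr_distr o_def du dv)
  moreover have "1 - e \<le> measure ?\<pi> T'"
  proof -
    have "measure Q T \<le> measure Q ((\<lambda>\<omega>. (u \<omega>, v \<omega>)) -` T' \<inter> space Q)"
      using TT' TQ by (intro Q.finite_measure_mono) (auto intro!: measurable_sets[OF _ T'm])
    then show ?thesis using T(2) by (simp add: measure_distr)
  qed
  moreover have "T' \<noteq> {}" using TT' T0 by blast
  moreover have "\<exists>g\<in>feats_closure Y. \<forall>(x, y)\<in>T'. \<bar>f x - g y\<bar> \<le> e" if f: "f \<in> feats_closure X" for f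
  proof -
    obtain g where fg: "(f, g) \<in> R" using R1[OF f] by blast
    then have "g \<in> feats_closure Y" by (simp add: R_def)
    then show ?thesis using T'R[OF fg] by blast
  qed
  moreover have "\<exists>f\<in>feats_closure X. \<forall>(x, y)\<in>T'. \<bar>f x - g y\<bar> \<le> e" if g: "g \<in> feats_closure Y" for g
  proof -
    obtain f where fg: "(f, g) \<in> R" using R2[OF g] by blast
    then have "f \<in> feats_closure X" by (simp add: R_def)
    then show ?thesis using T'R[OF fg] by blast
  qed
  ultimately show ?thesis unfolding near_def using T' by blast
qed

lemma near_imp_box_dist_le:
  assumes X: "geometric_data_set X" and near: "near e X Y"
  shows "box_dist X Y \<le> ennreal (2 * e)"
proof -
  interpret X: gds X by (rule gds.intro) fact
  obtain \<pi> T where \<pi>: "\<pi> \<in> couplings (msr X) (msr Y)"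
    and T: "closedin (prod_topology (ftop X) (ftop Y)) T" "T \<noteq> {}" "1 - e \<le> measure \<pi> T"
    and XY: "\<And>f. f \<in> feats_closure X \<Longrightarrow> \<exists>g\<in>feats_closure Y. \<forall>(x, y)\<in>T. \<bar>f x - g y\<bar> \<le> e"
    and YX: "\<And>g. g \<in> feats_closure Y \<Longrightarrow> \<exists>f\<in>feats_closure X. \<forall>(x, y)\<in>T. \<bar>f x - g y\<bar> \<le> e"
    using near unfolding near_def by blast
  have "e \<ge> 0"
  proof -
    obtain f where "f \<in> feats_closure X" using X.feats_closure_nonempty by blast
    then obtain g where g: "\<forall>(x, y)\<in>T. \<bar>f x - g y\<bar> \<le> e" using XY by blast
    obtain x y where "(x, y) \<in> T" using T(2) by force
    then have "\<bar>f x - g y\<bar> \<le> e" using g by blast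
    then show ?thesis by linarith
  qed
  have h1: "(INF b\<in>(\<lambda>g. g \<circ> snd) ` feats_closure Y. dsup T (f \<circ> fst) b) \<le> ennreal e" if f: "f \<in> feats_closure X" for f
  proof -
    obtain g where g: "g \<in> feats_closure Y" "\<forall>(x, y)\<in>T. \<bar>f x - g y\<bar> \<le> e" using XY[OF f] by blast
    have "dsup T (f \<circ> fst) (g \<circ> snd) \<le> ennreal e"
      unfolding dsup_def using g(2) by (intro SUP_least ennreal_leI) auto
    then show ?thesis using g(1) by (intro INF_lower2[of "g \<circ> snd"]) auto
  qed
  have h2: "(INF a\<in>(\<lambda>f. f \<circ> fst) ` feats_closure X. dsup T a (g \<circ> snd)) \<le> ennreal e" if g: "g \<in> feats_closure Y" for g
  proof -
    obtain f where f: "f \<in> feats_closure X" "\<forall>(x, y)\<in>T. \<bar>f x - g y\<bar> \<le> e" using YX[OF g] by blast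
    have "dsup T (f \<circ> fst) (g \<circ> snd) \<le> ennreal e"
      unfolding dsup_def using f(2) by (intro SUP_least ennreal_leI) auto
    then show ?thesis using f(1) by (intro INF_lower2[of "f \<circ> fst"]) auto
  qed
  have "hausdorff (dsup T) ((\<lambda>f. f \<circ> fst) ` feats_closure X) ((\<lambda>g. g \<circ> snd) ` feats_closure Y) \<le> ennreal e"
    unfolding hausdorff_def using h1 h2 by (intro max.boundedI SUP_least) auto
  then have "2 * hausdorff (dsup T) ((\<lambda>f. f \<circ> fst) ` feats_closure X) ((\<lambda>g. g \<circ> snd) ` feats_closure Y) \<le> 2 * ennreal e"
    by (rule mult_left_mono) simp
  also have "2 * ennreal e = ennreal (2 * e)"
    using \<open>e \<ge> 0\<close> by (simp add: ennreal_mult)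
  finally have "max (ennreal (1 - measure \<pi> T))
      (2 * hausdorff (dsup T) ((\<lambda>f. f \<circ> fst) ` feats_closure X) ((\<lambda>g. g \<circ> snd) ` feats_closure Y)) \<le> ennreal (2 * e)"
    using T(3) \<open>e \<ge> 0\<close> by (intro max.boundedI ennreal_leI) auto
  then show ?thesis
    unfolding box_dist_def using \<pi> T by (intro INF_lower2[of "(\<pi>, T)"]) auto
qed

text \<open>The strict inequality lets witnesses be read off from each infimum, attained or not; the
  factor \<open>2\<close> is simply dropped.\<close>

lemma box_dist_less_imp_near:
  assumes less: "box_dist X Y < ennreal e"
  shows "near e X Y"
proof -
  obtain \<pi> T where \<pi>: "\<pi> \<in> couplings (msr X) (msr Y)"
    and T: "closedin (prod_topology (ftop X) (ftop Y)) T" "T \<noteq> {}"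
    and 1: "ennreal (1 - measure \<pi> T) < ennreal e"
    and 2: "2 * hausdorff (dsup T) ((\<lambda>f. f \<circ> fst) ` feats_closure X) ((\<lambda>g. g \<circ> snd) ` feats_closure Y) < ennreal e"
    using less unfolding box_dist_def INF_less_iff by auto
  let ?H = "hausdorff (dsup T) ((\<lambda>f. f \<circ> fst) ` feats_closure X) ((\<lambda>g. g \<circ> snd) ` feats_closure Y)"
  have "?H \<le> 2 * ?H" using mult_right_mono[of 1 2 ?H] by simp
  then have H: "?H < ennreal e" using 2 by (rule le_less_trans)
  have close: "\<forall>(x, y)\<in>T. \<bar>f x - g y\<bar> \<le> e" if "dsup T (f \<circ> fst) (g \<circ> snd) < ennreal e" for f g
  proof clarify
    fix x y assume "(x, y) \<in> T"
    then have "ennreal \<bar>f x - g y\<bar> \<le> dsup T (f \<circ> fst) (g \<circ> snd)"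
      unfolding dsup_def by (intro SUP_upper2[of "(x, y)"]) auto
    then have "ennreal \<bar>f x - g y\<bar> < ennreal e" using that by (rule le_less_trans)
    then show "\<bar>f x - g y\<bar> \<le> e" by (auto simp: ennreal_less_iff intro: less_imp_le)
  qed
  have "\<exists>g\<in>feats_closure Y. \<forall>(x, y)\<in>T. \<bar>f x - g y\<bar> \<le> e" if f: "f \<in> feats_closure X" for f
  proof -
    have "(INF b\<in>(\<lambda>g. g \<circ> snd) ` feats_closure Y. dsup T (f \<circ> fst) b) \<le> ?H"
      unfolding hausdorff_def using f by (intro max.coboundedI1 SUP_upper2[of "f \<circ> fst"]) auto
    then have "(INF b\<in>(\<lambda>g. g \<circ> snd) ` feats_closure Y. dsup T (f \<circ> fst) b) < ennreal e"
      using H by (rule le_less_trans)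
    then show ?thesis using close unfolding INF_less_iff by blast
  qed
  moreover have "\<exists>f\<in>feats_closure X. \<forall>(x, y)\<in>T. \<bar>f x - g y\<bar> \<le> e" if g: "g \<in> feats_closure Y" for g
  proof -
    have "(INF a\<in>(\<lambda>f. f \<circ> fst) ` feats_closure X. dsup T a (g \<circ> snd)) \<le> ?H"
      unfolding hausdorff_def using g by (intro max.coboundedI2 SUP_upper2[of "g \<circ> snd"]) auto
    then have "(INF a\<in>(\<lambda>f. f \<circ> fst) ` feats_closure X. dsup T a (g \<circ> snd)) < ennreal e"
      using H by (rule le_less_trans)
    then show ?thesis using close unfolding INF_less_iff by blast
  qed
  moreover have "1 - e \<le> measure \<pi> T"
    using 1 by (cases "1 - measure \<pi> T \<ge> 0") (auto simp: ennreal_less_iff ennreal_neg)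
  ultimately show ?thesis unfolding near_def using \<pi> T by blast
qed

section \<open>Ky Fan distance and covering numbers\<close>

lemma (in prob_space) ky_fan_less_iff:
  "ky_fan M f g < \<epsilon> \<longleftrightarrow> (\<exists>e\<ge>0. e < \<epsilon> \<and> prob {x \<in> space M. \<bar>f x - g x\<bar> > e} \<le> e)"
proof -
  have "1 \<in> {e. e \<ge> 0 \<and> prob {x \<in> space M. \<bar>f x - g x\<bar> > e} \<le> e}" by simp
  then have ne: "{e. e \<ge> 0 \<and> prob {x \<in> space M. \<bar>f x - g x\<bar> > e} \<le> e} \<noteq> {}" by blast
  show ?thesis
    unfolding ky_fan_def using cInf_less_iff[OF ne, of \<epsilon>] by (auto simp: bdd_below_def)
qed

lemma Cov_finite_iff:
  "Cov X L F \<epsilon> < \<infinity> \<longleftrightarrow> (\<exists>N. finite N \<and> N \<subseteq> F \<and> F \<subseteq> open_nbhd (ky_fan (msr X)) (postcompose X L N) \<epsilon>)"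
  unfolding Cov_def INF_less_iff by auto

lemma monoidal_lipschitz:
  assumes "monoidal L" "p \<in> L"
  shows "\<bar>p s - p t\<bar> \<le> \<bar>s - t\<bar>"
  using assms lipschitz_onD[of 1 UNIV p s t] by (force simp: monoidal_def dist_real_def)

lemma monoidal_measurable:
  assumes "monoidal L" "p \<in> L"
  shows "p \<in> borel_measurable borel"
  using assms by (intro borel_measurable_continuous_onI) (auto simp: monoidal_def intro: lipschitz_on_continuous_on)

text \<open>Pull \<open>g\<close> back to \<open>f\<close> within \<open>d\<close> on
  \<open>T\<close>, cover \<open>f\<close> by \<open>p\<close> after \<open>h\<close> at Ky Fan
  level \<open>e < d'\<close>, and push \<open>h\<close> forward to \<open>G h\<close>; as
  \<open>p\<close> is 1-Lipschitz, the last error stays at most \<open>d\<close>. Values then differ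
  by at most \<open>2 * d + e\<close> off an event of mass at most \<open>d + e\<close>.\<close>

lemma Cov_transfer:
  fixes X :: "'a data_set" and Y :: "'b data_set"
  assumes L: "monoidal L" and X: "geometric_data_set X" and Y: "geometric_data_set Y"
    and near: "near d X Y" and Cov: "Cov X L (feats_closure X) d' < \<infinity>"
  shows "Cov Y L (feats_closure Y) (2 * d + d') < \<infinity>"
proof -
  interpret X: gds X by (rule gds.intro) fact
  interpret Y: gds Y by (rule gds.intro) fact
  obtain \<pi> T where \<pi>: "\<pi> \<in> couplings (msr X) (msr Y)"
    and T: "closedin (prod_topology (ftop X) (ftop Y)) T" "1 - d \<le> measure \<pi> T" "T \<noteq> {}"
    and XY: "\<And>f. f \<in> feats_closure X \<Longrightarrow> \<exists>g\<in>feats_closure Y. \<forall>(x, y)\<in>T. \<bar>f x - g y\<bar> \<le> d"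
    and YX: "\<And>g. g \<in> feats_closure Y \<Longrightarrow> \<exists>f\<in>feats_closure X. \<forall>(x, y)\<in>T. \<bar>f x - g y\<bar> \<le> d"
    using near unfolding near_def by blast
  interpret \<pi>: prob_space \<pi> by (rule couplings_prob_space[OF \<pi> X.prob.prob_space_axioms])
  have sets_\<pi>[measurable_cong]: "sets \<pi> = sets (msr X \<Otimes>\<^sub>M msr Y)"
    and d1: "distr \<pi> (msr X) fst = msr X" and d2: "distr \<pi> (msr Y) snd = msr Y"
    using \<pi> by (auto simp: couplings_def)
  have [measurable]: "T \<in> sets \<pi>" using closedin_prod_measurable[OF X Y T(1)] by (simp add: sets_\<pi>)
  obtain N where N: "finite N" "N \<subseteq> feats_closure X"
      "feats_closure X \<subseteq> open_nbhd (ky_fan (msr X)) (postcompose X L N) d'"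
    using Cov unfolding Cov_finite_iff by blast
  have "\<forall>f\<in>feats_closure X. \<exists>g. g \<in> feats_closure Y \<and> (\<forall>(x, y)\<in>T. \<bar>f x - g y\<bar> \<le> d)"
    using XY by blast
  then obtain G where "\<forall>f\<in>feats_closure X. G f \<in> feats_closure Y \<and> (\<forall>(x, y)\<in>T. \<bar>f x - G f y\<bar> \<le> d)"
    by (rule bchoice[THEN exE])
  then have G: "\<And>f. f \<in> feats_closure X \<Longrightarrow> G f \<in> feats_closure Y"
     "\<And>f x y. f \<in> feats_closure X \<Longrightarrow> (x, y) \<in> T \<Longrightarrow> \<bar>f x - G f y\<bar> \<le> d"
    by auto
  have "g \<in> open_nbhd (ky_fan (msr Y)) (postcompose Y L (G ` N)) (2 * d + d')" if g: "g \<in> feats_closure Y" for g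
  proof -
    obtain f where f: "f \<in> feats_closure X" "\<And>x y. (x, y) \<in> T \<Longrightarrow> \<bar>f x - g y\<bar> \<le> d"
      using YX[OF g] by auto
    obtain p h where p: "p \<in> L" and h: "h \<in> N" and "ky_fan (msr X) f (compose (pts X) p h) < d'"
      using N(3) f(1) unfolding open_nbhd_def postcompose_def by blast
    then obtain e where e: "e \<ge> 0" "e < d'"
        "measure (msr X) {x \<in> pts X. \<bar>f x - compose (pts X) p h x\<bar> > e} \<le> e"
      using X.prob.ky_fan_less_iff by (auto simp: X.space_msr)
    have h': "h \<in> feats_closure X" using N h by blast
    note [measurable] = X.measurable_feats_closure[OF f(1)] X.measurable_feats_closure[OF h']
      Y.measurable_feats_closure[OF g] Y.measurable_feats_closure[OF G(1)[OF h']] monoidal_measurable[OF L p]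
    define A where "A = {x \<in> space (msr X). \<bar>f x - p (h x)\<bar> > e}"
    define B where "B = {y \<in> space (msr Y). \<bar>g y - p (G h y)\<bar> > 2 * d + e}"
    have [measurable]: "A \<in> sets (msr X)" "B \<in> sets (msr Y)" unfolding A_def B_def by measurable
    have "{x \<in> pts X. \<bar>f x - compose (pts X) p h x\<bar> > e} = A"
      by (auto simp: A_def X.space_msr compose_def)
    then have A: "measure (msr X) A \<le> e" using e(3) by simp
    have sub: "snd -` B \<inter> space \<pi> \<subseteq> (space \<pi> - T) \<union> (fst -` A \<inter> space \<pi>)"
    proof
      fix q assume q: "q \<in> snd -` B \<inter> space \<pi>"
      obtain x y where xy: "q = (x, y)" by force
      have "x \<in> space (msr X)"
        using q xy sets_eq_imp_space_eq[OF sets_\<pi>] by (auto simp: space_pair_measure)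
      moreover have "\<bar>f x - p (h x)\<bar> > e" if "q \<in> T"
      proof -
        have "\<bar>f x - g y\<bar> \<le> d" "\<bar>p (h x) - p (G h y)\<bar> \<le> d"
          using f(2) G(2)[OF h'] that xy monoidal_lipschitz[OF L p, of "h x" "G h y"] by (auto intro: order_trans)
        moreover have "\<bar>g y - p (G h y)\<bar> > 2 * d + e" using q xy by (auto simp: B_def)
        ultimately show ?thesis by linarith
      qed
      ultimately show "q \<in> (space \<pi> - T) \<union> (fst -` A \<inter> space \<pi>)"
        using q xy by (auto simp: A_def)
    qed
    have "measure (msr Y) B = measure (distr \<pi> (msr Y) snd) B" by (simp add: d2)
    also have "\<dots> = \<pi>.prob (snd -` B \<inter> space \<pi>)" by (rule measure_distr) measurable
    also have "\<dots> \<le> \<pi>.prob ((space \<pi> - T) \<union> (fst -` A \<inter> space \<pi>))"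
      using sub by (rule \<pi>.finite_measure_mono) measurable
    also have "\<dots> \<le> \<pi>.prob (space \<pi> - T) + \<pi>.prob (fst -` A \<inter> space \<pi>)"
      by (rule measure_Un_le) measurable
    also have "\<pi>.prob (fst -` A \<inter> space \<pi>) = measure (distr \<pi> (msr X) fst) A"
      by (rule measure_distr[symmetric]) measurable
    also have "\<pi>.prob (space \<pi> - T) = 1 - \<pi>.prob T" by (rule \<pi>.prob_compl) measurable
    finally have "measure (msr Y) B \<le> d + e" using A T(2) by (simp add: d1)
    moreover have "{y \<in> space (msr Y). \<bar>g y - compose (pts Y) p (G h) y\<bar> > 2 * d + e} = B"
      by (auto simp: B_def Y.space_msr compose_def)
    \<comment> \<open>Passes from the mass bound \<open>d + e\<close> to the Ky Fan level
      \<open>2 * d + e\<close>; the sign comes from a point of \<open>T\<close>.\<close>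
    moreover have "d \<ge> 0" 
    proof -
      obtain x y where "(x, y) \<in> T" using T(3) by force
      then show ?thesis using f(2)[of x y] by linarith
    qed
    ultimately have "ky_fan (msr Y) g (compose (pts Y) p (G h)) < 2 * d + d'"
      unfolding Y.prob.ky_fan_less_iff using e by (intro exI[of _ "2 * d + e"]) auto
    then show ?thesis unfolding open_nbhd_def postcompose_def using p h by blast
  qed
  then show ?thesis
    unfolding Cov_finite_iff using N G(1) by (intro exI[of _ "G ` N"]) auto
qed

text \<open>The approximating \<open>X\<close> may change with \<open>d\<close>, so this serves the
  limit of a sequence as well as an isomorphic copy.\<close>

lemma L_compact_if_near:
  fixes Y :: "'b data_set"
  assumes L: "monoidal L" and Y: "geometric_data_set Y"
    and post: "postcompose Y L (feats_closure Y) \<subseteq> feats_closure Y"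
    and near: "\<And>d. 0 < d \<Longrightarrow> d < 1 \<Longrightarrow> \<exists>X :: 'a data_set. L_compact L X \<and> near d X Y"
  shows "L_compact L Y"
  unfolding L_compact_def
proof (intro conjI allI impI Y post)
  fix \<epsilon> :: real assume "\<epsilon> > 0"
  \<comment> \<open>With \<open>d \<le> \<epsilon> / 4\<close> the transfer loss
    \<open>2 * d\<close> leaves the positive level \<open>\<epsilon> - 2 * d\<close> for covering
    \<open>X\<close>.\<close>
  define d where "d = min (\<epsilon> / 4) (1 / 2)"
  have d: "0 < d" "d < 1" "2 * d \<le> \<epsilon> / 2" using \<open>\<epsilon> > 0\<close> by (auto simp: d_def)
  then obtain X :: "'a data_set" where X: "L_compact L X" "near d X Y" using near by blast
  then have "Cov Y L (feats_closure Y) (2 * d + (\<epsilon> - 2 * d)) < \<infinity>"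
    using d \<open>\<epsilon> > 0\<close> unfolding L_compact_def by (intro Cov_transfer[OF L _ Y]) auto
  then show "Cov Y L (feats_closure Y) \<epsilon> < \<infinity>" by simp
qed

text \<open>The coupling of \<open>W\<close> and \<open>X\<close> stays; only the second map becomes
  \<open>\<phi>\<close> after the projection. Going through \<open>nearI\<close> avoids transporting
  the closed set along \<open>\<phi>\<close>, for which \<open>\<phi>\<close> would have to be shown
  a homeomorphism.\<close>

lemma near_isomorphic:
  fixes W :: "'a data_set" and X :: "'b data_set" and Y :: "'c data_set"
  assumes W: "geometric_data_set W" and X: "geometric_data_set X" and Y: "geometric_data_set Y"
    and iso: "isomorphic X Y" and near: "near e W X" and e: "e < 1"
  shows "near e W Y"
proof -
  interpret W: gds W by (rule gds.intro) fact
  interpret X: gds X by (rule gds.intro) fact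
  interpret Y: gds Y by (rule gds.intro) fact
  obtain \<phi> where \<phi>[measurable]: "\<phi> \<in> measurable (msr X) (msr Y)" and d\<phi>: "distr (msr X) (msr Y) \<phi> = msr Y"
    and F: "(\<lambda>g. compose (pts X) g \<phi>) ` feats_closure Y = feats_closure X"
    using iso unfolding isomorphic_def by blast
  obtain \<pi> T where \<pi>: "\<pi> \<in> couplings (msr W) (msr X)"
    and T: "closedin (prod_topology (ftop W) (ftop X)) T" "1 - e \<le> measure \<pi> T"
    and XY: "\<And>f. f \<in> feats_closure W \<Longrightarrow> \<exists>g\<in>feats_closure X. \<forall>(x, y)\<in>T. \<bar>f x - g y\<bar> \<le> e"
    and YX: "\<And>g. g \<in> feats_closure X \<Longrightarrow> \<exists>f\<in>feats_closure W. \<forall>(x, y)\<in>T. \<bar>f x - g y\<bar> \<le> e"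
    using near unfolding near_def by blast
  have sets_\<pi>[measurable_cong]: "sets \<pi> = sets (msr W \<Otimes>\<^sub>M msr X)"
    and d1: "distr \<pi> (msr W) fst = msr W" and d2: "distr \<pi> (msr X) snd = msr X"
    using \<pi> by (auto simp: couplings_def)
  have TX: "T \<subseteq> pts W \<times> pts X" using closedin_subset[OF T(1)] by simp
  show ?thesis
  proof (rule nearI[OF W Y couplings_prob_space[OF \<pi> W.prob.prob_space_axioms], where u=fst and v="\<lambda>p. \<phi> (snd p)" and T=T])
    show "T \<in> sets \<pi>" using closedin_prod_measurable[OF W X T(1)] by (simp add: sets_\<pi>)
    have "distr \<pi> (msr Y) (\<lambda>p. \<phi> (snd p)) = distr (distr \<pi> (msr X) snd) (msr Y) \<phi>"
      by (subst distr_distr) (auto simp: o_def)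
    then show "distr \<pi> (msr Y) (\<lambda>p. \<phi> (snd p)) = msr Y" by (simp add: d2 d\<phi>)
    show "\<exists>g\<in>feats_closure Y. \<forall>\<omega>\<in>T. \<bar>f (fst \<omega>) - g (\<phi> (snd \<omega>))\<bar> \<le> e" if f: "f \<in> feats_closure W" for f
    proof -
      obtain g where g: "g \<in> feats_closure X" "\<forall>(x, y)\<in>T. \<bar>f x - g y\<bar> \<le> e" using XY[OF f] by blast
      then obtain g' where g': "g' \<in> feats_closure Y" "g = compose (pts X) g' \<phi>" using F by blast
      show ?thesis
      proof (intro bexI[of _ g'] ballI g')
        fix \<omega> assume \<omega>: "\<omega> \<in> T"
        then show "\<bar>f (fst \<omega>) - g' (\<phi> (snd \<omega>))\<bar> \<le> e"
          using bspec[OF g(2) \<omega>] TX by (cases \<omega>) (auto simp: g' compose_def)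
      qed
    qed
    show "\<exists>f\<in>feats_closure W. \<forall>\<omega>\<in>T. \<bar>f (fst \<omega>) - g (\<phi> (snd \<omega>))\<bar> \<le> e" if g: "g \<in> feats Y" for g
    proof -
      have "compose (pts X) g \<phi> \<in> feats_closure X" using F g Y.feats_subset_closure by blast
      then obtain f where f: "f \<in> feats_closure W" "\<forall>(x, y)\<in>T. \<bar>f x - compose (pts X) g \<phi> y\<bar> \<le> e" using YX by blast
      show ?thesis
      proof (intro bexI[of _ f] ballI f)
        fix \<omega> assume \<omega>: "\<omega> \<in> T"
        then show "\<bar>f (fst \<omega>) - g (\<phi> (snd \<omega>))\<bar> \<le> e"
          using bspec[OF f(2) \<omega>] TX by (cases \<omega>) (auto simp: compose_def)
      qed
    qed
  qed (use T e d1 in auto)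
qed

lemma near_refl:
  assumes X: "geometric_data_set X" and e: "0 \<le> e" "e < 1"
  shows "near e X X"
proof -
  interpret X: gds X by (rule gds.intro) fact
  show ?thesis
  proof (rule nearI[OF X X X.prob.prob_space_axioms, where u="\<lambda>x. x" and v="\<lambda>x. x" and T="space (msr X)"])
    show "\<exists>f\<in>feats_closure X. \<forall>\<omega>\<in>space (msr X). \<bar>f \<omega> - g \<omega>\<bar> \<le> e" if "g \<in> feats X" for g
      using that X.feats_subset_closure e by (intro bexI[of _ g]) auto
    show "\<exists>g\<in>feats_closure X. \<forall>\<omega>\<in>space (msr X). \<bar>f \<omega> - g \<omega>\<bar> \<le> e" if "f \<in> feats_closure X" for f
      using that e by (intro bexI[of _ f]) auto
  qed (use e X.prob.prob_space in auto)
qed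

text \<open>An isomorphic copy is near at every positive scale below \<open>1\<close>, so covering
  numbers come from \<open>L_compact_if_near\<close>. Invariance under \<open>L\<close> travels
  through surjectivity of \<open>\<phi>\<close>: functions on \<open>pts Y\<close> that agree after
  composition with \<open>\<phi>\<close> are equal.\<close>

lemma L_compact_isomorphic:
  fixes X :: "'a data_set" and Y :: "'b data_set"
  assumes L: "monoidal L" and X: "L_compact L X" and Y: "geometric_data_set Y" and iso: "isomorphic X Y"
  shows "L_compact L Y"
proof (rule L_compact_if_near[OF L Y])
  have gX: "geometric_data_set X" and post: "postcompose X L (feats_closure X) \<subseteq> feats_closure X"
    using X by (auto simp: L_compact_def)
  interpret X: gds X by (rule gds.intro) fact
  interpret Y: gds Y by (rule gds.intro) fact
  show "\<exists>X :: 'a data_set. L_compact L X \<and> near d X Y" if "0 < d" "d < 1" for d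
    using near_isomorphic[OF gX gX Y iso near_refl[OF gX, of d]] that X by auto
  obtain \<phi> where bij: "bij_betw \<phi> (pts X) (pts Y)"
    and F: "(\<lambda>g. compose (pts X) g \<phi>) ` feats_closure Y = feats_closure X"
    using iso unfolding isomorphic_def by blast
  show "postcompose Y L (feats_closure Y) \<subseteq> feats_closure Y"
  proof
    fix q assume "q \<in> postcompose Y L (feats_closure Y)"
    then obtain p g where p: "p \<in> L" and g: "g \<in> feats_closure Y" and q: "q = compose (pts Y) p g"
      by (auto simp: postcompose_def)
    have "compose (pts X) g \<phi> \<in> feats_closure X"
      unfolding F[symmetric] using g by (rule imageI)
    then have "compose (pts X) p (compose (pts X) g \<phi>) \<in> postcompose X L (feats_closure X)"
      using p by (auto simp: postcompose_def)
    then have "compose (pts X) p (compose (pts X) g \<phi>) \<in> (\<lambda>g. compose (pts X) g \<phi>) ` feats_closure Y"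
      unfolding F by (rule subsetD[OF post])
    then obtain g' where g': "g' \<in> feats_closure Y" "compose (pts X) p (compose (pts X) g \<phi>) = compose (pts X) g' \<phi>"
      by (rule imageE)
    have "q y = g' y" if y: "y \<in> pts Y" for y
    proof -
      obtain x where x: "x \<in> pts X" "y = \<phi> x" using bij y unfolding bij_betw_def by blast
      then show ?thesis using fun_cong[OF g'(2), of x] y by (simp add: q compose_def)
    qed
    then have "q = g'"
      using Y.feats_closure_extensional[OF g'(1)] by (intro extensionalityI[of _ "pts Y"]) (auto simp: q compose_def)
    then show "q \<in> feats_closure Y" using g' by simp
  qed
qed

text \<open>Sending a point to the first ball of radius \<open>e / 2\<close> that contains it turns
  a countable cover into a partition, on whose cells the 1-Lipschitz features oscillate by at most
  \<open>e\<close>. Continuity of the measure reduces to finitely many cells.\<close>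

lemma (in gds) discretization:
  assumes e: "e > 0"
  obtains c :: "'a \<Rightarrow> nat" and I where "c \<in> measurable (msr X) (count_space UNIV)" "finite I"
    "1 - e \<le> measure (msr X) {x\<in>pts X. c x \<in> I}"
    "\<forall>i\<in>I. 0 < measure (msr X) {x\<in>pts X. c x = i}"
    "\<forall>x\<in>pts X. \<forall>y\<in>pts X. c x = c y \<longrightarrow> (\<forall>f\<in>feats_closure X. \<bar>f x - f y\<bar> \<le> e)"
proof -
  obtain a where a: "\<And>k. a k \<in> pts X" "\<And>y e. y \<in> pts X \<Longrightarrow> e > 0 \<Longrightarrow> \<exists>k::nat. fdist X (a k) y < e"
    using dense_sequence by metis
  define c where "c x = (LEAST k. x \<in> metric.mball (a k) (e / 2))" for x
  have [measurable]: "Measurable.pred (msr X) (\<lambda>x. x \<in> metric.mball (a k) (e / 2))" for k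
  proof -
    have "{x \<in> space (msr X). x \<in> metric.mball (a k) (e / 2)} = metric.mball (a k) (e / 2)"
      by (auto simp: space_msr)
    then show ?thesis
      unfolding pred_def using sets_msr_open[OF metric.openin_mball] by metis
  qed
  have c[measurable]: "c \<in> measurable (msr X) (count_space UNIV)"
    unfolding c_def by measurable
  have c_ball: "x \<in> metric.mball (a (c x)) (e / 2)" if x: "x \<in> pts X" for x
  proof -
    obtain k where "fdist X (a k) x < e / 2" using a(2)[OF x, of "e / 2"] e by auto
    then have "x \<in> metric.mball (a k) (e / 2)" using a(1) x by simp
    then show ?thesis unfolding c_def by (rule LeastI)
  qed
  have small: "\<bar>f x - f y\<bar> \<le> e" if "x \<in> pts X" "y \<in> pts X" "c x = c y" "f \<in> feats_closure X" for x y f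
  proof -
    have "\<bar>f (a (c x)) - f x\<bar> < e / 2" "\<bar>f (a (c x)) - f y\<bar> < e / 2"
      using c_ball[OF that(1)] c_ball[OF that(2)] that(3)
        feats_closure_lipschitz[OF that(4) a(1)[of "c x"] that(1)]
        feats_closure_lipschitz[OF that(4) a(1)[of "c x"] that(2)] by auto
    then show ?thesis by linarith
  qed
  have space[simp]: "space (msr X) = pts X" by (rule space_msr)
  have meas[measurable]: "{x\<in>pts X. c x \<in> J} \<in> sets (msr X)" for J
  proof -
    have "{x\<in>pts X. c x \<in> J} = c -` J \<inter> space (msr X)" by auto
    then show ?thesis using measurable_sets[OF c, of J] by simp
  qed
  have meas1[measurable]: "{x\<in>pts X. c x = i} \<in> sets (msr X)" "{x\<in>pts X. c x < i} \<in> sets (msr X)" for i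
    using meas[of "{i}"] meas[of "{..<i}"] by simp_all
  have "(\<lambda>n. prob.prob {x\<in>pts X. c x \<in> {..<n}}) \<longlonglongrightarrow> prob.prob (\<Union>n. {x\<in>pts X. c x \<in> {..<n}})"
    by (rule prob.finite_Lim_measure_incseq) (auto simp: incseq_def)
  also have "(\<Union>n. {x\<in>pts X. c x \<in> {..<n}}) = space (msr X)" by auto
  finally have "(\<lambda>n. prob.prob {x\<in>pts X. c x \<in> {..<n}}) \<longlonglongrightarrow> 1" by (simp only: prob.prob_space)
  then have "\<forall>\<^sub>F n in sequentially. prob.prob {x\<in>pts X. c x \<in> {..<n}} > 1 - e"
    using e by (intro order_tendstoD(1)) auto
  then obtain n where n: "prob.prob {x\<in>pts X. c x \<in> {..<n}} > 1 - e"
    by (auto simp: eventually_sequentially)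
  \<comment> \<open>Dropping null cells costs no mass and provides the positive lower bound on cell
    masses used in \<open>profile_exists\<close>.\<close>
  define I where "I = {i\<in>{..<n}. prob.prob {x\<in>pts X. c x = i} > 0}"
  note sum = prob.prob_cells[OF c, unfolded space]
  have "prob.prob {x\<in>pts X. c x \<in> {..<n}} = prob.prob {x\<in>pts X. c x \<in> I}"
    unfolding sum[OF finite_lessThan] by (subst sum)
      (auto simp: I_def zero_less_measure_iff intro!: sum.mono_neutral_right)
  then show thesis
    using n small by (intro that[OF c, of I]) (auto simp: I_def)
qed

section \<open>Limits of rapidly converging sequences\<close>

text \<open>One sequence \<open>e\<close> bounds lost mass, matching error and oscillation on cells
  at each stage. Halving makes all errors from stage \<open>n\<close> on add up to a fixed multiple
  of \<open>e n\<close>.\<close>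

locale box_chain =
  fixes X :: "nat \<Rightarrow> 'a data_set" and e :: "nat \<Rightarrow> real"
    and \<pi> :: "nat \<Rightarrow> ('a \<times> 'a) measure" and T :: "nat \<Rightarrow> ('a \<times> 'a) set"
    and c :: "nat \<Rightarrow> 'a \<Rightarrow> nat" and I :: "nat \<Rightarrow> nat set"
  assumes geometric: "\<And>n. geometric_data_set (X n)"
    and e_pos: "\<And>n. 0 < e n" and e_Suc: "\<And>n. e (Suc n) = e n / 2"
    and couplings: "\<And>n. \<pi> n \<in> couplings (msr (X n)) (msr (X (Suc n)))"
    and T_sets: "\<And>n. T n \<in> sets (msr (X n) \<Otimes>\<^sub>M msr (X (Suc n)))"
    and T_large: "\<And>n. 1 - e n \<le> measure (\<pi> n) (T n)"
    and match_Suc: "\<And>n f. f \<in> feats_closure (X n) \<Longrightarrow>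
          \<exists>g\<in>feats_closure (X (Suc n)). \<forall>(x, y)\<in>T n. \<bar>f x - g y\<bar> \<le> e n"
    and match_pred: "\<And>n g. g \<in> feats_closure (X (Suc n)) \<Longrightarrow>
          \<exists>f\<in>feats_closure (X n). \<forall>(x, y)\<in>T n. \<bar>f x - g y\<bar> \<le> e n"
    and c: "\<And>n. c n \<in> measurable (msr (X n)) (count_space UNIV)" and finite_I: "\<And>n. finite (I n)"
    and c_large: "\<And>n. 1 - e n \<le> measure (msr (X n)) {x\<in>pts (X n). c n x \<in> I n}"
    and c_small: "\<And>n x y f. x \<in> pts (X n) \<Longrightarrow> y \<in> pts (X n) \<Longrightarrow> c n x = c n y \<Longrightarrow>
          f \<in> feats_closure (X n) \<Longrightarrow> \<bar>f x - f y\<bar> \<le> e n"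
begin

sublocale X: gds "X n" for n
  by (rule gds.intro) (rule geometric)

sublocale \<pi>: prob_space "\<pi> n" for n
  by (rule couplings_prob_space[OF couplings X.prob.prob_space_axioms])

lemma sets_\<pi>[measurable_cong]: "sets (\<pi> n) = sets (msr (X n) \<Otimes>\<^sub>M msr (X (Suc n)))"
  and distr_fst: "distr (\<pi> n) (msr (X n)) fst = msr (X n)"
  and distr_snd: "distr (\<pi> n) (msr (X (Suc n))) snd = msr (X (Suc n))"
  using couplings[of n] by (auto simp: couplings_def)

lemma space_\<pi>: "space (\<pi> n) = pts (X n) \<times> pts (X (Suc n))"
  using sets_eq_imp_space_eq[OF sets_\<pi>[of n]] by (simp add: space_pair_measure X.space_msr)

lemma T_subset: "T n \<subseteq> pts (X n) \<times> pts (X (Suc n))"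
  using sets.sets_into_space[OF T_sets[of n]] by (simp add: space_pair_measure X.space_msr)

lemmas c_measurable[measurable] = c

definition cell_law :: "nat \<Rightarrow> (nat \<times> nat) measure" where
  "cell_law n = distr (\<pi> n) (count_space UNIV) (\<lambda>p. (c n (fst p), c (Suc n) (snd p)))"

lemma cell_pair_measurable[measurable]:
  "(\<lambda>p. (c n (fst p), c (Suc n) (snd p))) \<in> measurable (\<pi> n) (count_space UNIV)"
proof -
  have "(\<lambda>p. (c n (fst p), c (Suc n) (snd p))) \<in> measurable (\<pi> n) (count_space UNIV \<Otimes>\<^sub>M count_space UNIV)"
    by measurable
  then show ?thesis by (simp add: pair_measure_countable)
qed

lemma cell_law_fst: "emeasure (cell_law n) ({a} \<times> UNIV) = emeasure (msr (X n)) {x\<in>pts (X n). c n x = a}"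
proof -
  have "emeasure (cell_law n) ({a} \<times> UNIV) = emeasure (\<pi> n) (fst -` {x\<in>pts (X n). c n x = a} \<inter> space (\<pi> n))"
    unfolding cell_law_def by (subst emeasure_distr) (auto simp: space_\<pi> intro!: arg_cong[where f="emeasure (\<pi> n)"])
  also have "\<dots> = emeasure (distr (\<pi> n) (msr (X n)) fst) {x\<in>pts (X n). c n x = a}"
    unfolding X.space_msr[symmetric] by (subst emeasure_distr) auto
  finally show ?thesis by (simp add: distr_fst)
qed

lemma cell_law_snd: "emeasure (cell_law n) (UNIV \<times> {a}) = emeasure (msr (X (Suc n))) {x\<in>pts (X (Suc n)). c (Suc n) x = a}"
proof -
  have "emeasure (cell_law n) (UNIV \<times> {a}) = emeasure (\<pi> n) (snd -` {x\<in>pts (X (Suc n)). c (Suc n) x = a} \<inter> space (\<pi> n))"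
    unfolding cell_law_def by (subst emeasure_distr) (auto simp: space_\<pi> intro!: arg_cong[where f="emeasure (\<pi> n)"])
  also have "\<dots> = emeasure (distr (\<pi> n) (msr (X (Suc n))) snd) {x\<in>pts (X (Suc n)). c (Suc n) x = a}"
    unfolding X.space_msr[symmetric] by (subst emeasure_distr) auto
  finally show ?thesis by (simp add: distr_snd)
qed

text \<open>A jump between cells is good if it is witnessed by a matched pair of points; features that are
  matched on \<open>T n\<close> are then close at any representatives of the two cells.\<close>

definition good_jump :: "nat \<Rightarrow> (nat \<times> nat) set" where
  "good_jump n = (\<lambda>(x, y). (c n x, c (Suc n) y)) ` {(x, y) \<in> T n. c n x \<in> I n \<and> c (Suc n) y \<in> I (Suc n)}"

text \<open>Failing to be matched costs \<open>e n\<close>; missing the finite set of cells costs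
  \<open>e n\<close> at stage \<open>n\<close> and \<open>e n / 2\<close> at the next. The sum is
  rounded up to \<open>3 * e n\<close>.\<close>

lemma good_jump_large: "1 - 3 * e n \<le> measure (cell_law n) (good_jump n)"
proof -
  define A where "A = {x\<in>space (msr (X n)). c n x \<in> I n}"
  define B where "B = {y\<in>space (msr (X (Suc n))). c (Suc n) y \<in> I (Suc n)}"
  have [measurable]: "T n \<in> sets (\<pi> n)" using T_sets by (simp add: sets_\<pi>)
  have AB[measurable]: "A \<in> sets (msr (X n))" "B \<in> sets (msr (X (Suc n)))"
    unfolding A_def B_def by measurable
  have A': "\<pi>.prob n (fst -` A \<inter> space (\<pi> n)) \<ge> 1 - e n"
    using c_large[of n] measure_distr[OF _ AB(1), of fst "\<pi> n"] by (simp add: distr_fst A_def X.space_msr)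
  have B': "\<pi>.prob n (snd -` B \<inter> space (\<pi> n)) \<ge> 1 - e (Suc n)"
    using c_large[of "Suc n"] measure_distr[OF _ AB(2), of snd "\<pi> n"] by (simp add: distr_snd B_def X.space_msr)
  have fst_A: "fst -` A \<inter> space (\<pi> n) \<in> sets (\<pi> n)"
    by (rule measurable_sets[OF _ AB(1)]) measurable
  have snd_B: "snd -` B \<inter> space (\<pi> n) \<in> sets (\<pi> n)"
    by (rule measurable_sets[OF _ AB(2)]) measurable
  have "1 - 3 * e n \<le> 1 - (e n + e n + e (Suc n))" using e_Suc[of n] e_pos[of n] by simp
  also have "\<dots> \<le> \<pi>.prob n (T n \<inter> (fst -` A \<inter> space (\<pi> n)) \<inter> (snd -` B \<inter> space (\<pi> n)))"
    using fst_A snd_B A' B' T_large by (intro \<pi>.prob_Int_ge) auto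
  also have "\<dots> \<le> \<pi>.prob n ((\<lambda>p. (c n (fst p), c (Suc n) (snd p))) -` good_jump n \<inter> space (\<pi> n))"
  proof (rule \<pi>.finite_measure_mono)
    show "T n \<inter> (fst -` A \<inter> space (\<pi> n)) \<inter> (snd -` B \<inter> space (\<pi> n))
        \<subseteq> (\<lambda>p. (c n (fst p), c (Suc n) (snd p))) -` good_jump n \<inter> space (\<pi> n)"
      by (force simp: good_jump_def A_def B_def)
  qed (rule measurable_sets[OF cell_pair_measurable], simp)
  also have "\<dots> = measure (cell_law n) (good_jump n)"
    unfolding cell_law_def by (rule measure_distr[symmetric]) measurable
  finally show ?thesis .
qed

text \<open>The choice depends on the cell alone, so a path of cell indices evaluates all threads at
  the same points.\<close>

definition rep :: "nat \<Rightarrow> nat \<Rightarrow> 'a" where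
  "rep n a = (SOME x. x \<in> pts (X n) \<and> c n x = a)"

lemma rep: "x \<in> pts (X n) \<Longrightarrow> rep n (c n x) \<in> pts (X n) \<and> c n (rep n (c n x)) = c n x"
  unfolding rep_def by (rule someI[of _ x]) simp

lemma rep_close: "x \<in> pts (X n) \<Longrightarrow> f \<in> feats_closure (X n) \<Longrightarrow> \<bar>f x - f (rep n (c n x))\<bar> \<le> e n"
  using rep[of x n] c_small[of x n "rep n (c n x)" f] by auto

text \<open>Threads index the features of the limit space: a thread is a sequence of consecutively matched
  features.\<close>

definition threads :: "(nat \<Rightarrow> 'a \<Rightarrow> real) set" where
  "threads = {r. \<forall>n. r n \<in> feats_closure (X n) \<and> (\<forall>(x, y)\<in>T n. \<bar>r n x - r (Suc n) y\<bar> \<le> e n)}"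

lemma thread_feature: "r \<in> threads \<Longrightarrow> r n \<in> feats_closure (X n)"
  by (simp add: threads_def)

text \<open>Moving from \<open>rep n a\<close> to a witness \<open>x\<close> of the jump, across the
  match to \<open>y\<close>, and on to \<open>rep (Suc n) b\<close> costs \<open>e n\<close>,
  \<open>e n\<close> and \<open>e n / 2\<close>.\<close>

lemma thread_jump:
  assumes r: "r \<in> threads" and ab: "(a, b) \<in> good_jump n"
  shows "\<bar>r n (rep n a) - r (Suc n) (rep (Suc n) b)\<bar> \<le> 3 * e n"
proof -
  obtain x y where xy: "(x, y) \<in> T n" "a = c n x" "b = c (Suc n) y"
    using ab by (auto simp: good_jump_def)
  then have "\<bar>r n x - r (Suc n) y\<bar> \<le> e n" using r by (auto simp: threads_def)
  moreover have "\<bar>r n x - r n (rep n a)\<bar> \<le> e n"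
    using xy T_subset[of n] rep_close[OF _ thread_feature[OF r]] by auto
  moreover have "\<bar>r (Suc n) y - r (Suc n) (rep (Suc n) b)\<bar> \<le> e n / 2"
    using xy T_subset[of n] rep_close[OF _ thread_feature[OF r], of y "Suc n"] e_Suc[of n] by auto
  ultimately show ?thesis using e_pos[of n] unfolding abs_le_iff by linarith
qed

text \<open>Two-sided matching puts every feature of every stage on a thread: forward by dependent
  choice with \<open>match_Suc\<close>, backward by finitely many uses of \<open>match_pred\<close>.
  This gives the limit enough features to match those of each \<open>X n\<close>.\<close>

lemma thread_exists:
  assumes f: "f \<in> feats_closure (X n)"
  shows "\<exists>r\<in>threads. r n = f"
proof -
  have "\<exists>s. \<forall>k. (s k \<in> feats_closure (X (n + k)) \<and> (k = 0 \<longrightarrow> s k = f)) \<and>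
       (\<forall>(x, y)\<in>T (n + k). \<bar>s k x - s (Suc k) y\<bar> \<le> e (n + k))"
  proof (rule dependent_nat_choice)
    show "\<exists>g. g \<in> feats_closure (X (n + 0)) \<and> (0 = 0 \<longrightarrow> g = f)" using f by auto
    fix g k assume "g \<in> feats_closure (X (n + k)) \<and> (k = 0 \<longrightarrow> g = f)"
    then show "\<exists>h. (h \<in> feats_closure (X (n + Suc k)) \<and> (Suc k = 0 \<longrightarrow> h = f)) \<and> (\<forall>(x, y)\<in>T (n + k). \<bar>g x - h y\<bar> \<le> e (n + k))"
      using match_Suc[of g "n + k"] by auto
  qed
  then obtain s where s: "s 0 = f" "\<And>k. s k \<in> feats_closure (X (n + k))"
     "\<And>k. \<forall>(x, y)\<in>T (n + k). \<bar>s k x - s (Suc k) y\<bar> \<le> e (n + k)" by blast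
  have "\<exists>r. r n = f \<and> (\<forall>k\<le>n. r k \<in> feats_closure (X k)) \<and> (\<forall>k<n. \<forall>(x, y)\<in>T k. \<bar>r k x - r (Suc k) y\<bar> \<le> e k)"
    using f
  proof (induction n arbitrary: f)
    case 0
    then show ?case by (intro exI[of _ "\<lambda>_. f"]) auto
  next
    case (Suc n)
    obtain h where h: "h \<in> feats_closure (X n)" "\<forall>(x, y)\<in>T n. \<bar>h x - f y\<bar> \<le> e n"
      using match_pred[OF Suc.prems] by blast
    obtain r where r: "r n = h" "\<forall>k\<le>n. r k \<in> feats_closure (X k)" "\<forall>k<n. \<forall>(x, y)\<in>T k. \<bar>r k x - r (Suc k) y\<bar> \<le> e k"
      using Suc.IH[OF h(1)] by blast
    define r' where "r' = r(Suc n := f)"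
    have "r' (Suc n) = f" "\<And>k. k \<le> n \<Longrightarrow> r' k = r k" by (auto simp: r'_def)
    then show ?case
      using r h Suc.prems by (intro exI[of _ r']) (auto simp: le_Suc_eq less_Suc_eq)
  qed
  then obtain r where r: "r n = f" "\<And>k. k \<le> n \<Longrightarrow> r k \<in> feats_closure (X k)"
      "\<And>k. k < n \<Longrightarrow> \<forall>(x, y)\<in>T k. \<bar>r k x - r (Suc k) y\<bar> \<le> e k" by blast
  define q where "q k = (if k \<le> n then r k else s (k - n))" for k
  have "q k \<in> feats_closure (X k)" for k
    using r(2)[of k] s(2)[of "k - n"] by (auto simp: q_def)
  moreover have "\<forall>(x, y)\<in>T k. \<bar>q k x - q (Suc k) y\<bar> \<le> e k" for k
  proof -
    consider "k < n" | "k = n" | "n < k" by linarith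
    then show ?thesis
    proof cases
      case 1
      then show ?thesis using r(3)[of k] by (simp add: q_def)
    next
      case 2
      then show ?thesis using s(3)[of 0] r(1) s(1) by (simp add: q_def)
    next
      case 3
      then show ?thesis using s(3)[of "k - n"] by (simp add: q_def Suc_diff_le)
    qed
  qed
  ultimately have "q \<in> threads" by (auto simp: threads_def)
  moreover have "q n = f" by (simp add: q_def r)
  ultimately show ?thesis by blast
qed

section \<open>Limits of threads along good paths\<close>

lemma e_tendsto: "e \<longlonglongrightarrow> 0"
proof -
  have "e n = e 0 * (1 / 2) ^ n" for n
    by (induction n) (simp_all add: e_Suc)
  then have "e = (\<lambda>n. e 0 * (1 / 2) ^ n)" by (rule ext)
  moreover have "(\<lambda>n. e 0 * (1 / 2) ^ n) \<longlonglongrightarrow> e 0 * 0"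
    by (intro tendsto_intros LIMSEQ_realpow_zero) auto
  ultimately show ?thesis by (simp only: mult_zero_right)
qed

lemma e_small: "\<epsilon> > 0 \<Longrightarrow> \<exists>n\<ge>N. e n \<le> \<epsilon>"
proof -
  assume "\<epsilon> > 0"
  then have "\<forall>\<^sub>F n in sequentially. e n < \<epsilon>" by (rule order_tendstoD(2)[OF e_tendsto])
  then obtain N' where "\<And>n. n \<ge> N' \<Longrightarrow> e n < \<epsilon>" by (auto simp: eventually_sequentially)
  then show ?thesis by (intro exI[of _ "max N N'"]) (auto intro: less_imp_le)
qed

text \<open>The increments are dominated by a geometric series with sum \<open>3 * e n * 2\<close>.
  Since \<open>3 * e m = 6 * e m - 6 * e (Suc m)\<close>, the telescoping bound
  \<open>6 * e n - 6 * e m\<close> is the form that survives induction.\<close>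

lemma geometric_limit:
  fixes a :: "nat \<Rightarrow> real"
  assumes a: "\<And>n. n \<ge> N \<Longrightarrow> \<bar>a n - a (Suc n)\<bar> \<le> 3 * e n"
  shows "a \<longlonglongrightarrow> lim a" and "n \<ge> N \<Longrightarrow> \<bar>a n - lim a\<bar> \<le> 6 * e n"
proof -
  have step: "\<bar>a n - a m\<bar> \<le> 6 * e n - 6 * e m" if "n \<ge> N" "m \<ge> n" for n m
    using that(2)
  proof (induction m rule: dec_induct)
    case (step m)
    have "\<bar>a m - a (Suc m)\<bar> \<le> 3 * e m" using a step that by simp
    then show ?case using step.IH e_Suc[of m] by linarith
  qed simp
  have "Cauchy a"
  proof (rule metric_CauchyI)
    fix \<epsilon> :: real assume "\<epsilon> > 0"
    \<comment> \<open>Both terms are within \<open>6 * e K\<close> of \<open>a K\<close>, and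
      \<open>12 / 13 < 1\<close>.\<close>
    then obtain K where K: "K \<ge> N" "e K \<le> \<epsilon> / 13" using e_small[of "\<epsilon> / 13" N] by auto
    have "dist (a m) (a n) < \<epsilon>" if "m \<ge> K" "n \<ge> K" for m n
      using step[OF K(1) that(1)] step[OF K(1) that(2)] e_pos[of m] e_pos[of n] K(2) \<open>\<epsilon> > 0\<close>
      unfolding dist_real_def by linarith
    then show "\<exists>M. \<forall>m\<ge>M. \<forall>n\<ge>M. dist (a m) (a n) < \<epsilon>" by blast
  qed
  then show L: "a \<longlonglongrightarrow> lim a" by (simp add: Cauchy_convergent_iff convergent_LIMSEQ_iff)
  assume n: "n \<ge> N"
  have "(\<lambda>m. \<bar>a n - a m\<bar>) \<longlonglongrightarrow> \<bar>a n - lim a\<bar>" by (intro tendsto_intros L)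
  then show "\<bar>a n - lim a\<bar> \<le> 6 * e n"
  proof (rule LIMSEQ_le_const2)
    show "\<exists>K. \<forall>m\<ge>K. \<bar>a n - a m\<bar> \<le> 6 * e n"
    proof (intro exI[of _ n] allI impI)
      fix m assume "m \<ge> n"
      then show "\<bar>a n - a m\<bar> \<le> 6 * e n" using step[OF n] e_pos[of m] by fastforce
    qed
  qed
qed

definition ev :: "(nat \<Rightarrow> nat) \<Rightarrow> (nat \<Rightarrow> 'a \<Rightarrow> real) \<Rightarrow> real" where
  "ev \<omega> r = lim (\<lambda>n. r n (rep n (\<omega> n)))"

definition good_path :: "nat \<Rightarrow> (nat \<Rightarrow> nat) set" where
  "good_path N = {\<omega>. \<forall>n\<ge>N. (\<omega> n, \<omega> (Suc n)) \<in> good_jump n}"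

lemma good_path_mono: "N \<le> M \<Longrightarrow> good_path N \<subseteq> good_path M"
  by (auto simp: good_path_def)

lemma ev_tendsto:
  assumes "\<omega> \<in> good_path N" "r \<in> threads"
  shows "(\<lambda>n. r n (rep n (\<omega> n))) \<longlonglongrightarrow> ev \<omega> r"
    and "n \<ge> N \<Longrightarrow> \<bar>r n (rep n (\<omega> n)) - ev \<omega> r\<bar> \<le> 6 * e n"
  using geometric_limit[of N "\<lambda>n. r n (rep n (\<omega> n))"] thread_jump[OF assms(2)] assms(1)
  unfolding ev_def good_path_def by auto

lemma rep_pts:
  assumes "\<omega> \<in> good_path N" "n \<ge> N"
  shows "rep n (\<omega> n) \<in> pts (X n)"
proof -
  have "(\<omega> n, \<omega> (Suc n)) \<in> good_jump n" using assms by (auto simp: good_path_def)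
  then obtain x y where "(x, y) \<in> T n" "\<omega> n = c n x" by (auto simp: good_jump_def)
  then show ?thesis using rep[of x n] T_subset[of n] by auto
qed

end

section \<open>The path space of the chain of cells\<close>

locale box_markov_chain = box_chain X e \<pi> T c I + P: prob_space P
  for X :: "nat \<Rightarrow> 'a data_set" and e \<pi> T c I and P :: "(nat \<Rightarrow> nat) measure" +
  assumes coordinate[measurable]: "\<And>n. (\<lambda>\<omega>. \<omega> n) \<in> measurable P (count_space UNIV)"
    and law: "\<And>n a b. emeasure P {\<omega>\<in>space P. \<omega> n = a \<and> \<omega> (Suc n) = b} = emeasure (cell_law n) {(a, b)}"
begin

lemma coordinate_pair[measurable]: "(\<lambda>\<omega>. (\<omega> n, \<omega> (Suc n))) \<in> measurable P (count_space UNIV)"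
proof -
  have "(\<lambda>\<omega>. (\<omega> n, \<omega> (Suc n))) \<in> measurable P (count_space UNIV \<Otimes>\<^sub>M count_space UNIV)"
    by measurable
  then show ?thesis by (simp add: pair_measure_countable)
qed

lemma distr_pair: "distr P (count_space UNIV) (\<lambda>\<omega>. (\<omega> n, \<omega> (Suc n))) = cell_law n"
proof (rule measure_eqI_countable[of _ UNIV])
  fix p :: "nat \<times> nat"
  have "(\<lambda>\<omega>. (\<omega> n, \<omega> (Suc n))) -` {p} \<inter> space P = {\<omega>\<in>space P. \<omega> n = fst p \<and> \<omega> (Suc n) = snd p}"
    by auto
  then show "emeasure (distr P (count_space UNIV) (\<lambda>\<omega>. (\<omega> n, \<omega> (Suc n)))) {p} = emeasure (cell_law n) {p}"
    using law[of n "fst p" "snd p"] by (subst emeasure_distr) auto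
qed (auto simp: cell_law_def)

lemma prob_pair: "P.prob {\<omega>\<in>space P. (\<omega> n, \<omega> (Suc n)) \<in> S} = measure (cell_law n) S"
proof -
  have "measure (cell_law n) S = P.prob ((\<lambda>\<omega>. (\<omega> n, \<omega> (Suc n))) -` S \<inter> space P)"
    unfolding distr_pair[symmetric] by (rule measure_distr) auto
  then show ?thesis by (simp add: vimage_def Int_def conj_commute)
qed

lemma prob_coordinate: "P.prob {\<omega>\<in>space P. \<omega> n = a} = measure (msr (X n)) {x\<in>pts (X n). c n x = a}"
  using prob_pair[of n "{a} \<times> UNIV"] cell_law_fst[of n a] by (simp add: measure_def)

lemma good_jump_events[measurable]: "{\<omega>\<in>space P. (\<omega> n, \<omega> (Suc n)) \<in> S} \<in> P.events"
proof -
  have "{\<omega>\<in>space P. (\<omega> n, \<omega> (Suc n)) \<in> S} = (\<lambda>\<omega>. (\<omega> n, \<omega> (Suc n))) -` S \<inter> space P" by auto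
  also have "\<dots> \<in> P.events" by (rule measurable_sets[OF coordinate_pair]) simp
  finally show ?thesis .
qed

definition good :: "nat \<Rightarrow> (nat \<Rightarrow> nat) set" where
  "good N = good_path N \<inter> space P"

lemma good_eq: "good N = (\<Inter>n\<in>{N..}. {\<omega>\<in>space P. (\<omega> n, \<omega> (Suc n)) \<in> good_jump n})"
  by (auto simp: good_def good_path_def)

lemma good_events[measurable]: "good N \<in> P.events"
  unfolding good_eq by (rule sets.countable_INT') auto

text \<open>Union bound over all jumps from time \<open>N\<close> on:
  \<open>3 * (e N + e N / 2 + ...) = 6 * e N\<close>. As this tends to zero, almost every path is
  eventually good.\<close>

lemma prob_good: "1 - 6 * e N \<le> P.prob (good N)"
proof -
  define bad where "bad n = {\<omega>\<in>space P. (\<omega> (N + n), \<omega> (Suc (N + n))) \<in> - good_jump (N + n)}" for n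
  have bad: "bad n \<in> P.events" "P.prob (bad n) \<le> 3 * e (N + n)" for n
  proof -
    show "bad n \<in> P.events" unfolding bad_def by measurable
    have "bad n = space P - {\<omega>\<in>space P. (\<omega> (N + n), \<omega> (Suc (N + n))) \<in> good_jump (N + n)}"
      by (auto simp: bad_def)
    then have "P.prob (bad n) = 1 - measure (cell_law (N + n)) (good_jump (N + n))"
      using prob_pair[of "N + n" "good_jump (N + n)"] by (simp only:, subst P.prob_compl) auto
    then show "P.prob (bad n) \<le> 3 * e (N + n)" using good_jump_large[of "N + n"] by simp
  qed
  have "e (N + n) = e N * (1 / 2) ^ n" for n by (induction n) (simp_all add: e_Suc)
  then have sums: "(\<lambda>n. 3 * e (N + n)) sums (3 * (e N * 2))"
    using geometric_sums[of "1 / 2 :: real"] by (simp only:, intro sums_mult) simp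
  have summable: "summable (\<lambda>n. P.prob (bad n))"
    by (rule summable_comparison_test'[OF sums_summable[OF sums]]) (use bad in auto)
  have "P.prob (\<Union>n. bad n) \<le> (\<Sum>n. P.prob (bad n))"
    by (rule P.finite_measure_subadditive_countably) (use bad summable in auto)
  also have "\<dots> \<le> (\<Sum>n. 3 * e (N + n))"
    by (rule suminf_le[OF _ summable sums_summable[OF sums]]) (rule bad)
  also have "\<dots> = 6 * e N" using sums_unique[OF sums] by simp
  finally have "P.prob (\<Union>n. bad n) \<le> 6 * e N" .
  moreover have "good N = space P - (\<Union>n. bad n)"
    by (auto simp: good_eq bad_def le_iff_add)
  moreover have "(\<Union>n. bad n) \<in> P.events" using bad by auto
  ultimately show ?thesis by (simp add: P.prob_compl)
qed

text \<open>Fixing the index at a single time is enough: with \<open>N \<le> n\<close>, goodness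
  keeps each evaluation within \<open>6 * e n\<close> of the value of the \<open>n\<close>-th
  feature at \<open>rep n a\<close>. Evaluations on the cell thus vary by at most
  \<open>12 * e n\<close>, uniformly over threads.\<close>

definition triple_cell :: "nat \<Rightarrow> (nat \<Rightarrow> nat) set" where
  "triple_cell k = (case prod_decode k of (N, l) \<Rightarrow> case prod_decode l of (n, a) \<Rightarrow>
     if N \<le> n then {\<omega>\<in>good N. \<omega> n = a} else {})"

sublocale limit: feature_process P "\<Union>N. good N" triple_cell threads ev
proof
  show "(\<Union>N. good N) \<in> P.events" by measurable
  have "1 \<le> P.prob (\<Union>N. good N)"
  proof (rule field_le_epsilon)
    fix \<epsilon> :: real assume "\<epsilon> > 0"
    then obtain N where "e N \<le> \<epsilon> / 6" using e_small[of "\<epsilon> / 6"] by auto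
    moreover have "P.prob (good N) \<le> P.prob (\<Union>N. good N)" by (rule P.finite_measure_mono) auto
    ultimately show "1 \<le> P.prob (\<Union>N. good N) + \<epsilon>" using prob_good[of N] by simp
  qed
  then show "P.prob (\<Union>N. good N) = 1" using P.prob_le_1 by (simp add: antisym)
  show "triple_cell k \<in> P.events" for k
  proof -
    have "{\<omega>\<in>good N. \<omega> n = a} \<in> P.events" for N n a
    proof -
      have "{\<omega>\<in>good N. \<omega> n = a} = good N \<inter> {\<omega>\<in>space P. \<omega> n = a}" by (auto simp: good_def)
      then show ?thesis by simp
    qed
    then show ?thesis by (auto simp: triple_cell_def split: prod.split)
  qed
  obtain f where "f \<in> feats_closure (X 0)" using X.feats_closure_nonempty by blast
  then show "threads \<noteq> {}" using thread_exists[of f 0] by blast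
  show "\<exists>k. \<omega> \<in> triple_cell k \<and> (\<forall>\<omega>'\<in>triple_cell k \<inter> (\<Union>N. good N). \<forall>r\<in>threads. \<bar>ev \<omega> r - ev \<omega>' r\<bar> \<le> \<epsilon>)"
    if \<omega>: "\<omega> \<in> (\<Union>N. good N)" and \<epsilon>: "\<epsilon> > 0" for \<omega> \<epsilon>
  proof -
    obtain N where N: "\<omega> \<in> good N" using \<omega> by blast
    obtain n where n: "n \<ge> N" "e n \<le> \<epsilon> / 12" using e_small[of "\<epsilon> / 12" N] \<epsilon> by auto
    let ?k = "prod_encode (N, prod_encode (n, \<omega> n))"
    have k: "triple_cell ?k = {\<omega>'\<in>good N. \<omega>' n = \<omega> n}" using n by (simp add: triple_cell_def)
    have "\<bar>ev \<omega> r - ev \<omega>' r\<bar> \<le> \<epsilon>" if "\<omega>' \<in> good N" "\<omega>' n = \<omega> n" "r \<in> threads" for \<omega>' r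
      using ev_tendsto(2)[OF _ that(3) n(1), of \<omega>] ev_tendsto(2)[OF _ that(3) n(1), of \<omega>'] that N n(2)
      by (simp add: good_def)
    then show ?thesis using k N by (intro exI[of _ ?k]) auto
  qed
  show "\<exists>B. \<forall>r\<in>threads. \<bar>ev \<omega> r - ev \<omega>' r\<bar> \<le> B"
    if \<omega>: "\<omega> \<in> (\<Union>N. good N)" and \<omega>': "\<omega>' \<in> (\<Union>N. good N)" for \<omega> \<omega>'
  proof -
    obtain N1 N2 where "\<omega> \<in> good N1" "\<omega>' \<in> good N2" using \<omega> \<omega>' by blast
    then have N: "\<omega> \<in> good_path (max N1 N2)" "\<omega>' \<in> good_path (max N1 N2)"
      using good_path_mono[of N1 "max N1 N2"] good_path_mono[of N2 "max N1 N2"] by (auto simp: good_def)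
    let ?n = "max N1 N2"
    \<comment> \<open>From a time at which both paths are good, each limit is within
      \<open>6 * e ?n\<close> of a value of one feature of that stage, and the Lipschitz bound
      between the two values is the same for all threads.\<close>
    have "\<bar>ev \<omega> r - ev \<omega>' r\<bar> \<le> 12 * e ?n + fdist (X ?n) (rep ?n (\<omega> ?n)) (rep ?n (\<omega>' ?n))" if r: "r \<in> threads" for r
      using ev_tendsto(2)[OF N(1) r order_refl] ev_tendsto(2)[OF N(2) r order_refl]
        X.feats_closure_lipschitz[OF thread_feature[OF r] rep_pts[OF N(1) order_refl] rep_pts[OF N(2) order_refl]]
      unfolding abs_le_iff by linarith
    then show ?thesis by blast
  qed
qed

text \<open>Acting stage by stage with a 1-Lipschitz \<open>p\<close> does not enlarge the matching
  errors, and continuity lets \<open>p\<close> commute with the limit along a good path.\<close>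

lemma thread_compose:
  assumes L: "monoidal L" and p: "p \<in> L" and r: "r \<in> threads"
    and post: "\<And>n. postcompose (X n) L (feats_closure (X n)) \<subseteq> feats_closure (X n)"
  shows "(\<lambda>n. compose (pts (X n)) p (r n)) \<in> threads"
    and "\<omega> \<in> good N \<Longrightarrow> ev \<omega> (\<lambda>n. compose (pts (X n)) p (r n)) = p (ev \<omega> r)"
proof -
  have "compose (pts (X n)) p (r n) \<in> postcompose (X n) L (feats_closure (X n))" for n
    using p thread_feature[OF r, of n] by (auto simp: postcompose_def)
  then have "compose (pts (X n)) p (r n) \<in> feats_closure (X n)" for n using post by blast
  moreover have "\<bar>compose (pts (X n)) p (r n) x - compose (pts (X (Suc n))) p (r (Suc n)) y\<bar> \<le> e n"
    if "(x, y) \<in> T n" for n x y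
  proof -
    have "\<bar>r n x - r (Suc n) y\<bar> \<le> e n" using r that by (auto simp: threads_def)
    moreover have "x \<in> pts (X n)" "y \<in> pts (X (Suc n))" using T_subset that by blast+
    ultimately show ?thesis
      using monoidal_lipschitz[OF L p, of "r n x" "r (Suc n) y"] by (simp add: compose_def)
  qed
  ultimately show pr: "(\<lambda>n. compose (pts (X n)) p (r n)) \<in> threads" by (auto simp: threads_def)
  assume "\<omega> \<in> good N"
  then have \<omega>: "\<omega> \<in> good_path N" by (simp add: good_def)
  have "1-lipschitz_on UNIV p" using L p by (auto simp: monoidal_def)
  then have "isCont p (ev \<omega> r)"
    using lipschitz_on_continuous_on continuous_on_eq_continuous_at by blast
  then have "(\<lambda>n. p (r n (rep n (\<omega> n)))) \<longlonglongrightarrow> p (ev \<omega> r)"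
    by (rule isCont_tendsto_compose) (rule ev_tendsto(1)[OF \<omega> r])
  moreover have "\<forall>\<^sub>F n in sequentially. compose (pts (X n)) p (r n) (rep n (\<omega> n)) = p (r n (rep n (\<omega> n)))"
    unfolding eventually_sequentially using rep_pts[OF \<omega>] by (auto simp: compose_def)
  ultimately have "(\<lambda>n. compose (pts (X n)) p (r n) (rep n (\<omega> n))) \<longlonglongrightarrow> p (ev \<omega> r)"
    using tendsto_cong by fastforce
  with ev_tendsto(1)[OF \<omega> pr] show "ev \<omega> (\<lambda>n. compose (pts (X n)) p (r n)) = p (ev \<omega> r)"
    by (rule LIMSEQ_unique)
qed

text \<open>Comparing \<open>Z\<close> with any \<open>Y\<close> near \<open>X n\<close>, rather
  than with \<open>X n\<close> alone, spares a triangle inequality for \<open>near\<close>: the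
  coupling of \<open>Y\<close> with \<open>X n\<close> is itself glued to the path measure. In
  \<open>7 * e n\<close>, one \<open>e n\<close> pays for unmatched cells and for moving inside a
  cell, the other six for bad paths and for the tail of a thread.\<close>

lemma limit_exists:
  assumes universe: "(UNIV :: real set) \<lesssim> (UNIV :: 'b set)" and L: "monoidal L"
    and post: "\<And>n. postcompose (X n) L (feats_closure (X n)) \<subseteq> feats_closure (X n)"
  obtains Z :: "'b data_set" where "geometric_data_set Z"
    "postcompose Z L (feats_closure Z) \<subseteq> feats_closure Z"
    "\<And>(Y :: 'c data_set) d n. geometric_data_set Y \<Longrightarrow> near d Y (X n) \<Longrightarrow> d + 7 * e n < 1 \<Longrightarrow> near (d + 7 * e n) Y Z"
proof -
  obtain Z :: "'b data_set" and g \<xi> V where Z: "geometric_data_set Z" and feats: "feats Z = g ` threads"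
    and \<xi>[measurable]: "\<xi> \<in> measurable P (msr Z)" and d\<xi>: "distr P (msr Z) \<xi> = msr Z"
    and V[measurable]: "V \<in> P.events" and V1: "P.prob V = 1" "V \<subseteq> (\<Union>N. good N)"
    and g\<xi>: "\<And>\<omega> r. \<omega> \<in> V \<Longrightarrow> r \<in> threads \<Longrightarrow> g r (\<xi> \<omega>) = ev \<omega> r"
    and dense: "\<And>x \<epsilon>. x \<in> pts Z \<Longrightarrow> \<epsilon> > 0 \<Longrightarrow> \<exists>\<omega>\<in>V. \<forall>r\<in>threads. \<bar>g r x - ev \<omega> r\<bar> \<le> \<epsilon>"
    using limit.data_set_exists[OF universe] by metis
  interpret Z: gds Z by (rule gds.intro) fact
  \<comment> \<open>The identity is exact for evaluations along paths in \<open>V\<close>; their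
    density and the Lipschitz bound for \<open>p\<close> extend it to every point of
    \<open>Z\<close>.\<close>
  have gp: "g (\<lambda>n. compose (pts (X n)) p (r n)) x = p (g r x)"
    if p: "p \<in> L" and r: "r \<in> threads" and x: "x \<in> pts Z" for p r x
  proof -
    let ?s = "\<lambda>n. compose (pts (X n)) p (r n)"
    have s: "?s \<in> threads" by (rule thread_compose(1)[OF L p r post])
    have "\<bar>g ?s x - p (g r x)\<bar> \<le> 0"
    proof (rule field_le_epsilon)
      fix \<epsilon> :: real assume "\<epsilon> > 0"
      then obtain \<omega> where \<omega>: "\<omega> \<in> V" "\<And>r. r \<in> threads \<Longrightarrow> \<bar>g r x - ev \<omega> r\<bar> \<le> \<epsilon> / 2"
        using dense[OF x, of "\<epsilon> / 2"] by auto
      obtain N where "\<omega> \<in> good N" using \<omega> V1 by blast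
      then have "ev \<omega> ?s = p (ev \<omega> r)" by (rule thread_compose(2)[OF L p r post])
      then show "\<bar>g ?s x - p (g r x)\<bar> \<le> 0 + \<epsilon>"
        using \<omega>(2)[OF s] \<omega>(2)[OF r] monoidal_lipschitz[OF L p, of "g r x" "ev \<omega> r"] by linarith
    qed
    then show ?thesis by simp
  qed
  show thesis
  proof (rule that[OF Z])
    show "postcompose Z L (feats_closure Z) \<subseteq> feats_closure Z"
    proof
      fix q assume "q \<in> postcompose Z L (feats_closure Z)"
      then obtain p h where p: "p \<in> L" and h: "h \<in> feats_closure Z" and q: "q = compose (pts Z) p h"
        by (auto simp: postcompose_def)
      show "q \<in> feats_closure Z"
        unfolding Z.feats_closure_iff
      proof (intro conjI allI impI)
        show "q \<in> extensional (pts Z)" by (simp add: q compose_def)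
        fix A and \<delta> :: real assume A: "finite A \<and> A \<subseteq> pts Z \<and> \<delta> > 0"
        then obtain h' where "h' \<in> feats Z" and h': "\<And>x. x \<in> A \<Longrightarrow> \<bar>h' x - h x\<bar> < \<delta>"
          using Z.feats_closure_approx[OF h, of A \<delta>] by blast
        then obtain r where r: "r \<in> threads" "h' = g r" using feats by blast
        let ?s = "\<lambda>n. compose (pts (X n)) p (r n)"
        have "\<bar>g ?s x - q x\<bar> < \<delta>" if x: "x \<in> A" for x
        proof -
          have "x \<in> pts Z" using A x by blast
          then have "\<bar>g ?s x - q x\<bar> \<le> \<bar>h' x - h x\<bar>"
            using gp[OF p r(1)] r(2) monoidal_lipschitz[OF L p, of "h' x" "h x"] by (simp add: q compose_def)
          then show ?thesis using h'[OF x] by linarith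
        qed
        moreover have "g ?s \<in> feats Z" unfolding feats by (rule imageI) (rule thread_compose(1)[OF L p r(1) post])
        ultimately show "\<exists>g\<in>feats Z. \<forall>x\<in>A. \<bar>g x - q x\<bar> < \<delta>" by blast
      qed
    qed
  next
    fix Y :: "'c data_set" and d n
    assume Y: "geometric_data_set Y" and near: "near d Y (X n)" and small: "d + 7 * e n < 1"
    interpret Y: gds Y by (rule gds.intro) fact
    obtain \<alpha> S where \<alpha>: "\<alpha> \<in> couplings (msr Y) (msr (X n))"
      and S: "closedin (prod_topology (ftop Y) (ftop (X n))) S" "1 - d \<le> measure \<alpha> S"
      and YX: "\<And>f. f \<in> feats_closure Y \<Longrightarrow> \<exists>h\<in>feats_closure (X n). \<forall>(y, x)\<in>S. \<bar>f y - h x\<bar> \<le> d"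
      and XY: "\<And>h. h \<in> feats_closure (X n) \<Longrightarrow> \<exists>f\<in>feats_closure Y. \<forall>(y, x)\<in>S. \<bar>f y - h x\<bar> \<le> d"
      using near unfolding near_def by blast
    interpret \<alpha>: prob_space \<alpha> by (rule couplings_prob_space[OF \<alpha> Y.prob.prob_space_axioms])
    have sets_\<alpha>[measurable_cong]: "sets \<alpha> = sets (msr Y \<Otimes>\<^sub>M msr (X n))"
      and d1: "distr \<alpha> (msr Y) fst = msr Y" and d2: "distr \<alpha> (msr (X n)) snd = msr (X n)"
      using \<alpha> by (auto simp: couplings_def)
    have S_sets[measurable]: "S \<in> sets \<alpha>"
      using closedin_prod_measurable[OF Y geometric S(1)] by (simp add: sets_\<alpha>)
    have S_sub: "S \<subseteq> pts Y \<times> pts (X n)" using closedin_subset[OF S(1)] by simp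
    have cs[measurable]: "(\<lambda>p. c n (snd p)) \<in> measurable \<alpha> (count_space UNIV)" by measurable
    have space_\<alpha>: "space \<alpha> = pts Y \<times> pts (X n)"
      using sets_eq_imp_space_eq[OF sets_\<alpha>] by (simp add: space_pair_measure X.space_msr Y.space_msr)
    have law_c: "\<alpha>.prob {p\<in>space \<alpha>. c n (snd p) = a} = measure (msr (X n)) {x\<in>pts (X n). c n x = a}" for a
    proof -
      have "{x\<in>space (msr (X n)). c n x = a} \<in> sets (msr (X n))" by measurable
      from measure_distr[OF _ this, of snd \<alpha>]
      have "measure (msr (X n)) {x\<in>pts (X n). c n x = a} = \<alpha>.prob (snd -` {x\<in>pts (X n). c n x = a} \<inter> space \<alpha>)"
        by (simp add: d2 X.space_msr)
      also have "snd -` {x\<in>pts (X n). c n x = a} \<inter> space \<alpha> = {p\<in>space \<alpha>. c n (snd p) = a}"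
        by (auto simp: space_\<alpha>)
      finally show ?thesis by simp
    qed
    \<comment> \<open>The cell index of the \<open>X n\<close>-coordinate under
      \<open>\<alpha>\<close> and the coordinate \<open>\<omega> n\<close> have the same law. Every
      minimum in the sum is therefore the full cell mass, and matching fails with probability at
      most \<open>e n\<close>.\<close>
    obtain \<rho> where \<rho>: "\<rho> \<in> couplings \<alpha> P"
      and match: "(\<Sum>i\<in>I n. min (\<alpha>.prob {p\<in>space \<alpha>. c n (snd p) = i}) (P.prob {\<omega>\<in>space P. \<omega> n = i}))
        \<le> measure \<rho> {q\<in>space \<alpha> \<times> space P. c n (snd (fst q)) = (snd q) n \<and> c n (snd (fst q)) \<in> I n}"
      using coupling_of_cells[OF \<alpha>.prob_space_axioms P.prob_space_axioms cs coordinate finite_I] by blast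
    interpret \<rho>: prob_space \<rho> by (rule couplings_prob_space[OF \<rho> \<alpha>.prob_space_axioms])
    have sets_\<rho>[measurable_cong]: "sets \<rho> = sets (\<alpha> \<Otimes>\<^sub>M P)"
      and r1: "distr \<rho> \<alpha> fst = \<alpha>" and r2: "distr \<rho> P snd = P"
      using \<rho> by (auto simp: couplings_def)
    have space_\<rho>: "space \<rho> = space \<alpha> \<times> space P"
      using sets_eq_imp_space_eq[OF sets_\<rho>] by (simp add: space_pair_measure)
    define M where "M = {q\<in>space \<rho>. c n (snd (fst q)) = (snd q) n \<and> c n (snd (fst q)) \<in> I n}"
    have M_sets[measurable]: "M \<in> sets \<rho>"
    proof -
      have "M = (\<Union>i\<in>I n. {q\<in>space \<rho>. c n (snd (fst q)) = i \<and> (snd q) n = i})" by (auto simp: M_def)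
      also have "\<dots> \<in> sets \<rho>" using finite_I by (intro sets.finite_UN) measurable
      finally show ?thesis .
    qed
    have M: "1 - e n \<le> \<rho>.prob M"
    proof -
      have "1 - e n \<le> (\<Sum>i\<in>I n. measure (msr (X n)) {x\<in>pts (X n). c n x = i})"
        using c_large[of n] X.prob.prob_cells[OF c finite_I, of n n] by (simp add: X.space_msr)
      then show ?thesis
        using match by (simp add: law_c prob_coordinate M_def space_\<rho>)
    qed
    define G where "G = V \<inter> good n"
    have G_sets[measurable]: "G \<in> P.events" unfolding G_def by measurable
    have G: "1 - 6 * e n \<le> P.prob G"
    proof -
      have "AE \<omega> in P. \<omega> \<in> V" using V1(1) V by (simp add: P.prob_eq_1)
      then have "P.prob G = P.prob (good n)"
        unfolding G_def by (intro P.finite_measure_eq_AE) auto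
      then show ?thesis using prob_good[of n] by simp
    qed
    define T' where "T' = (fst -` S \<inter> space \<rho>) \<inter> M \<inter> (snd -` G \<inter> space \<rho>)"
    have T'_sets[measurable]: "T' \<in> sets \<rho>" unfolding T'_def by measurable
    have T'_large: "1 - (d + 7 * e n) \<le> \<rho>.prob T'"
    proof -
      have S': "\<rho>.prob (fst -` S \<inter> space \<rho>) \<ge> 1 - d"
        using S(2) measure_distr[of fst \<rho> \<alpha> S] by (simp add: r1)
      have G': "\<rho>.prob (snd -` G \<inter> space \<rho>) \<ge> 1 - 6 * e n"
        using G measure_distr[of snd \<rho> P G] by (simp add: r2)
      have "fst -` S \<inter> space \<rho> \<in> sets \<rho>"
        by (rule measurable_sets[OF _ S_sets]) measurable
      moreover have "snd -` G \<inter> space \<rho> \<in> sets \<rho>"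
        by (rule measurable_sets[OF _ G_sets]) measurable
      ultimately have "1 - (d + e n + 6 * e n) \<le> \<rho>.prob T'"
        unfolding T'_def using S' M G' by (intro \<rho>.prob_Int_ge) auto
      then show ?thesis by simp
    qed
    \<comment> \<open>On \<open>T'\<close> the point \<open>x\<close> lies in the cell of
      \<open>rep n (\<omega> n)\<close>: one \<open>e n\<close> for this move, then
      \<open>6 * e n\<close> to the limit along the path.\<close>
    have core: "\<bar>h (snd (fst q)) - g r (\<xi> (snd q))\<bar> \<le> 7 * e n"
      if q: "q \<in> T'" and r: "r \<in> threads" "r n = h" for q r h
    proof -
      obtain y x \<omega> where [simp]: "q = ((y, x), \<omega>)" by (metis prod.collapse)
      have x: "x \<in> pts (X n)" "c n x = \<omega> n" "\<omega> \<in> V" "\<omega> \<in> good_path n"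
        using q S_sub by (auto simp: T'_def M_def G_def good_def)
      have "\<bar>h x - h (rep n (\<omega> n))\<bar> \<le> e n"
        using rep_close[OF x(1) thread_feature[OF r(1)]] x(2) r(2) by simp
      moreover have "\<bar>h (rep n (\<omega> n)) - g r (\<xi> \<omega>)\<bar> \<le> 6 * e n"
        using ev_tendsto(2)[OF x(4) r(1) order_refl] g\<xi>[OF x(3) r(1)] r(2) by simp
      ultimately show ?thesis by simp
    qed
    show "near (d + 7 * e n) Y Z"
    proof (rule nearI[OF Y Z \<rho>.prob_space_axioms, where u="\<lambda>q. fst (fst q)" and v="\<lambda>q. \<xi> (snd q)" and T=T'])
      have "distr \<rho> (msr Y) (\<lambda>q. fst (fst q)) = distr (distr \<rho> \<alpha> fst) (msr Y) fst"
        by (subst distr_distr) (auto simp: o_def)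
      then show "distr \<rho> (msr Y) (\<lambda>q. fst (fst q)) = msr Y" by (simp add: r1 d1)
      have "distr \<rho> (msr Z) (\<lambda>q. \<xi> (snd q)) = distr (distr \<rho> P snd) (msr Z) \<xi>"
        by (subst distr_distr) (auto simp: o_def)
      then show "distr \<rho> (msr Z) (\<lambda>q. \<xi> (snd q)) = msr Z" by (simp add: r2 d\<xi>)
      show "\<exists>k\<in>feats_closure Z. \<forall>q\<in>T'. \<bar>f (fst (fst q)) - k (\<xi> (snd q))\<bar> \<le> d + 7 * e n" if f: "f \<in> feats_closure Y" for f
      proof -
        obtain h where h: "h \<in> feats_closure (X n)" "\<forall>(y, x)\<in>S. \<bar>f y - h x\<bar> \<le> d" using YX[OF f] by blast
        obtain r where r: "r \<in> threads" "r n = h" using thread_exists[OF h(1)] by blast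
        have "g r \<in> feats_closure Z" using Z.feats_subset_closure feats r by blast
        moreover have "\<bar>f (fst (fst q)) - g r (\<xi> (snd q))\<bar> \<le> d + 7 * e n" if q: "q \<in> T'" for q
        proof -
          have "\<bar>f (fst (fst q)) - h (snd (fst q))\<bar> \<le> d" using h(2) q by (force simp: T'_def)
          then show ?thesis using core[OF q r] by linarith
        qed
        ultimately show ?thesis by blast
      qed
      show "\<exists>f\<in>feats_closure Y. \<forall>q\<in>T'. \<bar>f (fst (fst q)) - k (\<xi> (snd q))\<bar> \<le> d + 7 * e n" if k: "k \<in> feats Z" for k
      proof -
        obtain r where r: "r \<in> threads" "k = g r" using k feats by blast
        obtain f where f: "f \<in> feats_closure Y" "\<forall>(y, x)\<in>S. \<bar>f y - r n x\<bar> \<le> d"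
          using XY[OF thread_feature[OF r(1)]] by blast
        have "\<bar>f (fst (fst q)) - k (\<xi> (snd q))\<bar> \<le> d + 7 * e n" if q: "q \<in> T'" for q
        proof -
          have "\<bar>f (fst (fst q)) - r n (snd (fst q))\<bar> \<le> d" using f(2) q by (force simp: T'_def)
          then show ?thesis using core[OF q r(1) refl] r(2) by simp
        qed
        then show ?thesis using f(1) by blast
      qed
    qed (use T'_large small in auto)
  qed
qed

end

section \<open>Countably many profiles\<close>

text \<open>The list \<open>is\<close> names the cells of a partition of mesh \<open>1 / Suc k\<close>, \<open>ws ! i\<close> approximates the mass
  of cell \<open>i\<close>, and the \<open>L\<close>-orbits of the vectors \<open>vs\<close> approximate the features at one point of each
  cell. The entries \<open>ws ! i\<close> and \<open>v ! i\<close> are indexed by the cell \<open>i\<close>, not by its position in \<open>is\<close>; an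
  index beyond the end of a list gives an unspecified value, which does no harm.\<close>

definition profile :: "(real \<Rightarrow> real) set \<Rightarrow> 'a data_set \<Rightarrow> nat \<Rightarrow> nat list \<Rightarrow> rat list \<Rightarrow> rat list list \<Rightarrow> bool" where
  "profile L X k is ws vs \<longleftrightarrow> (\<exists>c x.
     c \<in> measurable (msr X) (count_space UNIV) \<and>
     (\<forall>x\<in>pts X. \<forall>y\<in>pts X. c x = c y \<longrightarrow> (\<forall>f\<in>feats_closure X. \<bar>f x - f y\<bar> \<le> 1 / Suc k)) \<and>
     (\<forall>i\<in>set is. x i \<in> pts X \<and> c (x i) = i) \<and>
     1 - 1 / Suc k \<le> (\<Sum>i\<in>set is. measure (msr X) {x\<in>pts X. c x = i}) \<and>
     (\<forall>i\<in>set is. \<bar>measure (msr X) {x\<in>pts X. c x = i} - of_rat (ws ! i)\<bar> \<le> 1 / Suc k / Suc (length is)) \<and>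
     (\<forall>f\<in>feats_closure X. \<exists>p\<in>L. \<exists>v\<in>set vs. \<forall>i\<in>set is. \<bar>f (x i) - p (of_rat (v ! i))\<bar> \<le> 1 / Suc k) \<and>
     (\<forall>p\<in>L. \<forall>v\<in>set vs. \<exists>f\<in>feats_closure X. \<forall>i\<in>set is. \<bar>f (x i) - p (of_rat (v ! i))\<bar> \<le> 1 / Suc k))"

text \<open>Features approximated by the same \<open>p\<close> and \<open>v\<close> are paired: two
  cell oscillations and two orbit approximations give \<open>4 / Suc k\<close>. The mass loss is
  smaller: \<open>1 / Suc k\<close> outside the named cells and \<open>2 / Suc k\<close> from
  rounding the weights on both sides.\<close>

lemma profile_near:
  fixes X :: "'a data_set" and Y :: "'b data_set"
  assumes X: "geometric_data_set X" and Y: "geometric_data_set Y"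
    and pX: "profile L X k is ws vs" and pY: "profile L Y k is ws vs" and k: "4 < Suc k"
  shows "near (4 / Suc k) X Y"
proof -
  interpret X: gds X by (rule gds.intro) fact
  interpret Y: gds Y by (rule gds.intro) fact
  define \<epsilon> where "\<epsilon> = 1 / real (Suc k)"
  have \<epsilon>: "\<epsilon> > 0" "4 / Suc k = 4 * \<epsilon>" "4 * \<epsilon> < 1" using k by (auto simp: \<epsilon>_def field_simps)
  let ?I = "set is"
  obtain c x where c: "c \<in> measurable (msr X) (count_space UNIV)"
    and small: "\<And>x y f. x \<in> pts X \<Longrightarrow> y \<in> pts X \<Longrightarrow> c x = c y \<Longrightarrow> f \<in> feats_closure X \<Longrightarrow> \<bar>f x - f y\<bar> \<le> \<epsilon>"
    and x: "\<And>i. i \<in> ?I \<Longrightarrow> x i \<in> pts X \<and> c (x i) = i"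
    and large: "1 - \<epsilon> \<le> (\<Sum>i\<in>?I. measure (msr X) {x\<in>pts X. c x = i})"
    and w: "\<And>i. i \<in> ?I \<Longrightarrow> \<bar>measure (msr X) {x\<in>pts X. c x = i} - of_rat (ws ! i)\<bar> \<le> \<epsilon> / Suc (length is)"
    and fp: "\<And>f. f \<in> feats_closure X \<Longrightarrow> \<exists>p\<in>L. \<exists>v\<in>set vs. \<forall>i\<in>?I. \<bar>f (x i) - p (of_rat (v ! i))\<bar> \<le> \<epsilon>"
    and pf: "\<And>p v. p \<in> L \<Longrightarrow> v \<in> set vs \<Longrightarrow> \<exists>f\<in>feats_closure X. \<forall>i\<in>?I. \<bar>f (x i) - p (of_rat (v ! i))\<bar> \<le> \<epsilon>"
    using pX unfolding profile_def \<epsilon>_def[symmetric] by (elim exE conjE) blast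
  obtain c' y where c': "c' \<in> measurable (msr Y) (count_space UNIV)"
    and small': "\<And>x y f. x \<in> pts Y \<Longrightarrow> y \<in> pts Y \<Longrightarrow> c' x = c' y \<Longrightarrow> f \<in> feats_closure Y \<Longrightarrow> \<bar>f x - f y\<bar> \<le> \<epsilon>"
    and y: "\<And>i. i \<in> ?I \<Longrightarrow> y i \<in> pts Y \<and> c' (y i) = i"
    and w': "\<And>i. i \<in> ?I \<Longrightarrow> \<bar>measure (msr Y) {x\<in>pts Y. c' x = i} - of_rat (ws ! i)\<bar> \<le> \<epsilon> / Suc (length is)"
    and fp': "\<And>f. f \<in> feats_closure Y \<Longrightarrow> \<exists>p\<in>L. \<exists>v\<in>set vs. \<forall>i\<in>?I. \<bar>f (y i) - p (of_rat (v ! i))\<bar> \<le> \<epsilon>"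
    and pf': "\<And>p v. p \<in> L \<Longrightarrow> v \<in> set vs \<Longrightarrow> \<exists>f\<in>feats_closure Y. \<forall>i\<in>?I. \<bar>f (y i) - p (of_rat (v ! i))\<bar> \<le> \<epsilon>"
    using pY unfolding profile_def \<epsilon>_def[symmetric] by (elim exE conjE) blast
  obtain \<pi> where \<pi>: "\<pi> \<in> couplings (msr X) (msr Y)"
    and match: "(\<Sum>i\<in>?I. min (measure (msr X) {x\<in>pts X. c x = i}) (measure (msr Y) {x\<in>pts Y. c' x = i}))
        \<le> measure \<pi> {p\<in>pts X \<times> pts Y. c (fst p) = c' (snd p) \<and> c (fst p) \<in> ?I}"
    using coupling_of_cells[OF X.prob.prob_space_axioms Y.prob.prob_space_axioms c c' finite_set[of "is"]]
    unfolding X.space_msr Y.space_msr by blast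
  have sets_\<pi>[measurable_cong]: "sets \<pi> = sets (msr X \<Otimes>\<^sub>M msr Y)"
    and d1: "distr \<pi> (msr X) fst = msr X" and d2: "distr \<pi> (msr Y) snd = msr Y"
    using \<pi> by (auto simp: couplings_def)
  define T where "T = {p\<in>pts X \<times> pts Y. c (fst p) = c' (snd p) \<and> c (fst p) \<in> ?I}"
  have "T = (\<Union>i\<in>?I. {x\<in>space (msr X). c x = i} \<times> {y\<in>space (msr Y). c' y = i})"
    by (auto simp: T_def X.space_msr Y.space_msr)
  also have "\<dots> \<in> sets \<pi>"
    using c c' by (intro sets.finite_UN) (auto simp: sets_\<pi>)
  finally have T_sets: "T \<in> sets \<pi>" .
  have T_large: "1 - 4 * \<epsilon> \<le> measure \<pi> T"
  proof -
    have "(\<Sum>i\<in>?I. measure (msr X) {x\<in>pts X. c x = i} - 2 * (\<epsilon> / Suc (length is)))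
        \<le> (\<Sum>i\<in>?I. min (measure (msr X) {x\<in>pts X. c x = i}) (measure (msr Y) {x\<in>pts Y. c' x = i}))"
    proof (rule sum_mono)
      fix i assume "i \<in> ?I"
      have "0 \<le> \<epsilon> / Suc (length is)" using \<epsilon> by simp
      then show "measure (msr X) {x\<in>pts X. c x = i} - 2 * (\<epsilon> / Suc (length is))
          \<le> min (measure (msr X) {x\<in>pts X. c x = i}) (measure (msr Y) {x\<in>pts Y. c' x = i})"
        using w[OF \<open>i \<in> ?I\<close>] w'[OF \<open>i \<in> ?I\<close>] unfolding min.bounded_iff by linarith
    qed
    moreover have "(\<Sum>i\<in>?I. measure (msr X) {x\<in>pts X. c x = i} - 2 * (\<epsilon> / Suc (length is))) =
        (\<Sum>i\<in>?I. measure (msr X) {x\<in>pts X. c x = i}) - card ?I * (2 * (\<epsilon> / Suc (length is)))"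
      by (simp add: sum_subtractf)
    moreover have "card ?I * (2 * (\<epsilon> / Suc (length is))) \<le> 2 * \<epsilon>"
    proof -
      \<comment> \<open>Rounding each weight to within \<open>\<epsilon> / Suc (length is)\<close>
        bounds the total whatever the number of cells. The list may repeat a cell, hence an
        inequality; the \<open>Suc\<close> covers the empty list.\<close>
      have "card ?I * (2 * (\<epsilon> / Suc (length is))) \<le> Suc (length is) * (2 * (\<epsilon> / Suc (length is)))"
        using card_length[of "is"] \<epsilon>(1) by (intro mult_right_mono) auto
      also have "\<dots> = 2 * \<epsilon>" by simp
      finally show ?thesis .
    qed
    ultimately show ?thesis using match large \<epsilon>(1) by (simp add: T_def)
  qed
  have core: "\<bar>f a - g b\<bar> \<le> 4 * \<epsilon>"
    if T: "(a, b) \<in> T" and f: "f \<in> feats_closure X" and g: "g \<in> feats_closure Y"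
      and fv: "\<forall>i\<in>?I. \<bar>f (x i) - p (of_rat (v ! i))\<bar> \<le> \<epsilon>" and gv: "\<forall>i\<in>?I. \<bar>g (y i) - p (of_rat (v ! i))\<bar> \<le> \<epsilon>"
    for a b f g v and p :: "real \<Rightarrow> real"
  proof -
    define i where "i = c a"
    have i: "i \<in> ?I" "c a = i" "c' b = i" "a \<in> pts X" "b \<in> pts Y" using T by (auto simp: T_def i_def)
    have "\<bar>f a - f (x i)\<bar> \<le> \<epsilon>" using x[OF i(1)] i small[of a "x i" f] f by auto
    moreover have "\<bar>g b - g (y i)\<bar> \<le> \<epsilon>" using y[OF i(1)] i small'[of b "y i" g] g by auto
    ultimately show ?thesis using bspec[OF fv i(1)] bspec[OF gv i(1)] by linarith
  qed
  show ?thesis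
    unfolding \<epsilon>(2)
  proof (rule nearI[OF X Y couplings_prob_space[OF \<pi> X.prob.prob_space_axioms], where u=fst and v=snd and T=T])
    show "\<exists>g\<in>feats_closure Y. \<forall>q\<in>T. \<bar>f (fst q) - g (snd q)\<bar> \<le> 4 * \<epsilon>" if f: "f \<in> feats_closure X" for f
    proof -
      obtain p v where p: "p \<in> L" "v \<in> set vs" "\<forall>i\<in>?I. \<bar>f (x i) - p (of_rat (v ! i))\<bar> \<le> \<epsilon>"
        using fp[OF f] by blast
      then obtain g where g: "g \<in> feats_closure Y" "\<forall>i\<in>?I. \<bar>g (y i) - p (of_rat (v ! i))\<bar> \<le> \<epsilon>"
        using pf' by blast
      show ?thesis using core[OF _ f g(1) p(3) g(2)] g(1) by (intro bexI[of _ g]) auto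
    qed
    show "\<exists>f\<in>feats_closure X. \<forall>q\<in>T. \<bar>f (fst q) - g (snd q)\<bar> \<le> 4 * \<epsilon>" if "g \<in> feats Y" for g
    proof -
      have g: "g \<in> feats_closure Y" using that Y.feats_subset_closure by blast
      then obtain p v where p: "p \<in> L" "v \<in> set vs" "\<forall>i\<in>?I. \<bar>g (y i) - p (of_rat (v ! i))\<bar> \<le> \<epsilon>"
        using fp' by blast
      then obtain f where f: "f \<in> feats_closure X" "\<forall>i\<in>?I. \<bar>f (x i) - p (of_rat (v ! i))\<bar> \<le> \<epsilon>"
        using pf by blast
      show ?thesis using core[OF _ f(1) g f(2) p(3)] f(1) by (intro bexI[of _ f]) auto
    qed
  qed (use T_sets T_large \<epsilon> d1 d2 in auto)
qed

section \<open>Existence of profiles\<close>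

lemma rational_approximation:
  fixes h :: "nat \<Rightarrow> real"
  assumes "\<eta> > 0"
  shows "\<exists>v :: rat list. \<forall>i<m. \<bar>of_rat (v ! i) - h i\<bar> \<le> \<eta>"
proof -
  have "\<exists>q :: rat. \<bar>of_rat q - h i\<bar> \<le> \<eta>" for i
  proof -
    obtain q where "h i < of_rat q" "of_rat q < h i + \<eta>"
      using of_rat_dense[of "h i" "h i + \<eta>"] assms by auto
    then show ?thesis by (intro exI[of _ q]) auto
  qed
  then obtain q :: "nat \<Rightarrow> rat" where "\<And>i. \<bar>of_rat (q i) - h i\<bar> \<le> \<eta>" by metis
  then show ?thesis by (intro exI[of _ "map q [0..<m]"]) auto
qed

text \<open>Ky Fan closeness tolerates an exceptional set, but one of mass below the smallest cell
  mass cannot swallow a whole cell. Each cell thus contains a point where \<open>f\<close> and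
  \<open>p\<close> after \<open>h\<close> are close, and small oscillation carries this over to the
  chosen point \<open>x i\<close>.\<close>

lemma profile_exists:
  fixes X :: "'a data_set"
  assumes L: "monoidal L" and X: "L_compact L X"
  shows "\<exists>is ws vs. profile L X k is ws vs"
proof -
  have gX: "geometric_data_set X" and post: "postcompose X L (feats_closure X) \<subseteq> feats_closure X"
    and Cov: "\<And>\<epsilon>. \<epsilon> > 0 \<Longrightarrow> Cov X L (feats_closure X) \<epsilon> < \<infinity>"
    using X by (auto simp: L_compact_def)
  interpret X: gds X by (rule gds.intro) fact
  define \<epsilon> where "\<epsilon> = 1 / real (Suc k)"
  \<comment> \<open>A quarter of \<open>\<epsilon>\<close> for each of four errors: oscillation of
    \<open>f\<close>, oscillation of \<open>h\<close>, Ky Fan error, rational rounding of the values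
    of \<open>h\<close>.\<close>
  define \<eta> where "\<eta> = \<epsilon> / 4"
  have "\<epsilon> > 0" by (simp add: \<epsilon>_def)
  then have \<eta>: "\<eta> > 0" "\<epsilon> = \<eta> + \<eta> + \<eta> + \<eta>" by (simp_all add: \<eta>_def)
  obtain c :: "'a \<Rightarrow> nat" and I where c: "c \<in> measurable (msr X) (count_space UNIV)" and I: "finite I"
    and large: "1 - \<eta> \<le> measure (msr X) {x\<in>pts X. c x \<in> I}"
    and pos: "\<forall>i\<in>I. 0 < measure (msr X) {x\<in>pts X. c x = i}"
    and small': "\<forall>x\<in>pts X. \<forall>y\<in>pts X. c x = c y \<longrightarrow> (\<forall>f\<in>feats_closure X. \<bar>f x - f y\<bar> \<le> \<eta>)"
    by (rule X.discretization[OF \<eta>(1)])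
  have small: "\<And>x y f. x \<in> pts X \<Longrightarrow> y \<in> pts X \<Longrightarrow> c x = c y \<Longrightarrow> f \<in> feats_closure X \<Longrightarrow> \<bar>f x - f y\<bar> \<le> \<eta>"
    using small' by simp
  \<comment> \<open>At most every cell mass, so that an exceptional set of mass below
    \<open>\<delta>\<close> contains no cell, and at most \<open>\<eta>\<close>, to bound the error
    in the values.\<close>
  define \<delta> where "\<delta> = Min (insert \<eta> ((\<lambda>i. measure (msr X) {x\<in>pts X. c x = i}) ` I))"
  have \<delta>: "\<delta> > 0" "\<delta> \<le> \<eta>" "\<And>i. i \<in> I \<Longrightarrow> \<delta> \<le> measure (msr X) {x\<in>pts X. c x = i}"
    using I pos \<eta> by (auto simp: \<delta>_def)
  have "\<exists>x. x \<in> pts X \<and> c x = i" if "i \<in> I" for i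
  proof (rule ccontr)
    assume "\<nexists>x. x \<in> pts X \<and> c x = i"
    then have "{x\<in>pts X. c x = i} = {}" by blast
    then have "measure (msr X) {x\<in>pts X. c x = i} = 0" by (simp only: measure_empty)
    then show False using bspec[OF pos that] by linarith
  qed
  then obtain x where x: "\<And>i. i \<in> I \<Longrightarrow> x i \<in> pts X \<and> c (x i) = i" by metis
  obtain N where N: "finite N" "N \<subseteq> feats_closure X"
      "feats_closure X \<subseteq> open_nbhd (ky_fan (msr X)) (postcompose X L N) \<delta>"
    using Cov[OF \<delta>(1)] unfolding Cov_finite_iff by blast
  obtain m where m: "\<And>i. i \<in> I \<Longrightarrow> i < m" using I unfolding finite_nat_set_iff_bounded by auto
  obtain "is" where "is": "set is = I" using finite_list[OF I] by blast
  obtain ws :: "rat list" where ws: "\<And>i. i \<in> I \<Longrightarrow> \<bar>of_rat (ws ! i) - measure (msr X) {x\<in>pts X. c x = i}\<bar> \<le> \<epsilon> / Suc (length is)"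
    using rational_approximation[of "\<epsilon> / Suc (length is)" m "\<lambda>i. measure (msr X) {x\<in>pts X. c x = i}"] m
    by (auto simp: \<epsilon>_def)
  have "\<exists>v :: rat list. \<forall>i<m. \<bar>of_rat (v ! i) - h (x i)\<bar> \<le> \<eta>" for h
    by (rule rational_approximation[OF \<eta>(1)])
  then obtain V :: "('a \<Rightarrow> real) \<Rightarrow> rat list" where "\<And>h. \<forall>i<m. \<bar>of_rat (V h ! i) - h (x i)\<bar> \<le> \<eta>" by metis
  then have V: "\<And>h i. i \<in> I \<Longrightarrow> \<bar>h (x i) - of_rat (V h ! i)\<bar> \<le> \<eta>" using m by (metis abs_minus_commute)
  obtain vs where vs: "set vs = V ` N" using finite_list[of "V ` N"] N(1) by blast
  have fp: "\<exists>p\<in>L. \<exists>v\<in>set vs. \<forall>i\<in>set is. \<bar>f (x i) - p (of_rat (v ! i))\<bar> \<le> \<epsilon>" if f: "f \<in> feats_closure X" for f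
  proof -
    obtain p h where p: "p \<in> L" and h: "h \<in> N" and "ky_fan (msr X) f (compose (pts X) p h) < \<delta>"
      using N(3) f unfolding open_nbhd_def postcompose_def by blast
    then obtain e where e: "e \<ge> 0" "e < \<delta>" "measure (msr X) {x \<in> pts X. \<bar>f x - compose (pts X) p h x\<bar> > e} \<le> e"
      using X.prob.ky_fan_less_iff by (auto simp: X.space_msr)
    have h': "h \<in> feats_closure X" using N h by blast
    have "\<bar>f (x i) - p (of_rat (V h ! i))\<bar> \<le> \<epsilon>" if i: "i \<in> I" for i
    proof -
      have "\<exists>y\<in>pts X. c y = i \<and> \<bar>f y - p (h y)\<bar> \<le> e"
      proof (rule ccontr)
        assume "\<not> (\<exists>y\<in>pts X. c y = i \<and> \<bar>f y - p (h y)\<bar> \<le> e)"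
        then have sub: "{x\<in>pts X. c x = i} \<subseteq> {x \<in> space (msr X). \<bar>f x - p (h x)\<bar> > e}" by (force simp: X.space_msr)
        note [measurable] = X.measurable_feats_closure[OF f] X.measurable_feats_closure[OF h'] monoidal_measurable[OF L p]
        have "{x \<in> space (msr X). \<bar>f x - p (h x)\<bar> > e} \<in> sets (msr X)" by measurable
        then have "measure (msr X) {x\<in>pts X. c x = i} \<le> measure (msr X) {x \<in> space (msr X). \<bar>f x - p (h x)\<bar> > e}"
          by (rule X.prob.finite_measure_mono[OF sub])
        also have "{x \<in> space (msr X). \<bar>f x - p (h x)\<bar> > e} = {x \<in> pts X. \<bar>f x - compose (pts X) p h x\<bar> > e}"
          by (auto simp: X.space_msr compose_def)
        finally show False using e \<delta>(3)[OF i] by linarith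
      qed
      then obtain y where y: "y \<in> pts X" "c y = i" "\<bar>f y - p (h y)\<bar> \<le> e" by blast
      have "\<bar>f (x i) - f y\<bar> \<le> \<eta>" "\<bar>h (x i) - h y\<bar> \<le> \<eta>"
        using small[of "x i" y] x[OF i] y f h' by auto
      moreover have "\<bar>p (h (x i)) - p (h y)\<bar> \<le> \<bar>h (x i) - h y\<bar>"
        "\<bar>p (h (x i)) - p (of_rat (V h ! i))\<bar> \<le> \<bar>h (x i) - of_rat (V h ! i)\<bar>"
        by (rule monoidal_lipschitz[OF L p])+
      ultimately show ?thesis using V[OF i, of h] y(3) e(2) \<delta>(2) \<eta>(2) by linarith
    qed
    then show ?thesis using p h vs "is" by blast
  qed
  have pf: "\<exists>f\<in>feats_closure X. \<forall>i\<in>set is. \<bar>f (x i) - p (of_rat (v ! i))\<bar> \<le> \<epsilon>" if p: "p \<in> L" and v: "v \<in> set vs" for p v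
  proof -
    obtain h where h: "h \<in> N" "v = V h" using v vs by blast
    have "compose (pts X) p h \<in> postcompose X L (feats_closure X)"
      using p h N(2) by (auto simp: postcompose_def)
    then have "compose (pts X) p h \<in> feats_closure X" using post by blast
    moreover have "\<bar>compose (pts X) p h (x i) - p (of_rat (v ! i))\<bar> \<le> \<epsilon>" if i: "i \<in> I" for i
      using monoidal_lipschitz[OF L p, of "h (x i)" "of_rat (v ! i)"] V[OF i, of h] h(2) x[OF i] \<eta>
      by (simp add: compose_def)
    ultimately show ?thesis using "is" by blast
  qed
  have "1 - \<epsilon> \<le> (\<Sum>i\<in>set is. measure (msr X) {x\<in>pts X. c x = i})"
    using large \<eta> X.prob.prob_cells[OF c I] by (simp add: X.space_msr "is")
  moreover have "\<bar>f a - f b\<bar> \<le> \<epsilon>" if "a \<in> pts X" "b \<in> pts X" "c a = c b" "f \<in> feats_closure X" for a b f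
    using small[OF that] \<eta> by linarith
  moreover have "\<forall>i\<in>set is. \<bar>measure (msr X) {x\<in>pts X. c x = i} - of_rat (ws ! i)\<bar> \<le> \<epsilon> / Suc (length is)"
    using ws by (simp add: "is" abs_minus_commute)
  ultimately have "profile L X k is ws vs"
    unfolding profile_def \<epsilon>_def[symmetric] using c x "is" fp pf
    by (intro exI[of _ c] exI[of _ x]) simp
  then show ?thesis by blast
qed

section \<open>Completeness and separability\<close>

lemma near_mono:
  assumes near: "near e X Y" and ed: "e \<le> d"
  shows "near d X Y"
proof -
  obtain \<pi> T where \<pi>: "\<pi> \<in> couplings (msr X) (msr Y)"
    and T: "closedin (prod_topology (ftop X) (ftop Y)) T" "T \<noteq> {}" "1 - e \<le> measure \<pi> T"
    and XY: "\<And>f. f \<in> feats_closure X \<Longrightarrow> \<exists>g\<in>feats_closure Y. \<forall>(x, y)\<in>T. \<bar>f x - g y\<bar> \<le> e"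
    and YX: "\<And>g. g \<in> feats_closure Y \<Longrightarrow> \<exists>f\<in>feats_closure X. \<forall>(x, y)\<in>T. \<bar>f x - g y\<bar> \<le> e"
    using near unfolding near_def by blast
  have mono: "\<forall>(x, y)\<in>T. \<bar>f x - g y\<bar> \<le> d" if "\<forall>(x, y)\<in>T. \<bar>f x - g y\<bar> \<le> e" for f g
    using that ed by (auto intro: order_trans)
  have "\<exists>g\<in>feats_closure Y. \<forall>(x, y)\<in>T. \<bar>f x - g y\<bar> \<le> d" if "f \<in> feats_closure X" for f
    using XY[OF that] mono[of f] by blast
  moreover have "\<exists>f\<in>feats_closure X. \<forall>(x, y)\<in>T. \<bar>f x - g y\<bar> \<le> d" if "g \<in> feats_closure Y" for g
    using YX[OF that] mono[of _ g] by blast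
  moreover have "1 - d \<le> measure \<pi> T" using T(3) ed by linarith
  ultimately show ?thesis unfolding near_def using \<pi> T by blast
qed

lemma near_chain_limit:
  fixes X :: "nat \<Rightarrow> 'a data_set"
  assumes universe: "(UNIV :: real set) \<lesssim> (UNIV :: 'b set)" and L: "monoidal L"
    and X: "\<And>n. geometric_data_set (X n)"
    and post: "\<And>n. postcompose (X n) L (feats_closure (X n)) \<subseteq> feats_closure (X n)"
    and e_pos: "\<And>n. 0 < e n" and e_Suc: "\<And>n. e (Suc n) = e n / 2"
    and near: "\<And>n. near (e n) (X n) (X (Suc n))"
  obtains Z :: "'b data_set" where "geometric_data_set Z"
    "postcompose Z L (feats_closure Z) \<subseteq> feats_closure Z"
    "\<And>(Y :: 'c data_set) d n. geometric_data_set Y \<Longrightarrow> near d Y (X n) \<Longrightarrow> d + 7 * e n < 1 \<Longrightarrow> near (d + 7 * e n) Y Z"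
proof -
  define QT where "QT n \<pi> T \<longleftrightarrow> \<pi> \<in> couplings (msr (X n)) (msr (X (Suc n))) \<and>
      T \<in> sets (msr (X n) \<Otimes>\<^sub>M msr (X (Suc n))) \<and> 1 - e n \<le> measure \<pi> T \<and>
      (\<forall>f\<in>feats_closure (X n). \<exists>g\<in>feats_closure (X (Suc n)). \<forall>(x, y)\<in>T. \<bar>f x - g y\<bar> \<le> e n) \<and>
      (\<forall>g\<in>feats_closure (X (Suc n)). \<exists>f\<in>feats_closure (X n). \<forall>(x, y)\<in>T. \<bar>f x - g y\<bar> \<le> e n)" for n \<pi> T
  have "\<exists>\<pi> T. QT n \<pi> T" for n
    using near[of n] closedin_prod_measurable[OF X X, of n "Suc n"] unfolding near_def QT_def by blast
  then obtain \<pi> T where \<pi>T: "\<And>n. QT n (\<pi> n) (T n)" by metis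
  define QC where "QC n c I \<longleftrightarrow> c \<in> measurable (msr (X n)) (count_space (UNIV :: nat set)) \<and> finite I \<and>
      1 - e n \<le> measure (msr (X n)) {x\<in>pts (X n). c x \<in> I} \<and>
      (\<forall>x\<in>pts (X n). \<forall>y\<in>pts (X n). c x = c y \<longrightarrow> (\<forall>f\<in>feats_closure (X n). \<bar>f x - f y\<bar> \<le> e n))" for n c I
  have "\<exists>c I. QC n c I" for n
    by (rule gds.discretization[OF gds.intro[OF X] e_pos[of n]]) (unfold QC_def, intro exI conjI)
  then obtain c I where cI: "\<And>n. QC n (c n) (I n)" by metis
  interpret box_chain X e \<pi> T c I
    by (rule box_chain.intro) (use X e_pos e_Suc \<pi>T cI in \<open>auto simp: QT_def QC_def\<close>)
  obtain P :: "(nat \<Rightarrow> nat) measure" where P: "prob_space P"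
    "\<And>n. (\<lambda>\<omega>. \<omega> n) \<in> measurable P (count_space UNIV)"
    "\<And>n a b. emeasure P {\<omega>\<in>space P. \<omega> n = a \<and> \<omega> (Suc n) = b} = emeasure (cell_law n) {(a, b)}"
  proof (rule markov_chain_exists[of cell_law])
    show "prob_space (cell_law n)" for n
      unfolding cell_law_def by (rule \<pi>.prob_space_distr) measurable
    show "sets (cell_law n) = UNIV" for n by (simp add: cell_law_def)
    show "emeasure (cell_law n) (UNIV \<times> {b}) = emeasure (cell_law (Suc n)) ({b} \<times> UNIV)" for n b
      by (simp only: cell_law_fst cell_law_snd)
  qed (rule that; blast)
  interpret P: prob_space P by (rule P(1))
  interpret box_markov_chain X e \<pi> T c I P
    by unfold_locales (rule P)+
  show thesis
    using limit_exists[OF universe L post] that by blast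
qed

section \<open>Representatives of isomorphism classes\<close>

lemma isomorphic_refl:
  assumes X: "geometric_data_set X"
  shows "isomorphic X X"
proof -
  interpret gds X by (rule gds.intro) fact
  have "compose (pts X) g id = g" if "g \<in> feats_closure X" for g
    using feats_closure_extensional[OF that] by (simp add: compose_def extensional_restrict)
  then have "(\<lambda>g. compose (pts X) g id) ` feats_closure X = feats_closure X" by force
  then show ?thesis
    unfolding isomorphic_def by (intro exI[of _ id] conjI bij_betw_id) (simp_all add: id_def distr_id2)
qed

lemma L_compact_geometric: "L_compact L X \<Longrightarrow> geometric_data_set X"
  by (simp add: L_compact_def)

text \<open>\<open>box_class\<close> evaluates at an unspecified member of the class; whatever is
  known about \<open>Y\<close> reaches that member only through the isomorphism.\<close>

lemma iso_class_representative:
  assumes L: "monoidal L" and Y: "L_compact L Y"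
  shows "L_compact L (SOME X. X \<in> iso_rel `` {Y})" and "isomorphic Y (SOME X. X \<in> iso_rel `` {Y})"
proof -
  have "Y \<in> iso_rel `` {Y}"
    using isomorphic_refl[OF L_compact_geometric[OF Y]] L_compact_geometric[OF Y] by (simp add: iso_rel_def)
  then have "(SOME X. X \<in> iso_rel `` {Y}) \<in> iso_rel `` {Y}" by (rule someI[of "\<lambda>X. X \<in> iso_rel `` {Y}"])
  then show "isomorphic Y (SOME X. X \<in> iso_rel `` {Y})" "L_compact L (SOME X. X \<in> iso_rel `` {Y})"
    using L_compact_isomorphic[OF L Y] by (auto simp: iso_rel_def)
qed

lemma class_representative:
  assumes "monoidal L" "A \<in> L_compact_classes L"
  shows "L_compact L (SOME X. X \<in> A)"
  using assms iso_class_representative(1) by (auto simp: L_compact_classes_def quotient_def)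

lemma box_complete:
  fixes X :: "nat \<Rightarrow> 'a data_set"
  assumes L: "monoidal L" and universe: "(UNIV :: real set) \<lesssim> (UNIV :: 'b set)"
    and X: "\<And>n. L_compact L (X n)"
    and cauchy: "\<And>\<epsilon> :: ennreal. \<epsilon> > 0 \<Longrightarrow> \<exists>N. \<forall>m\<ge>N. \<forall>n\<ge>N. box_dist (X m) (X n) < \<epsilon>"
  shows "\<exists>Z :: 'b data_set. L_compact L Z \<and> (\<forall>d>0. \<exists>N. \<forall>n\<ge>N. near d (X n) Z)"
proof -
  \<comment> \<open>Starting at \<open>1 / 16\<close> keeps
    \<open>e n + 7 * e n \<le> 1 / 2\<close>, below the bound \<open>1\<close> that the comparison
    with the limit requires.\<close>
  define e where "e n = (1 / 2) ^ n / (16 :: real)" for n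
  have e: "0 < e n" "e (Suc n) = e n / 2" "e n \<le> 1 / 16" for n
    by (auto simp: e_def power_le_one)
  have gX: "geometric_data_set (X n)" for n using X by (rule L_compact_geometric)
  have "\<exists>N. \<forall>m\<ge>N. \<forall>k\<ge>N. box_dist (X m) (X k) < ennreal (e n)" for n
    using cauchy[of "ennreal (e n)"] e(1)[of n] by simp
  then obtain K where K: "\<And>n m k. m \<ge> K n \<Longrightarrow> k \<ge> K n \<Longrightarrow> box_dist (X m) (X k) < ennreal (e n)" by metis
  \<comment> \<open>Partial sums are nondecreasing and dominate \<open>K n\<close>, so both
    \<open>s n\<close> and \<open>s (Suc n)\<close> lie beyond the threshold
    \<open>K n\<close>.\<close>
  define s where "s n = (\<Sum>j\<le>n. K j)" for n
  have s: "K n \<le> s n" "K n \<le> s (Suc n)" for n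
    using member_le_sum[of n "{..n}" K] by (auto simp: s_def)
  have near: "near (e n) (X m) (X (s n))" if "m \<ge> K n" for m n
    using K[OF that s(1)] by (rule box_dist_less_imp_near)
  obtain Z :: "'b data_set" where Z: "geometric_data_set Z" "postcompose Z L (feats_closure Z) \<subseteq> feats_closure Z"
    "\<And>(Y :: 'a data_set) d n. geometric_data_set Y \<Longrightarrow> near d Y (X (s n)) \<Longrightarrow> d + 7 * e n < 1 \<Longrightarrow> near (d + 7 * e n) Y Z"
  proof (rule near_chain_limit[OF universe L, of "\<lambda>n. X (s n)" e])
    show "postcompose (X (s n)) L (feats_closure (X (s n))) \<subseteq> feats_closure (X (s n))" for n
      using X by (simp add: L_compact_def)
    show "near (e n) (X (s n)) (X (s (Suc n)))" for n
      using K[OF s(1) s(2)] by (rule box_dist_less_imp_near)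
  qed (use gX e in auto)
  have conv: "\<exists>N. \<forall>m\<ge>N. near d (X m) Z" if "d > 0" for d
  proof -
    have "(\<lambda>n. e n) \<longlonglongrightarrow> 0 / 16"
      unfolding e_def by (intro tendsto_intros LIMSEQ_realpow_zero) auto
    then have "\<forall>\<^sub>F n in sequentially. e n < d / 8"
      using that by (intro order_tendstoD(2)) auto
    then obtain n where "e n < d / 8" by (meson eventually_happens' sequentially_bot)
    then have n: "8 * e n < d" by simp
    \<comment> \<open>Taking \<open>X m\<close> itself as the space compared with the limit gives
      convergence of the whole sequence at once, not only of the subsequence.\<close>
    have "near (8 * e n) (X m) Z" if "m \<ge> K n" for m
      using Z(3)[OF gX near[OF that]] e(3)[of n] by simp
    then show ?thesis using near_mono n by (meson less_imp_le)
  qed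
  have "L_compact L Z"
  proof (rule L_compact_if_near[OF L Z(1,2)])
    fix d :: real assume "0 < d" "d < 1"
    then show "\<exists>Y :: 'a data_set. L_compact L Y \<and> near d Y Z" using conv X by blast
  qed
  then show ?thesis using conv by blast
qed

theorem theorem1p1:
  fixes L :: "(real \<Rightarrow> real) set"
  assumes "monoidal L"
    and universe: "(UNIV :: real set) \<lesssim> (UNIV :: 'a set)"
  shows
    "(\<forall>\<sigma> :: nat \<Rightarrow> 'a data_set set.
        range \<sigma> \<subseteq> L_compact_classes L \<and>
        (\<forall>\<epsilon>>0. \<exists>N. \<forall>m\<ge>N. \<forall>n\<ge>N. box_class (\<sigma> m) (\<sigma> n) < \<epsilon>) \<longrightarrow>
        (\<exists>A :: 'a data_set set \<in> L_compact_classes L. (\<lambda>n. box_class (\<sigma> n) A) \<longlonglongrightarrow> 0)) \<and>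
     (\<exists>C :: 'a data_set set set.
        countable C \<and> C \<subseteq> L_compact_classes L \<and>
        (\<forall>A :: 'a data_set set \<in> L_compact_classes L. \<forall>\<epsilon>>0. \<exists>B\<in>C. box_class A B < \<epsilon>))"
proof (intro conjI allI impI)
  note L = \<open>monoidal L\<close>
  fix \<sigma> :: "nat \<Rightarrow> 'a data_set set"
  assume \<sigma>: "range \<sigma> \<subseteq> L_compact_classes L \<and>
        (\<forall>\<epsilon>>0. \<exists>N. \<forall>m\<ge>N. \<forall>n\<ge>N. box_class (\<sigma> m) (\<sigma> n) < \<epsilon>)"
  define X where "X n = (SOME X. X \<in> \<sigma> n)" for n
  have X: "L_compact L (X n)" for n
    unfolding X_def using \<sigma> by (intro class_representative[OF L]) auto
  have "\<exists>Z :: 'a data_set. L_compact L Z \<and> (\<forall>d>0. \<exists>N. \<forall>n\<ge>N. near d (X n) Z)"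
    by (rule box_complete[OF L universe X]) (use \<sigma> in \<open>simp add: box_class_def X_def\<close>)
  then obtain Z :: "'a data_set" where Z: "L_compact L Z" and near: "\<And>d. d > 0 \<Longrightarrow> \<exists>N. \<forall>n\<ge>N. near d (X n) Z"
    by blast
  define A where "A = iso_rel `` {Z}"
  have "A \<in> L_compact_classes L"
    unfolding A_def L_compact_classes_def using Z by (intro quotientI) simp
  moreover have "(\<lambda>n. box_class (\<sigma> n) A) \<longlonglongrightarrow> 0"
  proof (rule order_tendstoI)
    fix \<epsilon> :: ennreal assume "0 < \<epsilon>"
    then obtain r where r: "0 < r" "ennreal r < \<epsilon>"
      using dense[of 0 \<epsilon>] by (metis ennreal_cases ennreal_less_zero_iff less_top_ennreal not_less_iff_gr_or_eq order.strict_trans1 top_greatest)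
    \<comment> \<open>\<open>r / 2\<close> absorbs the factor \<open>2\<close> of
      \<open>near_imp_box_dist_le\<close>; the cap keeps \<open>d < 1\<close> for
      \<open>near_isomorphic\<close>.\<close>
    define d where "d = min (r / 2) (1 / 2)"
    have d: "0 < d" "d < 1" "2 * d \<le> r" using r by (auto simp: d_def)
    obtain N where N: "\<And>n. n \<ge> N \<Longrightarrow> near d (X n) Z" using near[OF d(1)] by blast
    have "box_class (\<sigma> n) A < \<epsilon>" if "n \<ge> N" for n
    proof -
      let ?Z = "SOME Z'. Z' \<in> A"
      have "near d (X n) ?Z"
        unfolding A_def
        by (rule near_isomorphic[OF L_compact_geometric[OF X] L_compact_geometric[OF Z]
              L_compact_geometric[OF iso_class_representative(1)[OF L Z]]
              iso_class_representative(2)[OF L Z] N[OF that] d(2)])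
      then have "box_dist (X n) ?Z \<le> ennreal (2 * d)"
        by (rule near_imp_box_dist_le[OF L_compact_geometric[OF X]])
      also have "\<dots> \<le> ennreal r" using d(3) by (rule ennreal_leI)
      finally show ?thesis using r(2) by (simp add: box_class_def X_def)
    qed
    then show "\<forall>\<^sub>F n in sequentially. box_class (\<sigma> n) A < \<epsilon>"
      by (auto simp: eventually_sequentially)
  qed simp
  ultimately show "\<exists>A :: 'a data_set set \<in> L_compact_classes L. (\<lambda>n. box_class (\<sigma> n) A) \<longlonglongrightarrow> 0" by blast
next
  note L = \<open>monoidal L\<close>
  define D :: "nat \<times> nat list \<times> rat list \<times> rat list list \<Rightarrow> 'a data_set set set" where
    "D = (\<lambda>(k, is, ws, vs). {A \<in> L_compact_classes L. profile L (SOME X. X \<in> A) k is ws vs})"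
  \<comment> \<open>One class for each profile code that occurs; the codes
    \<open>(k, is, ws, vs)\<close> range over a countable type.\<close>
  define C where "C = (\<lambda>t. SOME A. A \<in> D t) ` {t. D t \<noteq> {}}"
  have C: "(SOME A. A \<in> D t) \<in> D t" if "D t \<noteq> {}" for t using that by (simp add: some_in_eq)
  have "countable C" by (simp add: C_def)
  moreover have "C \<subseteq> L_compact_classes L"
  proof
    fix A assume "A \<in> C"
    then obtain t where "A = (SOME A. A \<in> D t)" "D t \<noteq> {}" unfolding C_def by blast
    then have "A \<in> D t" using C by simp
    then show "A \<in> L_compact_classes L" by (auto simp: D_def split: prod.splits)
  qed
  moreover have "\<exists>B\<in>C. box_class A B < \<epsilon>" if A: "A \<in> L_compact_classes L" and \<epsilon>: "0 < \<epsilon>" for A :: "'a data_set set" and \<epsilon>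
  proof -
    obtain r where r: "0 < r" "ennreal r < \<epsilon>"
      using \<epsilon> dense[of 0 \<epsilon>] by (metis ennreal_cases ennreal_less_zero_iff less_top_ennreal not_less_iff_gr_or_eq order.strict_trans1 top_greatest)
    \<comment> \<open>\<open>8 / r\<close> yields \<open>2 * (4 / Suc k) \<le> r\<close>, and the
      extra \<open>4\<close> yields the bound \<open>4 < Suc k\<close> of
      \<open>profile_near\<close>.\<close>
    obtain k where k: "8 / r + 4 < real k" using reals_Archimedean2 by blast
    moreover have "0 < 8 / r" using r(1) by simp
    ultimately have "4 < real k" and "8 / r < Suc k" by linarith+
    then have k4: "4 < Suc k" by simp
    have kr: "2 * (4 / Suc k) \<le> r" using r(1) \<open>8 / r < Suc k\<close> by (simp add: field_simps)
    obtain "is" ws vs where t: "profile L (SOME X. X \<in> A) k is ws vs"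
      using profile_exists[OF L class_representative[OF L A]] by blast
    let ?t = "(k, is, ws, vs)"
    have "A \<in> D ?t" using A t by (simp add: D_def)
    then have ne: "D ?t \<noteq> {}" by blast
    define B where "B = (SOME A. A \<in> D ?t)"
    have "B \<in> D ?t" unfolding B_def by (rule C[OF ne])
    then have B: "B \<in> L_compact_classes L" "profile L (SOME X. X \<in> B) k is ws vs" by (simp_all add: D_def)
    have "near (4 / Suc k) (SOME X. X \<in> A) (SOME X. X \<in> B)"
      by (rule profile_near[OF L_compact_geometric[OF class_representative[OF L A]]
            L_compact_geometric[OF class_representative[OF L B(1)]] t B(2) k4])
    then have "box_class A B \<le> ennreal (2 * (4 / Suc k))"
      unfolding box_class_def by (rule near_imp_box_dist_le[OF L_compact_geometric[OF class_representative[OF L A]]])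
    also have "\<dots> \<le> ennreal r" using kr by (rule ennreal_leI)
    finally have "box_class A B < \<epsilon>" using r(2) by (rule le_less_trans)
    moreover have "B \<in> C" using ne by (auto simp: C_def B_def)
    ultimately show ?thesis by blast
  qed
  ultimately show "\<exists>C :: 'a data_set set set.
        countable C \<and> C \<subseteq> L_compact_classes L \<and>
        (\<forall>A :: 'a data_set set \<in> L_compact_classes L. \<forall>\<epsilon>>0. \<exists>B\<in>C. box_class A B < \<epsilon>)" by blast
qed

end
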